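(* Let $p$ be an odd prime and let $G$ be a group of order $p^5$ in the isoclinism family $\Phi_4$. For each subgroup $K<Z(G)$ with $K\cong C_p$, let $m_K$ and $m_K'$ denote the exponents of $Z(G/K)$ and $Z(G/K)/(G/K)'$, respectively, and for a positive integer $d_K$ let $a_{d_K}$ and $a_{d_K}'$ be the number of cyclic subgroups of order $d_K$ of $Z(G/K)$ and of $Z(G/K)/(G/K)'$, respectively. Then the Wedderburn decomposition of $\mathbb{Q}G$ is $$\mathbb{Q}G\cong \mathbb{Q}(G/G')\ \oplus\bigoplus_{C_p\cong K<Z(G)}\ \bigoplus_{\substack{d_K\mid m_K\\ d_K\nmid m_K'}}a_{d_K}M_p(\mathbb{Q}(\zeta_{d_K}))\ \oplus\bigoplus_{C_p\cong K<Z(G)}\ \bigoplus_{\substack{d_K\mid m_K\\ d_K\mid m_K'}}(a_{d_K}-a_{d_K}')M_p(\mathbb{Q}(\zeta_{d_K})).$$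
   Context: $\zeta_d$ is a primitive $d$-th root of unity; $M_n(D)$ is the ring of $n\times n$ matrices over $D$; $aR$ denotes the direct sum of $a$ copies of the algebra $R$; $d_K$ ranges over positive divisors. Two groups $G,H$ are isoclinic if there are isomorphisms $G/Z(G)\to H/Z(H)$ and $G'\to H'$ compatible with the commutator maps. $\Phi_4$ (R. James) is the isoclinism family of the order-$p^5$ group $\Phi_4(1^5)=\langle\alpha,\alpha_1,\alpha_2,\beta_1,\beta_2:[\alpha_i,\alpha]=\beta_i,\ \alpha^p=\alpha_i^p=\beta_i^p=1\ (i=1,2)\rangle$, with unlisted commutators of generators trivial. For groups of order $p^5$ in $\Phi_4$ one has $Z(G)=G'\cong C_p\times C_p$. *)

theory Defs
  imports "HOL-Algebra.Algebra" "HOL-Algebra.Algebraic_Closure_Type" "Jordan_Normal_Form.Matrix"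
begin

section \<open>Groups\<close>

definition centre :: "('a, 'b) monoid_scheme \<Rightarrow> 'a set" where
  "centre G = {z \<in> carrier G. \<forall>x\<in>carrier G. z \<otimes>\<^bsub>G\<^esub> x = x \<otimes>\<^bsub>G\<^esub> z}"

definition commutator :: "('a, 'b) monoid_scheme \<Rightarrow> 'a \<Rightarrow> 'a \<Rightarrow> 'a" where
  "commutator G x y = inv\<^bsub>G\<^esub> x \<otimes>\<^bsub>G\<^esub> inv\<^bsub>G\<^esub> y \<otimes>\<^bsub>G\<^esub> x \<otimes>\<^bsub>G\<^esub> y"

abbreviation commutator_subgroup :: "('a, 'b) monoid_scheme \<Rightarrow> 'a set" where
  "commutator_subgroup G \<equiv> derived G (carrier G)"

text \<open>The commutator maps are regarded as maps
  \<open>G/Z(G) \<times> G/Z(G) \<rightarrow> G'\<close>, evaluated on coset representatives.\<close>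

definition isoclinic :: "('a, 'b) monoid_scheme \<Rightarrow> ('c, 'd) monoid_scheme \<Rightarrow> bool" where
  "isoclinic G H \<longleftrightarrow>
     (\<exists>\<phi> \<in> iso (G Mod centre G) (H Mod centre H).
      \<exists>\<psi> \<in> iso (G\<lparr>carrier := commutator_subgroup G\<rparr>) (H\<lparr>carrier := commutator_subgroup H\<rparr>).
        \<forall>x\<in>carrier G. \<forall>y\<in>carrier G. \<forall>x'\<in>carrier H. \<forall>y'\<in>carrier H.
          \<phi> (centre G #>\<^bsub>G\<^esub> x) = centre H #>\<^bsub>H\<^esub> x' \<longrightarrow>
          \<phi> (centre G #>\<^bsub>G\<^esub> y) = centre H #>\<^bsub>H\<^esub> y' \<longrightarrow>
          \<psi> (commutator G x y) = commutator H x' y')"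

definition group_exponent :: "('a, 'b) monoid_scheme \<Rightarrow> nat" where
  "group_exponent G = (LEAST n. 0 < n \<and> (\<forall>x\<in>carrier G. x [^]\<^bsub>G\<^esub> n = \<one>\<^bsub>G\<^esub>))"

definition num_cyclic_subgroups :: "('a, 'b) monoid_scheme \<Rightarrow> nat \<Rightarrow> nat" where
  "num_cyclic_subgroups G d =
     card {H. subgroup H G \<and> cyclic_group (G\<lparr>carrier := H\<rparr>) \<and> card H = d}"

section \<open>Groups given by generators and relations\<close>

text \<open>A word is a list of letters \<open>(e, x)\<close>, standing for the generator \<open>x\<close> if \<open>e\<close> is
  \<^const>\<open>True\<close> and for its inverse otherwise. All elements of the type \<open>'g\<close> are generators;
  a pair \<open>(u, v)\<close> in \<open>R\<close> is the relation \<open>u = v\<close>.\<close>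

type_synonym 'g word = "(bool \<times> 'g) list"

inductive word_eq :: "('g word \<times> 'g word) set \<Rightarrow> 'g word \<Rightarrow> 'g word \<Rightarrow> bool"
  for R :: "('g word \<times> 'g word) set" where
  word_rel: "(u, v) \<in> R \<Longrightarrow> word_eq R u v"
| word_cancel: "word_eq R [(e, x), (\<not> e, x)] []"
| word_refl: "word_eq R u u"
| word_sym: "word_eq R u v \<Longrightarrow> word_eq R v u"
| word_trans: "word_eq R u v \<Longrightarrow> word_eq R v w \<Longrightarrow> word_eq R u w"
| word_append: "word_eq R u u' \<Longrightarrow> word_eq R v v' \<Longrightarrow> word_eq R (u @ v) (u' @ v')"

definition presented_group :: "('g word \<times> 'g word) set \<Rightarrow> 'g word set monoid" where
  "presented_group R =
     \<lparr> carrier = UNIV // {(u, v). word_eq R u v},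
       monoid.mult = (\<lambda>U V. {w. \<exists>u\<in>U. \<exists>v\<in>V. word_eq R (u @ v) w}),
       one = {w. word_eq R [] w} \<rparr>"

definition word_gen :: "'g \<Rightarrow> 'g word" where
  "word_gen x = [(True, x)]"

definition word_inv :: "'g word \<Rightarrow> 'g word" where
  "word_inv u = map (\<lambda>(e, x). (\<not> e, x)) (rev u)"

definition word_commutator :: "'g word \<Rightarrow> 'g word \<Rightarrow> 'g word" where
  "word_commutator u v = word_inv u @ word_inv v @ u @ v"

definition word_pow :: "'g word \<Rightarrow> nat \<Rightarrow> 'g word" where
  "word_pow u n = concat (replicate n u)"

datatype phi4_gen = Alpha | Alpha1 | Alpha2 | Beta1 | Beta2

definition phi4_relations :: "nat \<Rightarrow> (phi4_gen word \<times> phi4_gen word) set" where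
  "phi4_relations p =
     {(word_commutator (word_gen Alpha1) (word_gen Alpha), word_gen Beta1),
      (word_commutator (word_gen Alpha2) (word_gen Alpha), word_gen Beta2)}
     \<union> {(word_commutator (word_gen x) (word_gen y), []) | x y.
          {x, y} \<noteq> {Alpha1, Alpha} \<and> {x, y} \<noteq> {Alpha2, Alpha}}
     \<union> {(word_pow (word_gen x) p, []) | x. True}"

text \<open>The group \<open>\<Phi>\<^sub>4(1\<^sup>5)\<close>, and membership in its isoclinism family \<open>\<Phi>\<^sub>4\<close>.\<close>

definition phi4_group :: "nat \<Rightarrow> phi4_gen word set monoid" where
  "phi4_group p = presented_group (phi4_relations p)"

definition in_phi4 :: "nat \<Rightarrow> ('a, 'b) monoid_scheme \<Rightarrow> bool" where
  "in_phi4 p G \<longleftrightarrow> isoclinic G (phi4_group p)"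

section \<open>Rational algebras\<close>

text \<open>The locale \<^locale>\<open>algebra\<close> requires commutative multiplication. Therefore rational
  algebras are only given here as records of type \<open>(rat, 'a) module\<close>, consisting of a ring
  together with a scalar multiplication by rational numbers.\<close>

definition alg_isomorphic :: "(rat, 'a) module \<Rightarrow> (rat, 'b) module \<Rightarrow> bool" where
  "alg_isomorphic A B \<longleftrightarrow>
     (\<exists>h \<in> ring_iso A B. \<forall>c. \<forall>x\<in>carrier A. h (c \<odot>\<^bsub>A\<^esub> x) = c \<odot>\<^bsub>B\<^esub> h x)"

text \<open>Elements \<open>\<Sum> f(x) x\<close> of the group algebra are represented by their coefficient functions
  \<open>f\<close>, which vanish outside the group.\<close>

definition group_algebra :: "('a, 'b) monoid_scheme \<Rightarrow> (rat, 'a \<Rightarrow> rat) module" where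
  "group_algebra G =
     \<lparr> carrier = {f. finite {x. f x \<noteq> 0} \<and> (\<forall>x. x \<notin> carrier G \<longrightarrow> f x = 0)},
       monoid.mult = (\<lambda>f g x. if x \<in> carrier G
                 then \<Sum>y\<in>{y \<in> carrier G. f y \<noteq> 0}. f y * g (inv\<^bsub>G\<^esub> y \<otimes>\<^bsub>G\<^esub> x) else 0),
       one = (\<lambda>x. if x = \<one>\<^bsub>G\<^esub> then 1 else 0),
       ring.zero = (\<lambda>x. 0),
       add = (\<lambda>f g x. f x + g x),
       module.smult = (\<lambda>c f x. c * f x) \<rparr>"

definition alg_sum :: "(rat, 'a) module \<Rightarrow> (rat, 'b) module \<Rightarrow> (rat, 'a \<times> 'b) module"
    (infixr \<open>\<oplus>\<^sub>a\<close> 65) where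
  "A \<oplus>\<^sub>a B = ring.extend (RDirProd A B)
     \<lparr> module.smult = (\<lambda>c (x, y). (c \<odot>\<^bsub>A\<^esub> x, c \<odot>\<^bsub>B\<^esub> y)) \<rparr>"

text \<open>Only finite index sets are intended here, so that the direct sum consists of all families.
  Over the empty index set it is the zero algebra.\<close>

definition alg_Sum :: "'i set \<Rightarrow> ('i \<Rightarrow> (rat, 'a) module) \<Rightarrow> (rat, 'i \<Rightarrow> 'a) module" where
  "alg_Sum I A =
     \<lparr> carrier = (\<Pi>\<^sub>E i\<in>I. carrier (A i)),
       monoid.mult = (\<lambda>f g. \<lambda>i\<in>I. f i \<otimes>\<^bsub>A i\<^esub> g i),
       one = (\<lambda>i\<in>I. \<one>\<^bsub>A i\<^esub>),
       ring.zero = (\<lambda>i\<in>I. \<zero>\<^bsub>A i\<^esub>),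
       add = (\<lambda>f g. \<lambda>i\<in>I. f i \<oplus>\<^bsub>A i\<^esub> g i),
       module.smult = (\<lambda>c f. \<lambda>i\<in>I. c \<odot>\<^bsub>A i\<^esub> f i) \<rparr>"

definition alg_copies :: "nat \<Rightarrow> (rat, 'a) module \<Rightarrow> (rat, nat \<Rightarrow> 'a) module" where
  "alg_copies a A = alg_Sum {..<a} (\<lambda>_. A)"

definition primitive_root_of_unity :: "nat \<Rightarrow> complex \<Rightarrow> bool" where
  "primitive_root_of_unity d z \<longleftrightarrow> 0 < d \<and> z ^ d = 1 \<and> (\<forall>k. 0 < k \<and> k < d \<longrightarrow> z ^ k \<noteq> 1)"

text \<open>The subfield \<open>\<rat>(z)\<close> of the complex numbers.\<close>

definition rat_adjoin :: "complex \<Rightarrow> complex set" where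
  "rat_adjoin z = generate_field ring_of_type_algebra {z}"

text \<open>The algebra of \<open>n \<times> n\<close> matrices over a subfield \<open>D\<close> of the complex numbers.\<close>

definition matrix_algebra :: "nat \<Rightarrow> complex set \<Rightarrow> (rat, complex mat) module" where
  "matrix_algebra n D =
     ring.extend ((ring_mat TYPE(complex) n ())
         \<lparr>carrier := {A \<in> carrier_mat n n. elements_mat A \<subseteq> D}\<rparr>)
       \<lparr> module.smult = (\<lambda>c A. of_rat c \<cdot>\<^sub>m A) \<rparr>"

section \<open>The data indexing the decomposition\<close>

definition central_Cp_subgroups :: "nat \<Rightarrow> ('a, 'b) monoid_scheme \<Rightarrow> 'a set set" where
  "central_Cp_subgroups p G =
     {K. subgroup K G \<and> K \<subset> centre G \<and> G\<lparr>carrier := K\<rparr> \<cong> integer_mod_group p}"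

text \<open>The groups \<open>Z(G/K)\<close> and \<open>Z(G/K)/(G/K)'\<close>. The latter is meaningful only if
  \<open>(G/K)' \<subseteq> Z(G/K)\<close>, that is, if \<open>G/K\<close> has nilpotency class at most 2. In that case it is a
  quotient of the abelian group \<open>Z(G/K)\<close>; so, for finite \<open>G\<close>, it has at most as many cyclic
  subgroups of any given order as \<open>Z(G/K)\<close>, and subtracting the two numbers in \<^typ>\<open>nat\<close>
  does not truncate.\<close>

definition quot_centre :: "('a, 'b) monoid_scheme \<Rightarrow> 'a set \<Rightarrow> 'a set monoid" where
  "quot_centre G K = (G Mod K)\<lparr>carrier := centre (G Mod K)\<rparr>"

definition quot_centre_mod_derived ::
    "('a, 'b) monoid_scheme \<Rightarrow> 'a set \<Rightarrow> 'a set set monoid" where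
  "quot_centre_mod_derived G K = quot_centre G K Mod commutator_subgroup (G Mod K)"

end

theory Submission
  imports Defs
begin

text \<open>
  The isoclinism with \<open>\<Phi>\<^sub>4(1\<^sup>5)\<close> shows that \<open>Z = Z(G) = G'\<close> is elementary abelian of order
  \<open>p\<^sup>2\<close>, that \<open>x \<mapsto> x\<^sup>p\<close> maps \<open>G\<close> into \<open>Z\<close>, and that for every \<open>K < Z\<close> of order \<open>p\<close> the preimage
  \<open>W\<close> of \<open>Z(G/K)\<close> has order \<open>p\<^sup>3\<close>. The simple components on which \<open>Z\<close> acts nontrivially correspond
  to the pairs \<open>(K, N)\<close> with \<open>N \<le> W\<close>, \<open>N \<inter> Z = K\<close> and \<open>W/N\<close> cyclic, say of order \<open>d \<in> {p, p\<^sup>2}\<close>.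

  Since \<open>p\<close> is odd, \<open>x \<mapsto> x\<^sup>p\<close> is a homomorphism, so \<open>v\<^sup>p \<in> K\<close> for some \<open>v \<notin> W\<close>. A faithful
  character of \<open>W/N\<close> therefore extends to \<open>\<langle>v, W\<rangle>\<close> with values in \<open>\<rat>(\<zeta>\<^sub>d)\<close>, and inducing the
  extension to \<open>G\<close> gives a surjection \<open>\<rat>G \<rightarrow> M\<^sub>p(\<rat>(\<zeta>\<^sub>d))\<close>. Together with \<open>\<rat>G \<rightarrow> \<rat>(G/G')\<close> these
  surjections form the isomorphism. It is onto because averaging over the subgroups \<open>N\<close> and \<open>Z\<close>
  separates the components. It is injective because the traces vanish outside \<open>W\<close>, so an element of
  the kernel has vanishing sums over the cosets of each \<open>N\<close>, by the irreducibility of the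
  \<open>d\<close>-th cyclotomic polynomial; inclusion-exclusion over the subgroups of order \<open>p\<close>, first in
  \<open>W/K\<close> and then in \<open>Z\<close>, shows that the element vanishes.
\<close>

section \<open>Linear relations between roots of unity of prime power order\<close>

text \<open>The numbers of copies arise as follows. \<open>(G/K)'\<close> is \<open>Z/K\<close>, of
  order \<open>p\<close>, and \<open>W/K = Z(G/K)\<close> has order \<open>p\<^sup>2\<close>, so
  \<open>Z(G/K)/(G/K)'\<close> has order \<open>p\<close>. If \<open>W/K\<close> is cyclic, the
  divisors 1 and \<open>p\<close> contribute \<open>1 - 1 = 0\<close> copies and
  \<open>p\<^sup>2\<close> contributes one, with \<open>N = K\<close>. If \<open>W/K\<close> is
  elementary abelian, the divisor \<open>p\<close> contributes \<open>(p + 1) - 1\<close> copies: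
  one for each subgroup of order \<open>p\<close> of \<open>W/K\<close> except \<open>Z/K\<close>,
  whose preimage \<open>Z\<close> does not meet \<open>Z\<close> in \<open>K\<close>. The obstacle
  to injectivity is that the coefficients are rational, while each matrix representation is only one
  of several Galois conjugates over the complex numbers. Irreducibility of the cyclotomic polynomial
  bridges this: a rational relation between the powers of \<open>\<zeta>\<close> with exponents
  below \<open>p * q\<close> has coefficients that depend on the exponent modulo \<open>q\<close>
  only. A second obstacle is that a presentation bounds a group from above only; exponent functions
  on words show that the presented group does not collapse.\<close>

lemma prime_dvd_choose_prime_power:
  assumes "Factorial_Ring.prime (p::nat)" "0 < k" "k < p ^ n"
  shows "p dvd (p ^ n choose k)"
proof (rule ccontr)
  assume "\<not> p dvd (p ^ n choose k)"
  then have cop: "coprime (p ^ n) (p ^ n choose k)"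
    using assms(1) by (simp add: prime_imp_coprime)
  \<comment> \<open>Absorption identity: \<open>p ^ n\<close> is coprime to the binomial coefficient
    by assumption, so it would have to divide \<open>k\<close>, which is smaller.\<close>
  have "k * (p ^ n choose k) = p ^ n * ((p ^ n - 1) choose (k - 1))"
    using assms by (intro times_binomial_minus1_eq) auto
  then have "p ^ n dvd k * (p ^ n choose k)" by simp
  then have "p ^ n dvd k" using cop by (simp add: coprime_dvd_mult_left_iff)
  with assms show False by (auto dest: dvd_imp_le)
qed

section \<open>Integer polynomials at complex arguments and Eisenstein's criterion\<close>

abbreviation ipoly :: "int poly \<Rightarrow> complex \<Rightarrow> complex" where
  "ipoly P z \<equiv> poly (map_poly of_int P) z"

lemma ipoly_simps:
  "ipoly 0 z = 0" "ipoly 1 z = 1" "ipoly (P + Q) z = ipoly P z + ipoly Q z"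
  "ipoly (P * Q) z = ipoly P z * ipoly Q z" "ipoly (smult c P) z = of_int c * ipoly P z"
  "ipoly (P - Q) z = ipoly P z - ipoly Q z"
  "ipoly (pCons c P) z = of_int c + z * ipoly P z"
proof -
  have "map_poly of_int (P + Q) = (map_poly of_int P + map_poly of_int Q :: complex poly)"
    "map_poly of_int (P - Q) = (map_poly of_int P - map_poly of_int Q :: complex poly)"
    "map_poly of_int (P * Q) = (map_poly of_int P * map_poly of_int Q :: complex poly)"
    by (rule poly_eqI; simp add: coeff_map_poly coeff_mult)+
  then show "ipoly (P + Q) z = ipoly P z + ipoly Q z" "ipoly (P - Q) z = ipoly P z - ipoly Q z"
    "ipoly (P * Q) z = ipoly P z * ipoly Q z" by simp_all
qed (simp_all add: map_poly_pCons map_poly_smult)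

lemma ipoly_sum_monom: "ipoly (\<Sum>i<(n::nat). monom (c i) (f i)) z = (\<Sum>i<n. of_int (c i) * z ^ f i)"
  by (induction n) (simp_all add: ipoly_simps map_poly_monom poly_monom)

lemma ipoly_pcompose: "ipoly (pcompose P Q) z = ipoly P (ipoly Q z)"
  by (induction P) (simp_all add: pcompose_pCons ipoly_simps map_poly_pCons)

text \<open>Eisenstein's criterion, phrased as a bound on the degree of the integer polynomials
  that vanish at a given root of the Eisenstein polynomial.\<close>

lemma eisenstein_root:
  fixes E P :: "int poly" and z :: complex
  assumes p: "Factorial_Ring.prime (p::int)" and monic: "lead_coeff E = 1"
    and low: "\<And>k. k < degree E \<Longrightarrow> p dvd coeff E k" and zero: "\<not> p ^ 2 dvd coeff E 0"
    and Ez: "ipoly E z = 0" and P: "degree P < degree E" "ipoly P z = 0"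
  shows "P = 0"
proof (rule ccontr)
  assume "P \<noteq> 0"
  define S where "S = (\<lambda>F::int poly. F \<noteq> 0 \<and> ipoly F z = 0)"
  \<comment> \<open>A nonzero integer polynomial of least degree vanishing at \<open>z\<close>; its
    primitive part \<open>F\<close> plays the role of the minimal polynomial.\<close>
  define F0 where "F0 = (ARG_MIN degree F. S F)"
  have SP: "S P" using P \<open>P \<noteq> 0\<close> by (simp add: S_def)
  have F0: "S F0" unfolding F0_def by (rule arg_min_natI[of S, OF SP])
  have F0_min: "degree F0 \<le> degree F" if "S F" for F
    unfolding F0_def using that by (rule arg_min_nat_le)
  define F where "F = primitive_part F0"
  have F0_eq: "F0 = smult (content F0) F" by (simp add: F_def)
  have cF0: "content F0 \<noteq> 0" using F0 by (simp add: S_def)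
  have Fz: "ipoly F z = 0" using F0 cF0 F0_eq by (metis S_def ipoly_simps(5) mult_eq_0_iff of_int_eq_0_iff)
  have F_ne: "F \<noteq> 0" using F0 F0_eq by (auto simp: S_def)
  have degF: "degree F = degree F0" by (simp add: F_def)
  have contF: "content F = 1" using F0 by (simp add: F_def S_def)
  have contE: "content E = 1"
  proof -
    have "content E dvd lead_coeff E" by (rule content_dvd_coeff)
    then show ?thesis by (metis monic normalize_content is_unit_normalize)
  qed
  \<comment> \<open>Pseudo-division stays within integer polynomials at the cost of the factor
    \<open>c\<close>. The remainder vanishes at \<open>z\<close>, so it is zero by
    minimality.\<close>
  obtain q r where qr: "pseudo_divmod E F = (q, r)" by fastforce
  define c where "c = lead_coeff F ^ (Suc (degree E) - degree F)"
  have c0: "c \<noteq> 0" using F_ne by (simp add: c_def)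
  have E_eq: "smult c E = F * q + r" and r: "r = 0 \<or> degree r < degree F"
    using pseudo_divmod[OF F_ne qr] by (auto simp: c_def)
  have "ipoly r z = 0"
    using arg_cong[OF E_eq, of "\<lambda>P. ipoly P z"] Ez Fz by (simp add: ipoly_simps)
  then have r0: "r = 0" using r F0_min[of r] degF by (force simp: S_def)
  \<comment> \<open>Gauss's lemma: \<open>E\<close> and \<open>F\<close> are primitive, so
    \<open>c\<close> is the content of \<open>q\<close> up to sign and can be cancelled. The factor
    \<open>c div normalize c\<close> in \<open>Q\<close> is the sign of \<open>c\<close>.\<close>
  have "content (smult c E) = content F * content q" using E_eq r0 by (simp add: content_mult)
  then have cq: "content q = normalize c" using contE contF by simp
  define Q where "Q = smult (c div normalize c) (primitive_part q)"
  have sgn: "c div normalize c * c = normalize c" "c div normalize c * normalize c = c"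
    using c0 by (cases "c < 0"; simp add: abs_if div_minus_right)+
  have "smult c E = F * smult (normalize c) (primitive_part q)"
    using E_eq r0 cq by (metis add_0_right content_times_primitive_part)
  also have "\<dots> = smult c (F * Q)"
    unfolding Q_def using sgn by (simp add: mult.commute)
  finally have EFQ: "E = F * Q" using c0 by (simp add: smult_cancel)
  have Q_ne: "Q \<noteq> 0" using EFQ monic by auto
  have degE: "degree E = degree F + degree Q" using EFQ F_ne Q_ne by (simp add: degree_mult_eq)
  have "lead_coeff F * lead_coeff Q = 1" using monic EFQ by (simp add: lead_coeff_mult)
  then have units: "is_unit (lead_coeff F)" "is_unit (lead_coeff Q)"
    by (metis dvd_triv_left, metis dvd_triv_right)
  have nF: "\<not> p dvd lead_coeff F" and nQ: "\<not> p dvd lead_coeff Q"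
    using units p by (meson dvd_trans not_prime_unit)+
  \<comment> \<open>Modulo \<open>p\<close> the lowest terms of \<open>F\<close> and
    \<open>Q\<close> have exponents \<open>i\<close> and \<open>j\<close>, so coefficient
    \<open>i + j\<close> of \<open>E\<close> is nonzero modulo \<open>p\<close>. This forces
    \<open>i + j = degree E\<close>: both factors are monomials modulo \<open>p\<close>, and both
    constant terms are divisible by \<open>p\<close>.\<close>
  define i where "i = (LEAST i. \<not> p dvd coeff F i)"
  define j where "j = (LEAST i. \<not> p dvd coeff Q i)"
  have i: "\<not> p dvd coeff F i" "i \<le> degree F" "\<And>k. k < i \<Longrightarrow> p dvd coeff F k"
    unfolding i_def using LeastI[of "\<lambda>i. \<not> p dvd coeff F i", OF nF] Least_le[of "\<lambda>i. \<not> p dvd coeff F i", OF nF]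
    by (auto dest: not_less_Least)
  have j: "\<not> p dvd coeff Q j" "j \<le> degree Q" "\<And>k. k < j \<Longrightarrow> p dvd coeff Q k"
    unfolding j_def using LeastI[of "\<lambda>i. \<not> p dvd coeff Q i", OF nQ] Least_le[of "\<lambda>i. \<not> p dvd coeff Q i", OF nQ]
    by (auto dest: not_less_Least)
  have "coeff E (i + j) = (\<Sum>k\<le>i + j. coeff F k * coeff Q (i + j - k))"
    by (simp add: EFQ coeff_mult)
  also have "\<dots> = coeff F i * coeff Q j + (\<Sum>k\<in>{..i+j} - {i}. coeff F k * coeff Q (i + j - k))"
    by (subst sum.remove[of _ i]) auto
  finally have *: "coeff E (i + j) = \<dots>" .
  have "p dvd (\<Sum>k\<in>{..i+j} - {i}. coeff F k * coeff Q (i + j - k))"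
  proof (rule dvd_sum)
    fix k assume k: "k \<in> {..i+j} - {i}"
    show "p dvd coeff F k * coeff Q (i + j - k)"
    proof (cases "k < i")
      case False
      then have "i + j - k < j" using k by auto
      then show ?thesis using j(3) by simp
    qed (use i(3) in simp)
  qed
  moreover have "\<not> p dvd coeff F i * coeff Q j" using i(1) j(1) p prime_dvd_mult_iff by blast
  ultimately have "\<not> p dvd coeff E (i + j)" unfolding * by (simp add: dvd_add_left_iff)
  then have "degree E \<le> i + j" using low by (metis not_le)
  then have ij: "i = degree F" "j = degree Q" using degE i(2) j(2) by auto
  have "0 < degree F"
  proof (rule ccontr)
    assume "\<not> 0 < degree F"
    then obtain a where "F = [:a:]" by (metis degree_eq_zeroE gr0I)
    then show False using Fz F_ne by (simp add: map_poly_pCons)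
  qed
  moreover have "degree F < degree E" using F0_min[OF SP] degF P by simp
  ultimately have "0 < i" "0 < j" using ij degE by auto
  then have "p dvd coeff F 0" "p dvd coeff Q 0" using i(3) j(3) by auto
  then have "p ^ 2 dvd coeff E 0" by (simp add: EFQ coeff_mult power2_eq_square mult_dvd_mono)
  with zero show False by simp
qed

section \<open>Cyclotomic polynomials of prime power order\<close>

lemma primitive_root_cyclotomic_sum:
  assumes "primitive_root_of_unity (p * q) z" "Factorial_Ring.prime p" 
  shows "(\<Sum>i<p. z ^ (i * q)) = 0"
proof -
  have d: "0 < p * q" "z ^ (p * q) = 1" "\<And>k. 0 < k \<Longrightarrow> k < p * q \<Longrightarrow> z ^ k \<noteq> 1"
    using assms(1) by (auto simp: primitive_root_of_unity_def)
  have "1 < p" using assms(2) by (rule prime_gt_1_nat)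
  have "z ^ q \<noteq> 1" using d \<open>1 < p\<close> by (intro d(3)) auto
  then have "(\<Sum>i<p. (z ^ q) ^ i) = ((z ^ q) ^ p - 1) / (z ^ q - 1)" by (rule geometric_sum)
  also have "\<dots> = 0" using d(2) by (simp flip: power_mult add: mult.commute)
  finally show ?thesis by (simp flip: power_mult add: mult.commute)
qed

text \<open>The bound \<open>(p - 1) * q\<close> is the degree of the cyclotomic polynomial
  \<open>\<Phi>\<close>, the sum of the \<open>x ^ (i * q)\<close> for \<open>i < p\<close>.
  Substituting \<open>x + 1\<close> for \<open>x\<close> turns it into an Eisenstein polynomial
  \<open>E\<close> with root \<open>z - 1\<close>.\<close>

lemma root_of_unity_int_independent:
  assumes p: "Factorial_Ring.prime p" and q: "q = p ^ e" and z: "primitive_root_of_unity (p * q) z"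
    and P: "degree P < (p - 1) * q" "ipoly P z = 0"
  shows "P = 0"
proof -
  define L :: "int poly" where "L = [:1, 1:]"
  define \<Phi> :: "int poly" where "\<Phi> = (\<Sum>i<p. monom 1 (i * q))"
  define E where "E = pcompose \<Phi> L"
  have p1: "1 < p" using p by (rule prime_gt_1_nat)
  have q0: "0 < q" using q p1 by simp
  have coeff_\<Phi>: "coeff \<Phi> m = (if \<exists>i<p. m = i * q then 1 else 0)" for m
  proof -
    have "coeff \<Phi> m = (\<Sum>i<p. if i * q = m then 1 else 0)"
      unfolding \<Phi>_def coeff_sum by simp
    also have "\<dots> = (\<Sum>i<p. if i = m div q then if m = i * q then 1 else 0 else 0)"
      using q0 by (intro sum.cong refl) (metis nonzero_mult_div_cancel_right less_not_refl)
    also have "\<dots> = (if \<exists>i<p. m = i * q then 1 else 0)"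
      using q0 by (auto simp: sum.delta)
    finally show ?thesis .
  qed
  have deg\<Phi>: "degree \<Phi> = (p - 1) * q"
  proof (rule antisym)
    show "degree \<Phi> \<le> (p - 1) * q"
    proof (rule degree_le, intro allI impI)
      fix i assume "(p - 1) * q < i"
      moreover have "k * q \<le> (p - 1) * q" if "k < p" for k
        using that by (intro mult_right_mono) auto
      ultimately show "coeff \<Phi> i = 0" by (auto simp: coeff_\<Phi> not_less[symmetric])
    qed
    have "coeff \<Phi> ((p - 1) * q) = 1" unfolding coeff_\<Phi> using p1 by (intro if_P exI[of _ "p - 1"]) simp
    then show "(p - 1) * q \<le> degree \<Phi>" by (intro le_degree) simp
  qed
  have lc\<Phi>: "lead_coeff \<Phi> = 1" 
    unfolding deg\<Phi> coeff_\<Phi> using p1 by (intro if_P exI[of _ "p - 1"]) simp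
  have degL: "degree L = 1" by (simp add: L_def)
  have degE: "degree E = (p - 1) * q" by (simp add: E_def degree_pcompose deg\<Phi> degL)
  have lcE: "lead_coeff E = 1"
    unfolding E_def by (subst lead_coeff_comp) (simp_all add: degL, simp_all add: L_def lc\<Phi>)
  have telescope: "\<Phi> * (monom 1 q - 1) = monom 1 (p * q) - 1"
  proof -
    have "\<Phi> = (\<Sum>i<p. monom 1 q ^ i)" by (simp add: \<Phi>_def monom_power mult.commute)
    then have "(monom 1 q - 1) * \<Phi> = monom 1 q ^ p - 1" by (simp add: power_diff_1_eq)
    then show ?thesis by (simp add: monom_power mult.commute)
  qed
  have comp_monom: "pcompose (monom 1 m) L = L ^ m" for m
    by (induction m) (simp_all add: monom_Suc pcompose_pCons pcompose_1 flip: one_pCons monom_0)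
  have EL: "E * (L ^ q - 1) = L ^ (p * q) - 1"
    using arg_cong[OF telescope, of "\<lambda>P. pcompose P L"]
    by (simp add: E_def pcompose_mult pcompose_diff comp_monom pcompose_1)
  \<comment> \<open>Modulo \<open>p\<close>, the power \<open>(1 + x) ^ (p ^ m)\<close> is
    \<open>1 + x ^ (p ^ m)\<close>. Inserted into the geometric sum identity \<open>EL\<close>, this
    gives \<open>E * x ^ q = x ^ (p * q)\<close> modulo \<open>p\<close>.\<close>
  have binom: "[:int p:] dvd L ^ (p ^ m) - 1 - monom 1 (p ^ m)" for m
  proof (rule const_poly_dvd_iff[THEN iffD2], rule allI)
    fix k
    have "coeff (L ^ (p ^ m)) k = of_nat (p ^ m choose k)"
    proof (cases "k \<le> p ^ m")
      case False
      have "degree (L ^ (p ^ m)) \<le> p ^ m" using degree_power_le[of L "p ^ m"] degL by simp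
      with False show ?thesis by (simp add: coeff_eq_0 binomial_eq_0)
    qed (simp add: L_def coeff_linear_poly_power)
    then show "int p dvd coeff (L ^ (p ^ m) - 1 - monom 1 (p ^ m)) k"
      using prime_dvd_choose_prime_power[OF p, of k m] p1
      by (cases "k = 0"; cases "k < p ^ m"; cases "k = p ^ m") (auto simp: coeff_1 coeff_monom binomial_eq_0)
  qed
  have pq: "p * q = p ^ Suc e" by (simp add: q)
  have "[:int p:] dvd (E * (L ^ q - 1) - E * (L ^ q - 1 - monom 1 q)) - monom 1 (p * q)"
  proof -
    have "[:int p:] dvd E * (L ^ q - 1 - monom 1 q)" unfolding q by (intro dvd_mult binom)
    moreover have "[:int p:] dvd E * (L ^ q - 1) - monom 1 (p * q)"
      unfolding EL pq by (rule binom)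
    ultimately have "[:int p:] dvd (E * (L ^ q - 1) - monom 1 (p * q)) - E * (L ^ q - 1 - monom 1 q)"
      by (rule dvd_diff[rotated])
    then show ?thesis by (simp add: algebra_simps)
  qed
  moreover have "E * (L ^ q - 1) - E * (L ^ q - 1 - monom 1 q) = E * monom 1 q" by (simp add: algebra_simps)
  ultimately have dvdE: "[:int p:] dvd E * monom 1 q - monom 1 (p * q)" by simp
  \<comment> \<open>Multiplication by \<open>x ^ q\<close> shifts coefficient \<open>k\<close> to
    \<open>k + q\<close>, which for \<open>k < degree E\<close> stays below the only surviving
    exponent \<open>p * q\<close>.\<close>
  have low: "int p dvd coeff E k" if "k < degree E" for k
  proof -
    have "int p dvd coeff (E * monom 1 q - monom 1 (p * q)) (k + q)"
      using dvdE by (simp only: const_poly_dvd_iff)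
    moreover have "k + q \<noteq> p * q"
      using that p1 unfolding degE by (simp add: diff_mult_distrib)
    ultimately show ?thesis by (simp add: coeff_monom_mult coeff_monom mult.commute[of E])
  qed
  \<comment> \<open>The constant term of \<open>E\<close> is the value of \<open>\<Phi>\<close> at
    1, a sum of \<open>p\<close> ones.\<close>
  have "coeff E 0 = int p"
    by (simp add: E_def poly_0_coeff_0[symmetric] poly_pcompose L_def \<Phi>_def poly_sum poly_monom)
  moreover have "\<not> (int p)\<^sup>2 dvd int p"
  proof
    assume "(int p)\<^sup>2 dvd int p"
    then have "p\<^sup>2 dvd p" by (metis int_dvd_int_iff of_nat_power)
    then show False using p1 by (auto dest!: dvd_imp_le simp: power2_eq_square)
  qed
  ultimately have zero: "\<not> (int p)\<^sup>2 dvd coeff E 0" by simp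
  have ipoly_L: "ipoly L (z - 1) = z" by (simp add: L_def map_poly_pCons)
  have "ipoly \<Phi> z = (\<Sum>i<p. z ^ (i * q))"
    unfolding \<Phi>_def ipoly_sum_monom by simp
  then have "ipoly E (z - 1) = 0"
    using primitive_root_cyclotomic_sum[OF z p] by (simp add: E_def ipoly_pcompose ipoly_L)
  moreover have "degree (pcompose P L) < degree E" using P degE by (simp add: degree_pcompose degL)
  moreover have "ipoly (pcompose P L) (z - 1) = 0" using P by (simp add: ipoly_pcompose ipoly_L)
  ultimately have "pcompose P L = 0"
    using eisenstein_root[of "int p" E, OF _ lcE low zero] p by auto
  then show ?thesis using pcompose_eq_0 degL by fastforce
qed

lemma common_denominator:
  fixes c :: "'i \<Rightarrow> rat"
  assumes "finite I"
  shows "\<exists>D>0. \<forall>i\<in>I. \<exists>k. of_int D * c i = of_int k"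
  using assms
proof induction
  case empty
  show ?case by (intro exI[of _ 1]) auto
next
  case (insert i I)
  then obtain D where D: "D > 0" "\<forall>i\<in>I. \<exists>k. of_int D * c i = of_int k" by blast
  obtain a b where ab: "c i = of_int a / of_int b" "b > 0"
    by (metis quotient_of_div quotient_of_denom_pos surj_pair)
  have "\<exists>k. of_int (D * b) * c j = of_int k" if "j \<in> insert i I" for j
    using that
  proof (cases "j = i")
    case True
    have "of_int (D * b) * c i = of_int (D * a)" using ab by simp
    then show ?thesis using True by blast
  next
    case False
    then obtain k where "of_int D * c j = of_int k" using D \<open>j \<in> insert i I\<close> by blast
    then have "of_int (D * b) * c j = of_int (b * k)" by (simp add: mult.commute mult.left_commute)
    then show ?thesis by blast
  qed
  then show ?case using D ab by (intro exI[of _ "D * b"]) (auto simp: zero_less_mult_iff)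
qed

text \<open>All rational relations come from the multiples of the cyclotomic one. After clearing
  denominators, subtracting suitable multiples of it removes the top \<open>q\<close> exponents, and
  the rest has too small a degree to vanish at \<open>z\<close> unless it is zero.\<close>

lemma root_of_unity_rat_relation:
  fixes c :: "nat \<Rightarrow> rat"
  assumes p: "Factorial_Ring.prime p" and q: "q = p ^ e" and z: "primitive_root_of_unity (p * q) z"
    and rel: "(\<Sum>j<p * q. of_rat (c j) * z ^ j) = 0" and j: "j < p * q" "j' < p * q" "j mod q = j' mod q"
  shows "c j = c j'"
proof -
  have p1: "1 < p" using p by (rule prime_gt_1_nat)
  have q0: "0 < q" using q p1 by simp
  obtain D where D: "D > 0" "\<forall>i\<in>{..<p * q}. \<exists>k. of_int D * c i = of_int k"
    using common_denominator[of "{..<p * q}" c] by auto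
  then obtain k where k: "\<And>i. i < p * q \<Longrightarrow> of_int D * c i = of_int (k i)" by (metis lessThan_iff)
  \<comment> \<open>The coefficients of the last block of \<open>q\<close> exponents. Any
    coefficient function of the form \<open>t (j mod q)\<close> is a relation by itself.\<close>
  define t where "t r = k ((p - 1) * q + r)" for r
  have kz: "(\<Sum>j<p * q. of_int (k j) * z ^ j) = 0"
  proof -
    have "(\<Sum>j<p * q. of_int (k j) * z ^ j) = (\<Sum>j<p * q. of_int D * (of_rat (c j) * z ^ j))"
    proof (rule sum.cong)
      fix j assume "j \<in> {..<p * q}"
      then have "(of_rat (of_int D * c j) :: complex) = of_int (k j)" using k by simp
      then show "of_int (k j) * z ^ j = of_int D * (of_rat (c j) * z ^ j)"
        by (simp add: of_rat_mult)
    qed simp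
    then show ?thesis using rel by (simp flip: sum_distrib_left)
  qed
  have split: "(\<Sum>j<p * q. f j) = (\<Sum>i<p. \<Sum>r<q. f (i * q + r))" for f :: "nat \<Rightarrow> complex"
  proof -
    have "(\<Sum>i<p. \<Sum>r<q. f (i * q + r)) = (\<Sum>i<p. \<Sum>j = i * q..<i * q + q. f j)"
    proof (rule sum.cong[OF refl])
      fix i
      show "(\<Sum>r<q. f (i * q + r)) = (\<Sum>j = i * q..<i * q + q. f j)"
        by (rule sum.reindex_bij_witness[of _ "\<lambda>j. j - i * q" "\<lambda>r. i * q + r"]) auto
    qed
    also have "\<dots> = (\<Sum>j<p * q. f j)" by (rule sum.nat_group)
    finally show ?thesis by simp
  qed
  have "(\<Sum>j<p * q. of_int (t (j mod q)) * z ^ j) = (\<Sum>i<p. \<Sum>r<q. of_int (t r) * z ^ r * z ^ (i * q))"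
    unfolding split by (intro sum.cong) (auto simp: power_add)
  also have "\<dots> = (\<Sum>r<q. \<Sum>i<p. of_int (t r) * z ^ r * z ^ (i * q))" by (rule sum.swap)
  also have "\<dots> = 0"
    by (simp flip: sum_distrib_left add: primitive_root_cyclotomic_sum[OF z p])
  finally have tz: "(\<Sum>j<p * q. of_int (t (j mod q)) * z ^ j) = 0" .
  define P where "P = (\<Sum>j<p * q. monom (k j - t (j mod q)) j)"
  have coeff_P: "coeff P m = (if m < p * q then k m - t (m mod q) else 0)" for m
    by (simp add: P_def coeff_sum coeff_monom sum.delta)
  have "ipoly P z = (\<Sum>j<p * q. of_int (k j - t (j mod q)) * z ^ j)"
    unfolding P_def ipoly_sum_monom by simp
  also have "\<dots> = 0" using kz tz by (simp add: algebra_simps sum_subtractf)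
  finally have Pz: "ipoly P z = 0" .
  have top: "coeff P m = 0" if "(p - 1) * q \<le> m" for m
  proof (cases "m < p * q")
    case True
    define r where "r = m - (p - 1) * q"
    have m: "m = (p - 1) * q + r" using that by (simp add: r_def)
    moreover have "r < q" using True m p1 by (simp add: diff_mult_distrib)
    ultimately have "m mod q = r" by simp
    then show ?thesis by (simp add: coeff_P t_def m)
  qed (simp add: coeff_P)
  have "0 < (p - 1) * q" using p1 q0 by simp
  then have "degree P < (p - 1) * q \<or> P = 0"
    using top by (metis leading_coeff_0_iff not_le)
  then have "P = 0" using root_of_unity_int_independent[OF p q z _ Pz] by blast
  then have "k m = t (m mod q)" if "m < p * q" for m using coeff_P[of m] that by simp
  then have "of_int D * c j = of_int D * c j'" using j k by metis
  then show ?thesis using D by simp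
qed

section \<open>The field generated by a root of unity over the rationals\<close>

abbreviation rpoly :: "rat poly \<Rightarrow> complex \<Rightarrow> complex" where
  "rpoly P z \<equiv> poly (map_poly of_rat P) z"

lemma rpoly_simps:
  "rpoly 0 z = 0" "rpoly 1 z = 1" "rpoly (P + Q) z = rpoly P z + rpoly Q z"
  "rpoly (P * Q) z = rpoly P z * rpoly Q z" "rpoly (- P) z = - rpoly P z"
  "rpoly (monom 1 n) z = z ^ n" "rpoly [:a:] z = of_rat a"
proof -
  have "map_poly of_rat (P + Q) = (map_poly of_rat P + map_poly of_rat Q :: complex poly)"
    "map_poly of_rat (- P) = (- map_poly of_rat P :: complex poly)"
    "map_poly of_rat (P * Q) = (map_poly of_rat P * map_poly of_rat Q :: complex poly)"
    by (rule poly_eqI; simp add: coeff_map_poly coeff_mult of_rat_add of_rat_minus of_rat_sum of_rat_mult)+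
  then show "rpoly (P + Q) z = rpoly P z + rpoly Q z" "rpoly (- P) z = - rpoly P z"
    "rpoly (P * Q) z = rpoly P z * rpoly Q z" by simp_all
qed (simp_all add: map_poly_monom poly_monom map_poly_pCons)

text \<open>Bezout's identity for \<open>P\<close> and an annihilating polynomial \<open>m\<close>
  of least degree. Their gcd does not vanish at \<open>z\<close> because \<open>P\<close> does not;
  so its cofactor in \<open>m\<close> vanishes there, has at least the degree of \<open>m\<close>,
  and the gcd is constant.\<close>

lemma rpoly_inverse:
  assumes F: "F \<noteq> 0" "rpoly F z = 0" and Pz: "rpoly P z \<noteq> 0"
  shows "\<exists>Q. rpoly P z * rpoly Q z = 1"
proof -
  define S where "S = (\<lambda>F::rat poly. F \<noteq> 0 \<and> rpoly F z = 0)"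
  define m where "m = (ARG_MIN degree F. S F)"
  have SF: "S F" using F by (simp add: S_def)
  have m: "S m" unfolding m_def by (rule arg_min_natI[of S, OF SF])
  have m_min: "degree m \<le> degree F" if "S F" for F
    unfolding m_def using that by (rule arg_min_nat_le)
  define g where "g = gcd P m"
  obtain h where h: "m = g * h" unfolding g_def by (meson gcd_dvd2 dvd_def)
  obtain k where k: "P = g * k" unfolding g_def by (meson gcd_dvd1 dvd_def)
  have gz: "rpoly g z \<noteq> 0" using Pz k by (auto simp: rpoly_simps)
  then have "rpoly h z = 0" using m h by (auto simp: S_def rpoly_simps)
  moreover have "h \<noteq> 0" "g \<noteq> 0" using m h by (auto simp: S_def)
  ultimately have "degree m \<le> degree h" by (intro m_min) (simp add: S_def)
  then have "degree g = 0" using h \<open>h \<noteq> 0\<close> \<open>g \<noteq> 0\<close> by (simp add: degree_mult_eq)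
  then obtain a where a: "g = [:a:]" "a \<noteq> 0" using \<open>g \<noteq> 0\<close> by (metis degree_eq_zeroE pCons_0_0)
  have bez: "fst (bezout_coefficients P m) * P + snd (bezout_coefficients P m) * m = g"
    unfolding g_def by (rule bezout_coefficients_fst_snd)
  define Q where "Q = [:inverse a:] * fst (bezout_coefficients P m)"
  have "rpoly (fst (bezout_coefficients P m)) z * rpoly P z = of_rat a"
    using arg_cong[OF bez, of "\<lambda>P. rpoly P z"] m a by (simp add: rpoly_simps S_def)
  then have "rpoly P z * rpoly Q z = of_rat (inverse a * a)"
    unfolding Q_def rpoly_simps of_rat_mult by (simp only: ac_simps)
  then show ?thesis using a by auto
qed

lemma rat_adjoin_closed:
  shows "1 \<in> rat_adjoin z" "z \<in> rat_adjoin z" "0 \<in> rat_adjoin z"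
    "x \<in> rat_adjoin z \<Longrightarrow> - x \<in> rat_adjoin z"
    "x \<in> rat_adjoin z \<Longrightarrow> inverse x \<in> rat_adjoin z"
    "x \<in> rat_adjoin z \<Longrightarrow> y \<in> rat_adjoin z \<Longrightarrow> x + y \<in> rat_adjoin z"
    "x \<in> rat_adjoin z \<Longrightarrow> y \<in> rat_adjoin z \<Longrightarrow> x * y \<in> rat_adjoin z"
    and rat_adjoin_induct: "x \<in> rat_adjoin z \<Longrightarrow> S 1 \<Longrightarrow> S z \<Longrightarrow> (\<And>x. S x \<Longrightarrow> S (- x))
      \<Longrightarrow> (\<And>x. x \<noteq> 0 \<Longrightarrow> S x \<Longrightarrow> S (inverse x)) \<Longrightarrow> (\<And>x y. S x \<Longrightarrow> S y \<Longrightarrow> S (x + y))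
      \<Longrightarrow> (\<And>x y. S x \<Longrightarrow> S y \<Longrightarrow> S (x * y)) \<Longrightarrow> S x"
proof -
  define R where "R = (ring_of_type_algebra :: complex ring)"
  interpret R: field R unfolding R_def by (rule field_from_type_algebra)
  have R_simps: "carrier R = UNIV" "\<one>\<^bsub>R\<^esub> = 1" "\<zero>\<^bsub>R\<^esub> = 0"
    "a \<oplus>\<^bsub>R\<^esub> b = a + b" "a \<otimes>\<^bsub>R\<^esub> b = a * b" for a b
    by (simp_all add: R_def ring_of_type_algebra_def)
  have min: "\<ominus>\<^bsub>R\<^esub> a = - a" for a
    by (rule R.minus_equality) (simp_all add: R_simps)
  have inv: "inv\<^bsub>R\<^esub> a = inverse a" if "a \<noteq> 0" for a
    by (rule R.comm_inv_char) (use that in \<open>simp_all add: R_simps\<close>)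
  have adj: "rat_adjoin z = generate_field R {z}" by (simp add: rat_adjoin_def R_def)
  note gen = generate_field.intros[where R = R and H = "{z}", folded adj, unfolded R_simps]
  show one: "1 \<in> rat_adjoin z" and "z \<in> rat_adjoin z" using gen(1,2) by simp_all
  show neg: "- x \<in> rat_adjoin z" if "x \<in> rat_adjoin z" for x using gen(3)[OF that] by (simp add: min)
  show add: "x + y \<in> rat_adjoin z" if "x \<in> rat_adjoin z" "y \<in> rat_adjoin z" for x y
    using gen(5)[OF that] .
  show "x * y \<in> rat_adjoin z" if "x \<in> rat_adjoin z" "y \<in> rat_adjoin z" for x y
    using gen(6)[OF that] .
  show zero: "0 \<in> rat_adjoin z" using add[OF one neg[OF one]] by simp
  \<comment> \<open>In HOL \<open>inverse 0 = 0\<close>, so zero is treated apart from the inverses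
    provided by \<open>generate_field\<close>.\<close>
  show "inverse x \<in> rat_adjoin z" if "x \<in> rat_adjoin z" for x
    using gen(4)[OF that] zero by (cases "x = 0") (simp_all add: inv)
  show "S x" if x: "x \<in> rat_adjoin z" and S: "S 1" "S z" "\<And>x. S x \<Longrightarrow> S (- x)"
      "\<And>x. x \<noteq> 0 \<Longrightarrow> S x \<Longrightarrow> S (inverse x)" "\<And>x y. S x \<Longrightarrow> S y \<Longrightarrow> S (x + y)"
      "\<And>x y. S x \<Longrightarrow> S y \<Longrightarrow> S (x * y)" for x S
    using x unfolding adj
  proof (induction rule: generate_field.induct)
    case (m_inv h)
    then show ?case using S(4)[of h] by (simp add: R_simps inv)
  qed (use S in \<open>auto simp: R_simps min\<close>)
qed

lemma rat_adjoin_of_rat: "of_rat q \<in> rat_adjoin z"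
proof -
  have nat: "of_nat n \<in> rat_adjoin z" for n
    by (induction n) (auto intro: rat_adjoin_closed)
  have int: "of_int k \<in> rat_adjoin z" for k
    using nat rat_adjoin_closed(4) by (cases k) (force simp del: of_nat_Suc)+
  obtain a b where "q = of_int a / of_int b" by (metis quotient_of_div surj_pair)
  then have "of_rat q = (of_int a * inverse (of_int b) :: complex)"
    by (simp add: of_rat_divide flip: divide_inverse)
  then show ?thesis using int rat_adjoin_closed by metis
qed

lemma rat_adjoin_sum: "(\<And>i. i \<in> I \<Longrightarrow> f i \<in> rat_adjoin z) \<Longrightarrow> sum f I \<in> rat_adjoin z"
  by (induction I rule: infinite_finite_induct) (auto intro: rat_adjoin_closed)

lemma rat_adjoin_power: "x \<in> rat_adjoin z \<Longrightarrow> x ^ n \<in> rat_adjoin z"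
  by (induction n) (auto intro: rat_adjoin_closed)

text \<open>Values of rational polynomials at \<open>z\<close> are closed under inverses, as
  \<open>z\<close> is a root of \<open>x ^ d - 1\<close>. Hence they exhaust the field, and
  exponents can be reduced modulo \<open>d\<close>.\<close>

lemma rat_adjoin_root_of_unity:
  assumes d: "0 < d" "z ^ d = 1" and x: "x \<in> rat_adjoin z"
  shows "\<exists>c. x = (\<Sum>k<d. of_rat (c k) * z ^ k)"
proof -
  have "\<exists>P. x = rpoly P z"
  proof (rule rat_adjoin_induct[OF x])
    fix x assume x: "x \<noteq> 0" "\<exists>P. x = rpoly P z"
    then obtain P where P: "x = rpoly P z" by blast
    define F :: "rat poly" where "F = monom 1 d + - 1"
    have "coeff F d = 1" using d by (simp add: F_def)
    then have "F \<noteq> 0" by auto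
    moreover have "rpoly F z = 0" using d unfolding F_def rpoly_simps by simp
    ultimately obtain Q where "rpoly P z * rpoly Q z = 1" using rpoly_inverse P x by blast
    then show "\<exists>Q. inverse x = rpoly Q z" using P by (metis inverse_unique)
  next
    show "\<exists>P. 1 = rpoly P z" "\<exists>P. z = rpoly P z"
      using rpoly_simps(2) rpoly_simps(6)[of 1] by (metis power_one_right)+
  next
    fix x y assume "\<exists>P. x = rpoly P z" "\<exists>P. y = rpoly P z"
    then show "\<exists>P. x + y = rpoly P z" "\<exists>P. x * y = rpoly P z"
      using rpoly_simps(3,4) by metis+
  next
    fix x assume "\<exists>P. x = rpoly P z"
    then show "\<exists>P. - x = rpoly P z" using rpoly_simps(5) by metis
  qed
  then obtain P where P: "x = rpoly P z" by blast
  define c where "c k = (\<Sum>i\<in>{i\<in>{..degree P}. i mod d = k}. coeff P i)" for k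
  have "x = (\<Sum>i\<le>degree P. of_rat (coeff P i) * z ^ i)"
    by (simp add: P poly_altdef coeff_map_poly degree_map_poly)
  also have "\<dots> = (\<Sum>k<d. \<Sum>i\<in>{i\<in>{..degree P}. i mod d = k}. of_rat (coeff P i) * z ^ i)"
    using d by (intro sum.group[symmetric]) auto
  also have "\<dots> = (\<Sum>k<d. of_rat (c k) * z ^ k)"
  proof (intro sum.cong refl)
    fix k
    have "z ^ i = z ^ (i mod d)" for i
      by (metis d(2) mult_1 power_add power_mult power_one mod_mult_div_eq mult.commute)
    then show "(\<Sum>i\<in>{i\<in>{..degree P}. i mod d = k}. of_rat (coeff P i) * z ^ i) = of_rat (c k) * z ^ k"
      unfolding c_def of_rat_sum sum_distrib_right by (intro sum.cong) auto
  qed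
  finally show ?thesis by blast
qed

section \<open>The group \<open>\<Phi>\<^sub>4(1\<^sup>5)\<close>\<close>

definition word_class :: "('g word \<times> 'g word) set \<Rightarrow> 'g word \<Rightarrow> 'g word set" where
  "word_class R u = {v. word_eq R u v}"

lemma word_class_eq_iff: "word_class R u = word_class R v \<longleftrightarrow> word_eq R u v"
  unfolding word_class_def by (auto intro: word_eq.intros dest: word_sym word_trans)

lemma word_inv_Cons: "word_inv ((e, x) # w) = word_inv w @ [(\<not> e, x)]"
  by (simp add: word_inv_def)

lemma word_eq_inv: "word_eq R (word_inv u @ u) []"
proof (induction u)
  case Nil
  show ?case by (simp add: word_inv_def word_refl)
next
  case (Cons l u)
  obtain e x where l: "l = (e, x)" by fastforce
  have "word_eq R ([(\<not> e, x), (e, x)] @ u) ([] @ u)"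
    using word_cancel[of R "\<not> e" x] by (intro word_append word_refl) simp
  then have "word_eq R (word_inv u @ [(\<not> e, x), (e, x)] @ u) (word_inv u @ u)"
    by (intro word_append word_refl) simp
  then show ?case using Cons by (simp add: l word_inv_Cons) (rule word_trans)
qed

lemma presented_group_simps:
  "carrier (presented_group R) = range (word_class R)"
  "word_class R u \<otimes>\<^bsub>presented_group R\<^esub> word_class R v = word_class R (u @ v)"
  "\<one>\<^bsub>presented_group R\<^esub> = word_class R []"
proof -
  show "carrier (presented_group R) = range (word_class R)"
    by (auto simp: presented_group_def quotient_def word_class_def Image_def)
  show "\<one>\<^bsub>presented_group R\<^esub> = word_class R []"
    by (simp add: presented_group_def word_class_def)
  have "(\<exists>u'\<in>word_class R u. \<exists>v'\<in>word_class R v. word_eq R (u' @ v') w) \<longleftrightarrow> word_eq R (u @ v) w" for w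
    unfolding word_class_def by (auto intro: word_refl word_trans[OF word_append])
  then show "word_class R u \<otimes>\<^bsub>presented_group R\<^esub> word_class R v = word_class R (u @ v)"
    by (simp add: presented_group_def word_class_def[of R "u @ v"])
qed

lemma group_presented_group: "group (presented_group R)"
proof (rule groupI)
  fix x assume "x \<in> carrier (presented_group R)"
  then obtain u where "x = word_class R u" by (auto simp: presented_group_simps)
  moreover have "word_class R (word_inv u @ u) = word_class R []"
    by (simp add: word_class_eq_iff word_eq_inv)
  ultimately show "\<exists>y\<in>carrier (presented_group R). y \<otimes>\<^bsub>presented_group R\<^esub> x = \<one>\<^bsub>presented_group R\<^esub>"
    by (auto simp: presented_group_simps)
qed (auto simp: presented_group_simps)

section \<open>Invariants of words that tell elements of the presented group apart\<close>

definition letter_exp :: "'g \<Rightarrow> bool \<times> 'g \<Rightarrow> int" where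
  "letter_exp g l = (if snd l = g then if fst l then 1 else - 1 else 0)"

fun word_exp :: "'g \<Rightarrow> 'g word \<Rightarrow> int" where
  "word_exp g [] = 0"
| "word_exp g (l # w) = letter_exp g l + word_exp g w"

text \<open>The exponent of the central generator \<open>b\<close> in the normal form of a word, where collecting
  the letters \<open>Alpha\<close> to the left of the letters \<open>g\<close> produces powers of \<open>b = [g, Alpha]\<close>.\<close>

fun word_central_exp :: "phi4_gen \<Rightarrow> phi4_gen \<Rightarrow> phi4_gen word \<Rightarrow> int" where
  "word_central_exp g b [] = 0"
| "word_central_exp g b (l # w) = letter_exp b l + letter_exp g l * word_exp Alpha w + word_central_exp g b w"

lemma word_exp_append: "word_exp g (u @ v) = word_exp g u + word_exp g v"
  by (induction u) auto

text \<open>This is the product rule for the corner entry of upper unitriangular 3 by 3 matrices: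
  together with \<open>word_exp g\<close> and \<open>word_exp Alpha\<close> as the other two
  entries, it maps words multiplicatively into a Heisenberg group.\<close>

lemma word_central_exp_append:
  "word_central_exp g b (u @ v)
   = word_central_exp g b u + word_central_exp g b v + word_exp g u * word_exp Alpha v"
  by (induction u) (auto simp: word_exp_append algebra_simps)

lemma word_exp_pow: "word_exp g (word_pow u n) = int n * word_exp g u"
  by (induction n) (auto simp: word_pow_def word_exp_append algebra_simps)

lemma word_central_exp_pow_gen:
  assumes "g \<noteq> Alpha"
  shows "word_central_exp g b (word_pow (word_gen x) n) = int n * letter_exp b (True, x)"
proof (induction n)
  case (Suc n)
  have "word_pow (word_gen x) (Suc n) = word_gen x @ word_pow (word_gen x) n" by (simp add: word_pow_def)
  then show ?case using Suc assms
    by (simp add: word_central_exp_append word_exp_pow word_gen_def letter_exp_def algebra_simps)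
qed (simp add: word_pow_def)

lemma phi4_relations_cases:
  assumes "(u, v) \<in> phi4_relations p"
  obtains (1) "u = word_commutator (word_gen Alpha1) (word_gen Alpha)" "v = word_gen Beta1"
    | (2) "u = word_commutator (word_gen Alpha2) (word_gen Alpha)" "v = word_gen Beta2"
    | (3) x y where "u = word_commutator (word_gen x) (word_gen y)" "v = []"
        "{x, y} \<noteq> {Alpha1, Alpha}" "{x, y} \<noteq> {Alpha2, Alpha}"
    | (4) x where "u = word_pow (word_gen x) p" "v = []"
  using assms unfolding phi4_relations_def by blast

lemma word_commutator_gen:
  "word_commutator (word_gen x) (word_gen y) = [(False, x), (False, y), (True, x), (True, y)]"
  by (simp add: word_commutator_def word_gen_def word_inv_def)

text \<open>Exponent sums are additive and respect the relations modulo \<open>p\<close>.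
  \<open>Beta1\<close> and \<open>Beta2\<close> are excluded: they are commutators, so their
  exponent sums are not invariant.\<close>

lemma word_eq_exp:
  assumes "word_eq (phi4_relations p) u v" "g \<in> {Alpha, Alpha1, Alpha2}"
  shows "word_exp g u mod int p = word_exp g v mod int p"
  using assms(1)
proof (induction rule: word_eq.induct)
  case (word_rel u v)
  then show ?case
    by (cases rule: phi4_relations_cases)
      (use assms(2) in \<open>auto simp: word_commutator_gen word_gen_def[of Beta1] word_gen_def[of Beta2] letter_exp_def word_exp_pow\<close>)
next
  case (word_append u u' v v')
  then show ?case unfolding word_exp_append by (intro mod_add_cong)
qed (simp_all add: letter_exp_def)

text \<open>The Heisenberg group modulo \<open>p\<close> satisfies all relations if
  \<open>g\<close>, \<open>Alpha\<close> and \<open>b\<close> go to its standard generators and the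
  other two generators to the identity. This keeps the powers of \<open>b\<close> apart, which
  exponent sums cannot do.\<close>

lemma word_eq_central_exp:
  assumes "word_eq (phi4_relations p) u v" "(g, b) \<in> {(Alpha1, Beta1), (Alpha2, Beta2)}"
  shows "word_central_exp g b u mod int p = word_central_exp g b v mod int p"
  using assms(1)
proof (induction rule: word_eq.induct)
  case (word_rel u v)
  then show ?case
  proof (cases rule: phi4_relations_cases)
    case (3 x y)
    have "word_central_exp g b u = 0"
      unfolding 3(1) word_commutator_gen using 3(3,4) assms(2)
      by (cases x; cases y; simp add: letter_exp_def insert_commute; elim disjE; simp)
    then show ?thesis using 3 by simp
  next
    case (4 x)
    then show ?thesis using assms(2) by (auto simp: word_central_exp_pow_gen)
  qed (use assms(2) in \<open>auto simp: word_commutator_gen word_gen_def[of Beta1] word_gen_def[of Beta2] letter_exp_def\<close>)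
next
  case (word_append u u' v v')
  from assms(2) have "word_exp g u mod int p = word_exp g u' mod int p"
    by (intro word_eq_exp word_append.hyps) auto
  moreover have "word_exp Alpha v mod int p = word_exp Alpha v' mod int p"
    by (intro word_eq_exp word_append.hyps) auto
  ultimately show ?case unfolding word_central_exp_append using word_append.IH by (intro mod_add_cong mod_mult_cong)
next
  case (word_cancel e x)
  show ?case using assms(2) by (auto simp: letter_exp_def)
qed simp_all

section \<open>Centres, commutators and derived subgroups of arbitrary groups\<close>

lemma (in group) cancel_left:
  assumes "x \<in> carrier G" "y \<in> carrier G"
  shows "inv x \<otimes> (x \<otimes> y) = y" "x \<otimes> (inv x \<otimes> y) = y"
  using assms by (simp_all flip: m_assoc)

lemmas (in group) group_simps = m_assoc inv_mult_group cancel_left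

lemma (in group) subgroup_centre: "subgroup (centre G) G"
proof (rule subgroupI)
  fix a b assume ab: "a \<in> centre G" "b \<in> centre G"
  then have comm: "a \<otimes> b \<otimes> x = x \<otimes> (a \<otimes> b)" if "x \<in> carrier G" for x
  proof -
    have "a \<in> carrier G" "b \<in> carrier G" "a \<otimes> x = x \<otimes> a" "b \<otimes> x = x \<otimes> b"
      using ab that by (auto simp: centre_def)
    note e = this
    have "a \<otimes> b \<otimes> x = a \<otimes> (x \<otimes> b)" unfolding e(4)[symmetric] using e(1,2) that by (simp add: m_assoc)
    also have "\<dots> = (x \<otimes> a) \<otimes> b" unfolding e(3)[symmetric] using e(1,2) that by (simp add: m_assoc)
    also have "\<dots> = x \<otimes> (a \<otimes> b)" using e(1,2) that by (simp add: m_assoc)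
    finally show ?thesis .
  qed
  have "a \<otimes> b \<in> carrier G" using ab unfolding centre_def by blast
  then show "a \<otimes> b \<in> centre G"
    unfolding centre_def by (intro CollectI conjI ballI) (assumption, rule comm)
next
  fix a assume a: "a \<in> centre G"
  then have "inv a \<otimes> x = x \<otimes> inv a" if "x \<in> carrier G" for x
  proof -
    have "a \<otimes> x = x \<otimes> a" "a \<in> carrier G" using a that by (auto simp: centre_def)
    then have "inv a \<otimes> (a \<otimes> x) \<otimes> inv a = inv a \<otimes> (x \<otimes> a) \<otimes> inv a" by simp
    then show ?thesis using that \<open>a \<in> carrier G\<close> by (simp add: group_simps)
  qed
  with a show "inv a \<in> centre G" by (simp add: centre_def)
next
  have "\<one> \<in> centre G" by (simp add: centre_def)
  then show "centre G \<noteq> {}" by blast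
qed (simp add: centre_def)

lemma (in group) normal_centre: "centre G \<lhd> G"
proof (rule normal_invI[OF subgroup_centre])
  fix x h assume x: "x \<in> carrier G" and h: "h \<in> centre G"
  then have "x \<otimes> h = h \<otimes> x" "h \<in> carrier G" by (auto simp: centre_def)
  then have "x \<otimes> h \<otimes> inv x = h" using x by (simp add: m_assoc)
  then show "x \<otimes> h \<otimes> inv x \<in> centre G" using h by simp
qed

lemma (in group) commutator_eqI:
  assumes "x \<in> carrier G" "y \<in> carrier G" "z \<in> carrier G" "x \<otimes> y = y \<otimes> x \<otimes> z"
  shows "commutator G x y = z"
proof -
  have "commutator G x y = inv (y \<otimes> x) \<otimes> (x \<otimes> y)"
    using assms(1-3) by (simp add: commutator_def group_simps)
  also have "\<dots> = z" unfolding assms(4) using assms(1-3) by (simp add: group_simps)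
  finally show ?thesis .
qed

lemma (in group) mult_commutator:
  assumes "x \<in> carrier G" "y \<in> carrier G"
  shows "x \<otimes> y = y \<otimes> x \<otimes> commutator G x y"
  using assms by (simp add: commutator_def group_simps)

lemma (in group) commutator_closed [simp, intro]:
  "x \<in> carrier G \<Longrightarrow> y \<in> carrier G \<Longrightarrow> commutator G x y \<in> carrier G"
  by (simp add: commutator_def)

lemma (in group) commutator_in_derived:
  "x \<in> carrier G \<Longrightarrow> y \<in> carrier G \<Longrightarrow> commutator G x y \<in> commutator_subgroup G"
  unfolding derived_def
proof (rule generate.incl)
  assume xy: "x \<in> carrier G" "y \<in> carrier G"
  have "commutator G x y = inv x \<otimes> inv y \<otimes> inv (inv x) \<otimes> inv (inv y)"
    using xy by (simp add: commutator_def)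
  also have "\<dots> \<in> derived_set G (carrier G)"
    using xy by (intro UN_I[of "inv x"] UN_I[of "inv y"] inv_closed singletonI)
  finally show "commutator G x y \<in> derived_set G (carrier G)" .
qed

lemma (in group) derived_subset:
  assumes "subgroup S G" "\<And>x y. x \<in> carrier G \<Longrightarrow> y \<in> carrier G \<Longrightarrow> commutator G x y \<in> S"
  shows "commutator_subgroup G \<subseteq> S"
  unfolding derived_def
proof (rule generate_subgroup_incl[OF _ assms(1)])
  show "derived_set G (carrier G) \<subseteq> S"
  proof clarify
    \<comment> \<open>The generators of \<open>derived_set\<close> are commutators of the inverses
      in the convention of \<open>commutator\<close>.\<close>
    fix h1 h2 assume "h1 \<in> carrier G" "h2 \<in> carrier G"
    then show "h1 \<otimes> h2 \<otimes> inv h1 \<otimes> inv h2 \<in> S"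
      using assms(2)[of "inv h1" "inv h2"] by (simp add: commutator_def)
  qed
qed

text \<open>Coordinates on a group of the family: \<open>A\<close>, \<open>X1\<close> and \<open>X2\<close> are the exponents of
  \<open>\<alpha>\<close>, \<open>\<alpha>\<^sub>1\<close> and \<open>\<alpha>\<^sub>2\<close> modulo the centre, and
  \<open>B i j\<close> corresponds to \<open>\<beta>\<^sub>1^i \<beta>\<^sub>2^j\<close>.\<close>

definition phi4_coordinates ::
    "nat \<Rightarrow> ('a, 'b) monoid_scheme \<Rightarrow> ('a \<Rightarrow> int) \<Rightarrow> ('a \<Rightarrow> int) \<Rightarrow> ('a \<Rightarrow> int) \<Rightarrow> (int \<Rightarrow> int \<Rightarrow> 'a) \<Rightarrow> bool" where
  "phi4_coordinates p G A X1 X2 B \<longleftrightarrow>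
     (\<forall>F\<in>{A, X1, X2}. \<forall>g\<in>carrier G. \<forall>h\<in>carrier G. F (g \<otimes>\<^bsub>G\<^esub> h) mod int p = (F g + F h) mod int p) \<and>
     (\<forall>i j k. \<exists>g\<in>carrier G. A g mod int p = i mod int p \<and> X1 g mod int p = j mod int p \<and> X2 g mod int p = k mod int p) \<and>
     (\<forall>g\<in>carrier G. g \<in> centre G \<longleftrightarrow> (\<forall>F\<in>{A, X1, X2}. F g mod int p = 0)) \<and>
     (\<forall>g\<in>carrier G. \<forall>h\<in>carrier G. commutator G g h = B (X1 g * A h - X1 h * A g) (X2 g * A h - X2 h * A g)) \<and>
     (\<forall>i j i' j'. B i j \<otimes>\<^bsub>G\<^esub> B i' j' = B (i + i') (j + j')) \<and>
     (\<forall>i j i' j'. B i j = B i' j' \<longleftrightarrow> i mod int p = i' mod int p \<and> j mod int p = j' mod int p) \<and>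
     commutator_subgroup G = range (\<lambda>(i, j). B i j)"

section \<open>Coordinates on the presented group\<close>

lemma mod_mult_diff_cong:
  fixes m :: int
  assumes "a mod m = a' mod m" "b mod m = b' mod m" "c mod m = c' mod m" "d mod m = d' mod m"
  shows "(a * b - c * d) mod m = (a' * b' - c' * d') mod m"
  by (intro mod_diff_cong mod_mult_cong assms)

text \<open>Commutators of words follow from those of generators by bilinearity, the
  \<open>Beta\<close> generators being central. The invariants of words supply what the relations
  alone cannot: coordinates well defined modulo \<open>p\<close>, and distinct \<open>B i j\<close>
  for pairs that differ modulo \<open>p\<close>.\<close>

lemma phi4_group_coordinates:
  fixes H (structure)
  assumes p: "Factorial_Ring.prime p" and H_def: "H = phi4_group p"
  shows "\<exists>A X1 X2 B. phi4_coordinates p H A X1 X2 B"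
proof -
  define R where "R = phi4_relations p"
  have H_eq: "H = presented_group R" by (simp add: H_def R_def phi4_group_def)
  interpret H: group H unfolding H_eq by (rule group_presented_group)
  define cl where "cl = word_class R"
  note H_simps = presented_group_simps[of R, folded H_eq cl_def]
  have cl_eq: "cl u = cl v \<longleftrightarrow> word_eq R u v" for u v unfolding cl_def by (rule word_class_eq_iff)
  have cl_H [simp, intro]: "cl u \<in> carrier H" for u by (simp add: H_simps)
  define ge where "ge x = cl [(True, x)]" for x
  have ge_H [simp, intro]: "ge x \<in> carrier H" for x by (simp add: ge_def)
  have inv_ge: "inv (ge x) = cl [(False, x)]" for x
  proof (rule H.inv_equality)
    show "cl [(False, x)] \<otimes> ge x = \<one>"
      using word_cancel[of R False x] by (simp add: ge_def H_simps cl_eq)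
  qed auto
  have cl_induct: "P (cl w)" if "P \<one>" "\<And>x w. P (cl w) \<Longrightarrow> P (ge x \<otimes> cl w)"
    "\<And>x w. P (cl w) \<Longrightarrow> P (inv (ge x) \<otimes> cl w)" for P w
  proof (induction w)
    case (Cons l w)
    obtain e x where "l = (e, x)" by fastforce
    then have "cl (l # w) = (if e then ge x else inv (ge x)) \<otimes> cl w"
      by (simp add: inv_ge) (simp add: ge_def H_simps)
    then show ?case using Cons that by simp
  qed (use that in \<open>simp add: H_simps\<close>)
  have rel: "word_eq R u v" if "(u, v) \<in> R" for u v using that by (rule word_eq.word_rel)
  have comm_cl: "cl (word_commutator (word_gen x) (word_gen y)) = commutator H (ge x) (ge y)" for x y
  proof -
    have "word_commutator (word_gen x) (word_gen y) = [(False, x)] @ [(False, y)] @ [(True, x)] @ [(True, y)]"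
      by (simp add: word_commutator_def word_gen_def word_inv_def)
    then show ?thesis by (simp add: commutator_def inv_ge) (simp add: ge_def H_simps)
  qed
  have comm_trivial: "ge x \<otimes> ge y = ge y \<otimes> ge x"
    if "{x, y} \<noteq> {Alpha1, Alpha}" "{x, y} \<noteq> {Alpha2, Alpha}" for x y
  proof -
    have "(word_commutator (word_gen x) (word_gen y), []) \<in> R"
      using that by (auto simp: R_def phi4_relations_def)
    then have "cl (word_commutator (word_gen x) (word_gen y)) = cl []" by (simp only: cl_eq rel)
    then have "commutator H (ge x) (ge y) = \<one>" by (simp add: comm_cl H_simps)
    then show ?thesis using H.mult_commutator[of "ge x" "ge y"] by simp
  qed
  have ge_pow_cl: "ge x [^] n = cl (word_pow (word_gen x) n)" for x and n :: nat
  proof (induction n)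
    case (Suc n)
    have "word_pow (word_gen x) n @ word_gen x = word_pow (word_gen x) (Suc n)"
      by (induction n) (auto simp: word_pow_def)
    then show ?case using Suc by (simp add: ge_def H_simps word_gen_def)
  qed (simp add: H_simps word_pow_def)
  have ge_p: "ge x [^] p = \<one>" for x
  proof -
    have "(word_pow (word_gen x) p, []) \<in> R" by (auto simp: R_def phi4_relations_def)
    then show ?thesis by (simp add: ge_pow_cl H_simps(3) cl_eq rel)
  qed
  have central: "z \<otimes> cl w = cl w \<otimes> z"
    if z: "z \<in> carrier H" and "\<And>x. z \<otimes> ge x = ge x \<otimes> z" for z w
  proof (induction rule: cl_induct)
    case (2 x w)
    then show ?case using z that(2)[of x] by (metis H.m_assoc cl_H ge_H)
  next
    case (3 x w)
    have "z \<otimes> inv (ge x) = inv (ge x) \<otimes> z"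
      using z that(2)[of x] by (metis H.inv_closed H.inv_solve_left H.inv_solve_right H.m_assoc H.m_closed ge_H)
    then show ?case using z 3 by (metis H.m_assoc H.inv_closed cl_H ge_H)
  qed (use z in simp)
  define b1 where "b1 = ge Beta1"
  define b2 where "b2 = ge Beta2"
  have bH [simp]: "b1 \<in> carrier H" "b2 \<in> carrier H" by (simp_all add: b1_def b2_def)
  have b_central: "b1 \<in> centre H" "b2 \<in> centre H"
  proof -
    have "z \<in> centre H" if "z \<in> carrier H" "\<And>x. z \<otimes> ge x = ge x \<otimes> z" for z
      using that central[OF that] by (auto simp: centre_def H_simps(1))
    then show "b1 \<in> centre H" "b2 \<in> centre H"
      unfolding b1_def b2_def by (auto intro!: comm_trivial simp: doubleton_eq_iff)
  qed
  define B where "B i j = b1 [^] (i::int) \<otimes> b2 [^] (j::int)" for i j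
  have B_H [simp, intro]: "B i j \<in> carrier H" for i j by (simp add: B_def)
  have B_centre: "B i j \<in> centre H" for i j
  proof -
    interpret C: subgroup "centre H" H by (rule H.subgroup_centre)
    have "b1 [^] i \<in> centre H" "b2 [^] j \<in> centre H"
      using b_central H.subgroup_centre by (auto intro: H.subgroup_int_pow_closed)
    then show ?thesis by (simp add: B_def)
  qed
  then have B_comm: "B i j \<otimes> x = x \<otimes> B i j" if "x \<in> carrier H" for i j x
    using that by (simp add: centre_def)
  have b2_comm: "b2 [^] (j::int) \<otimes> x = x \<otimes> b2 [^] j" if "x \<in> carrier H" for j x
    using B_comm[OF that, of 0 j] by (simp add: B_def)
  have B_mult: "B i j \<otimes> B i' j' = B (i + i') (j + j')" for i j i' j'
  proof -
    have "B i j \<otimes> B i' j' = b1 [^] i \<otimes> (b2 [^] j \<otimes> b1 [^] i') \<otimes> b2 [^] j'"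
      by (simp add: B_def H.m_assoc)
    also have "b2 [^] j \<otimes> b1 [^] i' = b1 [^] i' \<otimes> b2 [^] j" by (rule b2_comm) simp
    finally show ?thesis by (simp add: B_def H.m_assoc H.int_pow_mult)
  qed
  have B_0: "B 0 0 = \<one>" by (simp add: B_def)
  have B_inv: "inv (B i j) = B (- i) (- j)" for i j
    by (rule H.inv_equality) (simp_all add: B_mult B_0)
  \<comment> \<open>The relation \<open>[U, V] = B i j\<close>, multiplied out so that it can be
    rewritten without inverses. It is antisymmetric by \<open>C_sym\<close> and additive by
    \<open>C_mult\<close>.\<close>
  define C where "C U V i j \<longleftrightarrow> U \<otimes> V = V \<otimes> U \<otimes> B i j" for U V i j
  have C_sym: "C V U (- i) (- j)" if "C U V i j" "U \<in> carrier H" "V \<in> carrier H" for U V i j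
  proof -
    have "U \<otimes> V \<otimes> B (- i) (- j) = V \<otimes> U \<otimes> (B i j \<otimes> B (- i) (- j))"
      using that by (simp add: C_def H.m_assoc)
    then show ?thesis using that by (simp add: C_def B_mult B_0)
  qed
  have C_mult: "C (U \<otimes> U') V (i + i') (j + j')"
    if "C U V i j" "C U' V i' j'" and [simp]: "U \<in> carrier H" "U' \<in> carrier H" "V \<in> carrier H" for U U' V i j i' j'
  proof -
    have "U \<otimes> U' \<otimes> V = U \<otimes> (V \<otimes> U' \<otimes> B i' j')"
      using that by (simp add: C_def H.m_assoc)
    also have "\<dots> = (V \<otimes> U \<otimes> B i j) \<otimes> U' \<otimes> B i' j'"
      using that by (simp add: C_def flip: H.m_assoc)
    also have "\<dots> = V \<otimes> U \<otimes> (B i j \<otimes> U') \<otimes> B i' j'"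
      by (simp add: H.m_assoc)
    also have "\<dots> = V \<otimes> (U \<otimes> U') \<otimes> B (i + i') (j + j')"
    proof -
      have "B i j \<otimes> U' = U' \<otimes> B i j" by (rule B_comm) simp
      then show ?thesis by (simp only: H.m_assoc B_mult H.m_closed B_H that)
    qed
    finally show ?thesis by (simp add: C_def)
  qed
  have C_inv: "C (inv U) V (- i) (- j)" if c: "C U V i j" and [simp]: "U \<in> carrier H" "V \<in> carrier H" for U V i j
  proof -
    have "inv U \<otimes> V \<otimes> B i j = inv U \<otimes> (V \<otimes> U \<otimes> B i j) \<otimes> inv U"
      by (simp add: H.m_assoc B_comm[of "inv U"])  (simp flip: H.m_assoc)
    also have "\<dots> = V \<otimes> inv U"
      unfolding c[unfolded C_def, symmetric] by (simp flip: H.m_assoc)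
    finally have "V \<otimes> inv U = inv U \<otimes> V \<otimes> B i j" by simp
    then have "C V (inv U) i j" by (simp add: C_def)
    then show ?thesis by (intro C_sym) auto
  qed
  \<comment> \<open>Determinant of the exponents of \<open>g\<close> and \<open>Alpha\<close> in
    \<open>u\<close> and \<open>v\<close>. It is nonzero on generators only for the pairs whose
    commutator is a \<open>Beta\<close> generator or its inverse.\<close>
  define \<omega> where "\<omega> g u v = word_exp g u * word_exp Alpha v - word_exp g v * word_exp Alpha u" for g u v
  have C_gen: "C (ge x) (ge y) (\<omega> Alpha1 [(True, x)] [(True, y)]) (\<omega> Alpha2 [(True, x)] [(True, y)])" for x y
  proof -
    have 1: "C (ge Alpha1) (ge Alpha) 1 0" 
    proof -
      have "(word_commutator (word_gen Alpha1) (word_gen Alpha), word_gen Beta1) \<in> R" by (simp add: R_def phi4_relations_def)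
      then have "commutator H (ge Alpha1) (ge Alpha) = b1"
        unfolding comm_cl[symmetric] b1_def ge_def[of Beta1] cl_eq using rel by (simp add: word_gen_def[of Beta1])
      then show ?thesis unfolding C_def using H.mult_commutator[of "ge Alpha1" "ge Alpha"] by (simp add: B_def H.int_pow_1)
    qed
    have 2: "C (ge Alpha2) (ge Alpha) 0 1" 
    proof -
      have "(word_commutator (word_gen Alpha2) (word_gen Alpha), word_gen Beta2) \<in> R" by (simp add: R_def phi4_relations_def)
      then have "commutator H (ge Alpha2) (ge Alpha) = b2"
        unfolding comm_cl[symmetric] b2_def ge_def[of Beta2] cl_eq using rel by (simp add: word_gen_def[of Beta2])
      then show ?thesis unfolding C_def using H.mult_commutator[of "ge Alpha2" "ge Alpha"] by (simp add: B_def H.int_pow_1)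
    qed
    have 0: "C (ge x) (ge y) 0 0" if "{x, y} \<noteq> {Alpha1, Alpha}" "{x, y} \<noteq> {Alpha2, Alpha}" for x y
      using comm_trivial[OF that] by (simp add: C_def B_0)
    have 3: "C (ge Alpha) (ge Alpha1) (-1) 0" "C (ge Alpha) (ge Alpha2) 0 (-1)"
      using C_sym[OF 1] C_sym[OF 2] by simp_all
    show ?thesis
    proof (cases "{x, y} = {Alpha1, Alpha} \<or> {x, y} = {Alpha2, Alpha}")
      case True
      then show ?thesis using 1 2 3 by (auto simp: doubleton_eq_iff \<omega>_def letter_exp_def)
    next
      case False
      then have "\<omega> Alpha1 [(True, x)] [(True, y)] = 0" "\<omega> Alpha2 [(True, x)] [(True, y)] = 0"
        by (auto simp: \<omega>_def letter_exp_def)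
      then show ?thesis using 0 False by simp
    qed
  qed
  have C_word: "C (cl u) (cl v) (\<omega> Alpha1 u v) (\<omega> Alpha2 u v)" for u v
  proof -
    have letter: "C (cl (l # w)) V (i + i') (j + j')"
      if "C (ge (snd l)) V (if fst l then i else - i) (if fst l then j else - j)" "C (cl w) V i' j'" "V \<in> carrier H"
      for l w V i j i' j'
    proof -
      obtain e x where l: "l = (e, x)" by fastforce
      have "C (cl [l]) V i j"
        using that C_inv[OF that(1)] by (cases e) (simp_all add: l inv_ge, simp add: ge_def)
      then have "C (cl [l] \<otimes> cl w) V (i + i') (j + j')" using that by (intro C_mult) auto
      then show ?thesis by (simp add: H_simps)
    qed
    \<comment> \<open>Induction on \<open>u\<close> against a single generator. The induction on
      \<open>v\<close> afterwards uses antisymmetry to bring its new letter into the first argument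
      as well.\<close>
    have 1: "C (cl u) (ge y) (\<omega> Alpha1 u [(True, y)]) (\<omega> Alpha2 u [(True, y)])" for u y
    proof (induction u)
      case Nil
      show ?case by (simp add: \<omega>_def C_def B_0 H_simps(3)[symmetric])
    next
      case (Cons l u)
      have "C (cl (l # u)) (ge y) (\<omega> Alpha1 [l] [(True, y)] + \<omega> Alpha1 u [(True, y)]) (\<omega> Alpha2 [l] [(True, y)] + \<omega> Alpha2 u [(True, y)])"
      proof (rule letter[OF _ Cons ge_H])
        show "C (ge (snd l)) (ge y)
         (if fst l then \<omega> Alpha1 [l] [(True, y)] else - \<omega> Alpha1 [l] [(True, y)])
         (if fst l then \<omega> Alpha2 [l] [(True, y)] else - \<omega> Alpha2 [l] [(True, y)])"
          using C_gen[of "snd l" y] by (cases l; cases "fst l") (auto simp: \<omega>_def letter_exp_def)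
      qed
      then show ?case by (simp add: \<omega>_def algebra_simps)
    qed
    show ?thesis
    proof (induction v)
      case Nil
      show ?case by (simp add: \<omega>_def C_def B_0 H_simps(3)[symmetric])
    next
      case (Cons l v)
      have "C (cl (l # v)) (cl u) (\<omega> Alpha1 [l] u + \<omega> Alpha1 v u) (\<omega> Alpha2 [l] u + \<omega> Alpha2 v u)"
      proof (rule letter)
        show "C (ge (snd l)) (cl u)
         (if fst l then \<omega> Alpha1 [l] u else - \<omega> Alpha1 [l] u)
         (if fst l then \<omega> Alpha2 [l] u else - \<omega> Alpha2 [l] u)"
          using C_sym[OF 1[of u "snd l"]] by (cases l; cases "fst l") (auto simp: \<omega>_def letter_exp_def)
        show "C (cl v) (cl u) (\<omega> Alpha1 v u) (\<omega> Alpha2 v u)" using C_sym[OF Cons] by (simp add: \<omega>_def)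
      qed auto
      from C_sym[OF this] show ?case by (simp add: \<omega>_def algebra_simps)
    qed
  qed
  have comm_word: "commutator H (cl u) (cl v) = B (\<omega> Alpha1 u v) (\<omega> Alpha2 u v)" for u v
    using C_word[of u v] unfolding C_def by (intro H.commutator_eqI) auto
  have p0: "0 < p" using p by (rule prime_gt_0_nat)
  have pow_mod: "ge x [^] (i::int) = ge x [^] nat (i mod int p)" for x i
  proof -
    have "ge x [^] i = ge x [^] (int p * (i div int p) + i mod int p)" by simp
    also have "\<dots> = (ge x [^] int p) [^] (i div int p) \<otimes> ge x [^] (i mod int p)"
      by (simp only: H.int_pow_mult ge_H H.int_pow_pow)
    also have "ge x [^] int p = \<one>" using ge_p by (simp add: int_pow_int)
    finally show ?thesis using p0 by (simp flip: int_pow_int)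
  qed
  have B_cl: "B i j = cl (word_pow (word_gen Beta1) (nat (i mod int p)) @ word_pow (word_gen Beta2) (nat (j mod int p)))" for i j
    by (simp add: B_def b1_def b2_def pow_mod[of _ i] pow_mod[of _ j] ge_pow_cl H_simps)
  have B_eq: "B i j = B i' j' \<longleftrightarrow> i mod int p = i' mod int p \<and> j mod int p = j' mod int p" for i j i' j'
  proof
    assume "B i j = B i' j'"
    then have *: "word_eq (phi4_relations p)
        (word_pow (word_gen Beta1) (nat (i mod int p)) @ word_pow (word_gen Beta2) (nat (j mod int p)))
        (word_pow (word_gen Beta1) (nat (i' mod int p)) @ word_pow (word_gen Beta2) (nat (j' mod int p)))"
      by (simp add: B_cl cl_eq R_def)
    show "i mod int p = i' mod int p \<and> j mod int p = j' mod int p"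
      using word_eq_central_exp[OF *, of Alpha1 Beta1] word_eq_central_exp[OF *, of Alpha2 Beta2] p0
      by (simp add: word_central_exp_append word_central_exp_pow_gen word_exp_pow word_gen_def[of Beta2] word_gen_def[of Beta1] letter_exp_def)
        (simp add: word_gen_def[symmetric] word_central_exp_pow_gen letter_exp_def)
  qed (simp add: B_cl)
  \<comment> \<open>The exponents of a class are read off from an arbitrary representative, so they
    are meaningful modulo \<open>p\<close> only.\<close>
  define rp where "rp U = (SOME w. U = cl w)" for U
  have rp: "cl (rp U) = U" if "U \<in> carrier H" for U
    unfolding rp_def using that someI_ex[of "\<lambda>w. U = cl w"] by (auto simp: H_simps)
  define A where "A U = word_exp Alpha (rp U)" for U
  define X1 where "X1 U = word_exp Alpha1 (rp U)" for U
  define X2 where "X2 U = word_exp Alpha2 (rp U)" for U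
  have exp_rp: "word_exp g (rp (cl u)) mod int p = word_exp g u mod int p" if "g \<in> {Alpha, Alpha1, Alpha2}" for g u
  proof -
    have "word_eq (phi4_relations p) (rp (cl u)) u" using rp[of "cl u"] by (simp add: cl_eq R_def)
    then show ?thesis using that by (rule word_eq_exp)
  qed
  have comm_H: "commutator H g h = B (X1 g * A h - X1 h * A g) (X2 g * A h - X2 h * A g)"
    if "g \<in> carrier H" "h \<in> carrier H" for g h
    using comm_word[of "rp g" "rp h"] that by (simp add: rp \<omega>_def A_def X1_def X2_def)
  have hom: "word_exp x (rp (g \<otimes> h)) mod int p = (word_exp x (rp g) + word_exp x (rp h)) mod int p"
    if "x \<in> {Alpha, Alpha1, Alpha2}" "g \<in> carrier H" "h \<in> carrier H" for x g h
  proof -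
    have "g \<otimes> h = cl (rp g @ rp h)" using that by (simp add: rp flip: H_simps)
    then show ?thesis using exp_rp[OF that(1)] by (simp add: word_exp_append)
  qed
  have surj: "\<exists>g\<in>carrier H. A g mod int p = i mod int p \<and> X1 g mod int p = j mod int p \<and> X2 g mod int p = k mod int p" for i j k
  proof -
    define w where "w = word_pow (word_gen Alpha) (nat (i mod int p)) @ word_pow (word_gen Alpha1) (nat (j mod int p))
      @ word_pow (word_gen Alpha2) (nat (k mod int p))"
    have "A (cl w) mod int p = i mod int p" "X1 (cl w) mod int p = j mod int p" "X2 (cl w) mod int p = k mod int p"
      unfolding A_def X1_def X2_def using p0
      by (simp_all add: exp_rp) (simp_all add: w_def word_exp_append word_exp_pow word_gen_def letter_exp_def)
    then show ?thesis by blast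
  qed
  have "phi4_coordinates p H A X1 X2 B"
    unfolding phi4_coordinates_def
  proof (intro conjI)
    show "\<forall>F\<in>{A, X1, X2}. \<forall>g\<in>carrier H. \<forall>h\<in>carrier H. F (g \<otimes> h) mod int p = (F g + F h) mod int p"
      using hom by (simp add: A_def X1_def X2_def)
    show "\<forall>g\<in>carrier H. (g \<in> centre H) = (\<forall>F\<in>{A, X1, X2}. F g mod int p = 0)"
    proof (intro ballI iffI)
      fix g assume g: "g \<in> carrier H" and F: "\<forall>F\<in>{A, X1, X2}. F g mod int p = 0"
      have "g \<otimes> h = h \<otimes> g" if h: "h \<in> carrier H" for h
      proof -
        have "B (X1 g * A h - X1 h * A g) (X2 g * A h - X2 h * A g) = B 0 0"
          unfolding B_eq using F by (auto simp: mod_eq_0_iff_dvd)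
        then have "commutator H g h = \<one>" using g h by (simp add: comm_H B_0)
        then show ?thesis using H.mult_commutator[OF g h] g h by simp
      qed
      then show "g \<in> centre H" using g by (simp add: centre_def)
    next
      fix g F assume g: "g \<in> carrier H" "g \<in> centre H" and F: "F \<in> {A, X1, X2}"
      have zero: "(X1 g * A h - X1 h * A g) mod int p = 0 \<and> (X2 g * A h - X2 h * A g) mod int p = 0" if h: "h \<in> carrier H" for h
      proof -
        have "g \<otimes> h = h \<otimes> g \<otimes> \<one>" using g h by (simp add: centre_def)
        then have "commutator H g h = B 0 0" using g h by (intro H.commutator_eqI) (auto simp: B_0)
        then show ?thesis using g h by (simp add: comm_H B_eq)
      qed
      \<comment> \<open>The commutator with an element of coordinates (1, 0, 0) recovers
        \<open>X1 g\<close> and \<open>X2 g\<close>; the one with an element having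
        \<open>A = 0\<close> and \<open>X1 = 1\<close> recovers \<open>- A g\<close>.\<close>
      obtain h where h: "h \<in> carrier H" "A h mod int p = 1 mod int p" "X1 h mod int p = 0 mod int p" "X2 h mod int p = 0 mod int p"
        using surj[of 1 0 0] by blast
      obtain h' where h': "h' \<in> carrier H" "A h' mod int p = 0 mod int p" "X1 h' mod int p = 1 mod int p"
        using surj[of 0 1 0] by blast
      have "(X1 g * A h - X1 h * A g) mod int p = X1 g mod int p" "(X2 g * A h - X2 h * A g) mod int p = X2 g mod int p"
        "(X1 g * A h' - X1 h' * A g) mod int p = (- A g) mod int p"
        using mod_mult_diff_cong[OF refl h(2) h(3) refl, of "X1 g" "A g"]
          mod_mult_diff_cong[OF refl h(2) h(4) refl, of "X2 g" "A g"]
          mod_mult_diff_cong[OF refl h'(2) h'(3) refl, of "X1 g" "A g"]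
        by simp_all
      then have "X1 g mod int p = 0" "X2 g mod int p = 0" "A g mod int p = 0"
        using zero[OF h(1)] zero[OF h'(1)] by (simp_all add: mod_eq_0_iff_dvd)
      then show "F g mod int p = 0" using F by auto
    qed
    show "commutator_subgroup H = range (\<lambda>(i, j). B i j)"
    proof
      show "commutator_subgroup H \<subseteq> range (\<lambda>(i, j). B i j)"
      proof (rule H.derived_subset)
        show "subgroup (range (\<lambda>(i, j). B i j)) H"
        proof (rule H.subgroupI)
          fix a b assume "a \<in> range (\<lambda>(i, j). B i j)" "b \<in> range (\<lambda>(i, j). B i j)"
          then obtain i j i' j' where "a = B i j" "b = B i' j'" by auto
          then have "inv a = (\<lambda>(i, j). B i j) (- i, - j)" "a \<otimes> b = (\<lambda>(i, j). B i j) (i + i', j + j')"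
            by (simp_all add: B_inv B_mult)
          then show "inv a \<in> range (\<lambda>(i, j). B i j)" "a \<otimes> b \<in> range (\<lambda>(i, j). B i j)" by blast+
        qed auto
        show "commutator H x y \<in> range (\<lambda>(i, j). B i j)" if "x \<in> carrier H" "y \<in> carrier H" for x y
          using comm_H[OF that] by auto
      qed
      show "range (\<lambda>(i, j). B i j) \<subseteq> commutator_subgroup H"
      proof clarify
        fix i j
        \<comment> \<open>Every \<open>B i j\<close> is a single commutator, of elements with
          coordinates (0, i, j) and (1, 0, 0).\<close>
        obtain g where g: "g \<in> carrier H" "A g mod int p = 0 mod int p" "X1 g mod int p = i mod int p" "X2 g mod int p = j mod int p"
          using surj[of 0 i j] by blast
        obtain h where h: "h \<in> carrier H" "A h mod int p = 1 mod int p" "X1 h mod int p = 0 mod int p" "X2 h mod int p = 0 mod int p"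
          using surj[of 1 0 0] by blast
        have "B (X1 g * A h - X1 h * A g) (X2 g * A h - X2 h * A g) = B i j"
          unfolding B_eq
          using mod_mult_diff_cong[OF g(3) h(2) h(3) refl, of "A g"] mod_mult_diff_cong[OF g(4) h(2) h(4) refl, of "A g"]
          by simp
        then show "B i j \<in> commutator_subgroup H"
          using H.commutator_in_derived[OF g(1) h(1)] comm_H[OF g(1) h(1)] by simp
      qed
    qed
  qed (use comm_H B_mult B_eq surj in auto)
  then show ?thesis by blast
qed

section \<open>Structure of the groups in the family\<close>

text \<open>Coordinates involve only the quotient by the centre, the derived subgroup and the
  commutator map between them. So they can be pulled back: \<open>A\<close>, \<open>X1\<close>,
  \<open>X2\<close> along \<open>\<phi>\<close>, and \<open>B\<close> along the inverse of
  \<open>\<psi>\<close>.\<close>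

lemma isoclinic_phi4_coordinates:
  assumes G: "group G" and H: "group H" and iso: "isoclinic G H" and cH: "phi4_coordinates p H A' X1' X2' B'"
  shows "\<exists>A X1 X2 B. phi4_coordinates p G A X1 X2 B"
proof -
  interpret G: group G by fact
  interpret H: group H by fact
  interpret ZG: normal "centre G" G by (rule G.normal_centre)
  interpret ZH: normal "centre H" H by (rule H.normal_centre)
  obtain \<phi> \<psi> where \<phi>: "\<phi> \<in> iso (G Mod centre G) (H Mod centre H)"
    and \<psi>: "\<psi> \<in> iso (G\<lparr>carrier := commutator_subgroup G\<rparr>) (H\<lparr>carrier := commutator_subgroup H\<rparr>)"
    and comm: "\<And>x y x' y'. x \<in> carrier G \<Longrightarrow> y \<in> carrier G \<Longrightarrow> x' \<in> carrier H \<Longrightarrow> y' \<in> carrier H \<Longrightarrow>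
          \<phi> (centre G #>\<^bsub>G\<^esub> x) = centre H #>\<^bsub>H\<^esub> x' \<Longrightarrow> \<phi> (centre G #>\<^bsub>G\<^esub> y) = centre H #>\<^bsub>H\<^esub> y' \<Longrightarrow>
          \<psi> (commutator G x y) = commutator H x' y'"
    using iso unfolding isoclinic_def by blast
  note c = cH[unfolded phi4_coordinates_def]
  have homH: "F (g \<otimes>\<^bsub>H\<^esub> h) mod int p = (F g + F h) mod int p"
    if "F \<in> {A', X1', X2'}" "g \<in> carrier H" "h \<in> carrier H" for F g h using c that by blast
  have surjH: "\<exists>g\<in>carrier H. A' g mod int p = i mod int p \<and> X1' g mod int p = j mod int p \<and> X2' g mod int p = k mod int p" for i j k
    using c by blast
  have zH: "g \<in> centre H \<longleftrightarrow> (\<forall>F\<in>{A', X1', X2'}. F g mod int p = 0)" if "g \<in> carrier H" for g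
    using c that by blast
  have commH: "commutator H g h = B' (X1' g * A' h - X1' h * A' g) (X2' g * A' h - X2' h * A' g)"
    if "g \<in> carrier H" "h \<in> carrier H" for g h using c that by blast
  have multH: "B' i j \<otimes>\<^bsub>H\<^esub> B' i' j' = B' (i + i') (j + j')" for i j i' j' using c by blast
  have eqH: "B' i j = B' i' j' \<longleftrightarrow> i mod int p = i' mod int p \<and> j mod int p = j' mod int p" for i j i' j' using c by blast
  have derH: "commutator_subgroup H = range (\<lambda>(i, j). B' i j)" using c by blast
  \<comment> \<open>The coordinates vanish modulo \<open>p\<close> on the centre and so are
    functions on its cosets. The map \<open>r\<close> may therefore pick representatives
    arbitrarily.\<close>
  have coset_inv: "F x mod int p = F y mod int p"
    if F: "F \<in> {A', X1', X2'}" and xy: "x \<in> carrier H" "y \<in> carrier H" "centre H #>\<^bsub>H\<^esub> x = centre H #>\<^bsub>H\<^esub> y" for F x y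
  proof -
    have "x \<in> centre H #>\<^bsub>H\<^esub> y" using H.rcos_self[OF xy(1) ZH.is_subgroup] xy(3) by simp
    then obtain z where z: "z \<in> centre H" "x = z \<otimes>\<^bsub>H\<^esub> y" by (auto simp: r_coset_def)
    then have "z \<in> carrier H" using ZH.subset by blast
    then have "F z mod int p = 0" using zH[of z] F z by blast
    then have "F x mod int p = (F z + F y) mod int p" using homH[OF F, of z y] z xy by simp
    also have "\<dots> = (0 + F y) mod int p" using \<open>F z mod int p = 0\<close> by (intro mod_add_cong) auto
    finally show ?thesis by simp
  qed
  define r where "r x = (SOME x'. x' \<in> carrier H \<and> \<phi> (centre G #>\<^bsub>G\<^esub> x) = centre H #>\<^bsub>H\<^esub> x')" for x
  have r: "r x \<in> carrier H" "\<phi> (centre G #>\<^bsub>G\<^esub> x) = centre H #>\<^bsub>H\<^esub> r x" if "x \<in> carrier G" for x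
  proof -
    have "centre G #>\<^bsub>G\<^esub> x \<in> carrier (G Mod centre G)" using that by (auto simp: FactGroup_def RCOSETS_def)
    then have "\<phi> (centre G #>\<^bsub>G\<^esub> x) \<in> carrier (H Mod centre H)" using \<phi> by (auto simp: iso_def hom_def)
    then have "\<exists>x'. x' \<in> carrier H \<and> \<phi> (centre G #>\<^bsub>G\<^esub> x) = centre H #>\<^bsub>H\<^esub> x'"
      by (auto simp: FactGroup_def RCOSETS_def)
    then show "r x \<in> carrier H" "\<phi> (centre G #>\<^bsub>G\<^esub> x) = centre H #>\<^bsub>H\<^esub> r x"
      unfolding r_def by (metis (mono_tags, lifting) someI_ex)+
  qed
  have r_mult: "centre H #>\<^bsub>H\<^esub> r (x \<otimes>\<^bsub>G\<^esub> y) = centre H #>\<^bsub>H\<^esub> (r x \<otimes>\<^bsub>H\<^esub> r y)"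
    if xy: "x \<in> carrier G" "y \<in> carrier G" for x y
  proof -
    have mem: "centre G #>\<^bsub>G\<^esub> x \<in> carrier (G Mod centre G)" "centre G #>\<^bsub>G\<^esub> y \<in> carrier (G Mod centre G)"
      using xy by (auto simp: FactGroup_def RCOSETS_def)
    have "centre H #>\<^bsub>H\<^esub> r (x \<otimes>\<^bsub>G\<^esub> y) = \<phi> (centre G #>\<^bsub>G\<^esub> (x \<otimes>\<^bsub>G\<^esub> y))" using r(2)[of "x \<otimes>\<^bsub>G\<^esub> y"] xy by simp
    also have "centre G #>\<^bsub>G\<^esub> (x \<otimes>\<^bsub>G\<^esub> y) = (centre G #>\<^bsub>G\<^esub> x) \<otimes>\<^bsub>G Mod centre G\<^esub> (centre G #>\<^bsub>G\<^esub> y)"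
      using xy by (simp add: ZG.rcos_sum)
    also have "\<phi> \<dots> = \<phi> (centre G #>\<^bsub>G\<^esub> x) \<otimes>\<^bsub>H Mod centre H\<^esub> \<phi> (centre G #>\<^bsub>G\<^esub> y)"
      using \<phi> mem by (auto simp: iso_def hom_def)
    also have "\<dots> = centre H #>\<^bsub>H\<^esub> (r x \<otimes>\<^bsub>H\<^esub> r y)" using xy r by (simp add: ZH.rcos_sum)
    finally show ?thesis .
  qed
  have B'_der: "B' i j \<in> commutator_subgroup H" for i j using derH by auto
  have subH: "subgroup (commutator_subgroup H) H" by (rule H.derived_is_subgroup) simp
  have subG: "subgroup (commutator_subgroup G) G" by (rule G.derived_is_subgroup) simp
  interpret DG: subgroup "commutator_subgroup G" G by (rule subG)
  have \<psi>_bij: "bij_betw \<psi> (commutator_subgroup G) (commutator_subgroup H)" using \<psi> by (auto simp: iso_def)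
  have \<psi>_mult: "\<psi> (x \<otimes>\<^bsub>G\<^esub> y) = \<psi> x \<otimes>\<^bsub>H\<^esub> \<psi> y"
    if "x \<in> commutator_subgroup G" "y \<in> commutator_subgroup G" for x y
    using \<psi> that by (auto simp: iso_def hom_def)
  define B where "B i j = inv_into (commutator_subgroup G) \<psi> (B' i j)" for i j
  have B: "B i j \<in> commutator_subgroup G" "\<psi> (B i j) = B' i j" for i j
    unfolding B_def using \<psi>_bij B'_der by (auto simp: bij_betw_def inv_into_into f_inv_into_f)
  have B_eqI: "x = B i j" if "x \<in> commutator_subgroup G" "\<psi> x = B' i j" for x i j
    using that B[of i j] \<psi>_bij by (metis bij_betw_inv_into_left)
  have B_iff: "B i j = B i' j' \<longleftrightarrow> B' i j = B' i' j'" for i j i' j'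
    using B B_eqI by metis
  have "phi4_coordinates p G (A' \<circ> r) (X1' \<circ> r) (X2' \<circ> r) B"
    unfolding phi4_coordinates_def
  proof (intro conjI)
    have hom: "(F \<circ> r) (g \<otimes>\<^bsub>G\<^esub> h) mod int p = ((F \<circ> r) g + (F \<circ> r) h) mod int p"
      if "F \<in> {A', X1', X2'}" "g \<in> carrier G" "h \<in> carrier G" for F g h
      using coset_inv[OF that(1) _ _ r_mult[OF that(2,3)]] homH[OF that(1), of "r g" "r h"] r that by simp
    then show "\<forall>F\<in>{A' \<circ> r, X1' \<circ> r, X2' \<circ> r}. \<forall>g\<in>carrier G. \<forall>h\<in>carrier G. F (g \<otimes>\<^bsub>G\<^esub> h) mod int p = (F g + F h) mod int p"
      by blast
    show "\<forall>i j k. \<exists>g\<in>carrier G. (A' \<circ> r) g mod int p = i mod int p \<and> (X1' \<circ> r) g mod int p = j mod int p \<and> (X2' \<circ> r) g mod int p = k mod int p"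
    proof (intro allI)
      fix i j k
      obtain h where h: "h \<in> carrier H" "A' h mod int p = i mod int p" "X1' h mod int p = j mod int p" "X2' h mod int p = k mod int p"
        using surjH by blast
      have "centre H #>\<^bsub>H\<^esub> h \<in> carrier (H Mod centre H)" using h by (auto simp: FactGroup_def RCOSETS_def)
      then have "centre H #>\<^bsub>H\<^esub> h \<in> \<phi> ` carrier (G Mod centre G)" using \<phi> by (auto simp: iso_def bij_betw_def)
      then obtain g where g: "g \<in> carrier G" "centre H #>\<^bsub>H\<^esub> h = \<phi> (centre G #>\<^bsub>G\<^esub> g)"
        by (auto simp: FactGroup_def RCOSETS_def)
      then have F: "F (r g) mod int p = F h mod int p" if "F \<in> {A', X1', X2'}" for F
        using coset_inv[OF that, of "r g" h] r h by simp
      show "\<exists>g\<in>carrier G. (A' \<circ> r) g mod int p = i mod int p \<and> (X1' \<circ> r) g mod int p = j mod int p \<and> (X2' \<circ> r) g mod int p = k mod int p"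
        using g h F[of A'] F[of X1'] F[of X2'] by (intro bexI[of _ g]) auto
    qed
    show "\<forall>g\<in>carrier G. (g \<in> centre G) = (\<forall>F\<in>{A' \<circ> r, X1' \<circ> r, X2' \<circ> r}. F g mod int p = 0)"
    proof
      fix g assume g: "g \<in> carrier G"
      have "g \<in> centre G \<longleftrightarrow> centre G #>\<^bsub>G\<^esub> g = centre G"
        using g by (metis G.coset_join1 G.coset_join2 ZG.is_subgroup ZG.subset)
      also have "\<dots> \<longleftrightarrow> centre H #>\<^bsub>H\<^esub> r g = centre H"
      proof -
        interpret QG: group "G Mod centre G" by (rule ZG.factorgroup_is_group)
        interpret QH: group "H Mod centre H" by (rule ZH.factorgroup_is_group)
        have inj: "inj_on \<phi> (carrier (G Mod centre G))" using \<phi> by (auto simp: iso_def bij_betw_def)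
        have "\<phi> \<one>\<^bsub>G Mod centre G\<^esub> = \<one>\<^bsub>H Mod centre H\<^esub>"
          using \<phi> by (intro hom_one QG.group_axioms QH.group_axioms) (auto simp: iso_def)
        then have one: "\<phi> (centre G) = centre H" by simp
        have mem: "centre G \<in> carrier (G Mod centre G)" "centre G #>\<^bsub>G\<^esub> g \<in> carrier (G Mod centre G)"
          using QG.one_closed g by (auto simp: FactGroup_def RCOSETS_def)
        show ?thesis using one inj mem r[OF g] by (metis inj_onD)
      qed
      also have "\<dots> \<longleftrightarrow> r g \<in> centre H"
        using r[OF g] by (metis H.coset_join1 H.coset_join2 ZH.is_subgroup ZH.subset)
      finally show "(g \<in> centre G) = (\<forall>F\<in>{A' \<circ> r, X1' \<circ> r, X2' \<circ> r}. F g mod int p = 0)"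
        using zH[of "r g"] r[OF g] by simp
    qed
    show "\<forall>g\<in>carrier G. \<forall>h\<in>carrier G. commutator G g h =
      B ((X1' \<circ> r) g * (A' \<circ> r) h - (X1' \<circ> r) h * (A' \<circ> r) g) ((X2' \<circ> r) g * (A' \<circ> r) h - (X2' \<circ> r) h * (A' \<circ> r) g)"
    proof (intro ballI B_eqI)
      fix g h assume gh: "g \<in> carrier G" "h \<in> carrier G"
      show "commutator G g h \<in> commutator_subgroup G" using gh by (rule G.commutator_in_derived)
      show "\<psi> (commutator G g h) =
        B' ((X1' \<circ> r) g * (A' \<circ> r) h - (X1' \<circ> r) h * (A' \<circ> r) g) ((X2' \<circ> r) g * (A' \<circ> r) h - (X2' \<circ> r) h * (A' \<circ> r) g)"
        using comm[of g h "r g" "r h"] gh r commH by simp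
    qed
    show "\<forall>i j i' j'. B i j \<otimes>\<^bsub>G\<^esub> B i' j' = B (i + i') (j + j')"
      by (intro allI B_eqI DG.m_closed B) (simp add: \<psi>_mult B multH)
    show "\<forall>i j i' j'. (B i j = B i' j') = (i mod int p = i' mod int p \<and> j mod int p = j' mod int p)"
      unfolding B_iff eqH by simp
    show "commutator_subgroup G = range (\<lambda>(i, j). B i j)"
    proof
      show "commutator_subgroup G \<subseteq> range (\<lambda>(i, j). B i j)"
      proof
        fix x assume x: "x \<in> commutator_subgroup G"
        then have "\<psi> x \<in> commutator_subgroup H" using \<psi>_bij by (auto simp: bij_betw_def)
        then obtain i j where "\<psi> x = B' i j" using derH by auto
        then have "x = (\<lambda>(i, j). B i j) (i, j)" using B_eqI[OF x] by simp
        then show "x \<in> range (\<lambda>(i, j). B i j)" by blast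
      qed
    qed (use B in auto)
  qed
  then show ?thesis by blast
qed

text \<open>Lagrange's theorem for a map whose fibres are the right cosets of \<open>W\<close>; it
  makes orders computable from coordinates.\<close>

lemma (in group) card_fibres_subgroup:
  assumes W: "subgroup W G" and fin: "finite (carrier G)"
    and f: "\<And>x y. x \<in> carrier G \<Longrightarrow> y \<in> carrier G \<Longrightarrow> f x = f y \<longleftrightarrow> x \<otimes> inv y \<in> W"
  shows "card (f ` carrier G) * card W = Coset.order G"
proof -
  interpret W: subgroup W G by fact
  have eq: "W #> x = W #> y \<longleftrightarrow> f x = f y" if "x \<in> carrier G" "y \<in> carrier G" for x y
  proof -
    have "W #> x = W #> y \<longleftrightarrow> x \<in> W #> y"
      using that W by (metis rcos_self repr_independence)
    also have "\<dots> \<longleftrightarrow> x \<otimes> inv y \<in> W" using that W.rcos_module[OF group_axioms, of y x] by simp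
    finally show ?thesis using f[OF that] by simp
  qed
  have "bij_betw (\<lambda>C. f (SOME x. x \<in> C)) (rcosets W) (f ` carrier G)"
  proof -
    have some: "f (SOME x. x \<in> W #> y) = f y" if "y \<in> carrier G" for y
    proof -
      have "(SOME x. x \<in> W #> y) \<in> W #> y" using rcos_self[OF that W] by (rule someI)
      moreover then have "(SOME x. x \<in> W #> y) \<in> carrier G" using that by (metis W.subset r_coset_subset_G subsetD)
      ultimately show ?thesis using eq that W by (metis repr_independence)
    qed
    show ?thesis
      by (rule bij_betw_imageI) (auto simp: inj_on_def RCOSETS_def some eq image_iff)
  qed
  then have "card (rcosets W) = card (f ` carrier G)" by (rule bij_betw_same_card)
  then show ?thesis using lagrange[OF W] by simp
qed

lemma prime_inverse_mod:
  assumes "Factorial_Ring.prime (P :: int)" "\<not> P dvd k"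
  obtains x where "P dvd k * x - 1"
proof -
  have "gcd k P = 1" using assms by (metis coprime_iff_gcd_eq_1 coprime_commute prime_imp_coprime)
  then have "fst (bezout_coefficients k P) * k + snd (bezout_coefficients k P) * P = 1"
    by (simp add: bezout_coefficients_fst_snd)
  then have "k * fst (bezout_coefficients k P) - 1 = - snd (bezout_coefficients k P) * P"
    by (simp add: algebra_simps)
  then show ?thesis using that by (metis dvd_triv_right)
qed

text \<open>The coordinates identify \<open>G/Z\<close> with the 3-dimensional space over the field
  with \<open>p\<close> elements and \<open>G'\<close> with the plane. If \<open>K\<close> is the
  line spanned by \<open>(k1, k2)\<close>, the last claim holds because two independent linear
  forms, \<open>A\<close> and \<open>X1 * k2 - X2 * k1\<close>, cut out the subgroup in
  question.\<close>

lemma phi4_structure: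
  fixes G (structure)
  assumes p: "Factorial_Ring.prime p" and G: "group G" and order: "Coset.order G = p ^ 5" and phi4: "in_phi4 p G"
  shows "commutator_subgroup G = centre G" "card (centre G) = p ^ 2"
    "\<And>z. z \<in> centre G \<Longrightarrow> z [^] p = \<one>"
    "\<And>x. x \<in> carrier G \<Longrightarrow> x [^] p \<in> centre G"
    "\<And>K. subgroup K G \<Longrightarrow> K \<subseteq> centre G \<Longrightarrow> card K = p \<Longrightarrow>
      card {g \<in> carrier G. \<forall>h\<in>carrier G. commutator G g h \<in> K} = p ^ 3"
proof -
  interpret group G by fact
  have p0: "0 < p" using p by (rule prime_gt_0_nat)
  have fin: "finite (carrier G)" using order p0 by (metis order_gt_0_iff_finite zero_less_power)
  obtain A' X1' X2' B' where "phi4_coordinates p (phi4_group p) A' X1' X2' B'"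
    using phi4_group_coordinates[OF p refl] by blast
  then obtain A X1 X2 B where c0: "phi4_coordinates p G A X1 X2 B"
    using isoclinic_phi4_coordinates[OF G _ phi4[unfolded in_phi4_def]] group_presented_group
    unfolding phi4_group_def by blast
  note c = c0[unfolded phi4_coordinates_def]
  define P where "P = int p"
  have P0: "0 < P" using p0 by (simp add: P_def)
  have hom: "F (g \<otimes> h) mod P = (F g + F h) mod P"
    if "F \<in> {A, X1, X2}" "g \<in> carrier G" "h \<in> carrier G" for F g h using c that unfolding P_def by blast
  have surj: "\<exists>g\<in>carrier G. A g mod P = i mod P \<and> X1 g mod P = j mod P \<and> X2 g mod P = k mod P" for i j k
    using c unfolding P_def by blast
  have z: "g \<in> centre G \<longleftrightarrow> (\<forall>F\<in>{A, X1, X2}. F g mod P = 0)" if "g \<in> carrier G" for g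
    using c that unfolding P_def by blast
  have comm: "commutator G g h = B (X1 g * A h - X1 h * A g) (X2 g * A h - X2 h * A g)"
    if "g \<in> carrier G" "h \<in> carrier G" for g h using c that by blast
  have mult: "B i j \<otimes> B i' j' = B (i + i') (j + j')" for i j i' j' using c by blast
  have eq: "B i j = B i' j' \<longleftrightarrow> i mod P = i' mod P \<and> j mod P = j' mod P" for i j i' j' using c unfolding P_def by blast
  have der: "commutator_subgroup G = range (\<lambda>(i, j). B i j)" using c by blast
  have sub: "subgroup (commutator_subgroup G) G" by (rule derived_is_subgroup) simp
  then have B_G [simp]: "B i j \<in> carrier G" for i j using der subgroup.subset by blast
  have B_0: "B 0 0 = \<one>" using mult[of 0 0 0 0] by simp
  have B_pow: "B i j [^] n = B (int n * i) (int n * j)" for i j and n :: nat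
    by (induction n) (simp_all add: B_0 mult algebra_simps)
  have hom_inv: "F (g \<otimes> inv h) mod P = (F g - F h) mod P"
    if F: "F \<in> {A, X1, X2}" and gh: "g \<in> carrier G" "h \<in> carrier G" for F g h
  proof -
    have "F (g \<otimes> inv h \<otimes> h) mod P = (F (g \<otimes> inv h) + F h) mod P" using gh by (intro hom F) auto
    moreover have "g \<otimes> inv h \<otimes> h = g" using gh by (simp add: m_assoc)
    ultimately have "F g mod P = (F (g \<otimes> inv h) + F h) mod P" by simp
    then have "(F g - F h) mod P = (F (g \<otimes> inv h) + F h - F h) mod P" by (rule mod_diff_cong) simp
    then show ?thesis by simp
  qed
  have zero_iff: "F g mod P = F h mod P \<longleftrightarrow> F (g \<otimes> inv h) mod P = 0"
    if F: "F \<in> {A, X1, X2}" and gh: "g \<in> carrier G" "h \<in> carrier G" for F g h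
    unfolding hom_inv[OF that] by (simp add: mod_eq_dvd_iff mod_eq_0_iff_dvd)
  have card_Z: "p ^ 3 * card (centre G) = p ^ 5"
  proof -
    define f where "f g = (A g mod P, X1 g mod P, X2 g mod P)" for g
    have "card (f ` carrier G) * card (centre G) = Coset.order G"
      using zero_iff by (intro card_fibres_subgroup subgroup_centre fin) (simp add: f_def z)
    moreover have "f ` carrier G = {0..<P} \<times> {0..<P} \<times> {0..<P}"
    proof
      show "{0..<P} \<times> {0..<P} \<times> {0..<P} \<subseteq> f ` carrier G"
      proof clarify
        fix i j k assume "i \<in> {0..<P}" "j \<in> {0..<P}" "k \<in> {0..<P}"
        moreover obtain g where "g \<in> carrier G" "A g mod P = i mod P" "X1 g mod P = j mod P" "X2 g mod P = k mod P"
          using surj by blast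
        ultimately show "(i, j, k) \<in> f ` carrier G" by (intro image_eqI[of _ _ g]) (auto simp: f_def)
      qed
    qed (use P0 in \<open>auto simp: f_def\<close>)
    ultimately show ?thesis using order by (simp add: P_def power3_eq_cube mult.assoc)
  qed
  show cardZ: "card (centre G) = p ^ 2"
  proof -
    have "p ^ 3 * card (centre G) = p ^ 3 * p ^ 2" unfolding card_Z by (simp flip: power_add)
    then show ?thesis using p0 by (subst (asm) mult_cancel1) auto
  qed
  have sub_Z: "commutator_subgroup G \<subseteq> centre G"
  proof (rule derived_subset[OF subgroup_centre])
    fix g h assume gh: "g \<in> carrier G" "h \<in> carrier G"
    have "F (commutator G g h) mod P = 0" if F: "F \<in> {A, X1, X2}" for F
    proof -
      have "F (g \<otimes> h) mod P = F (h \<otimes> g) mod P" using gh by (simp add: hom[OF F] add.commute)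
      also have "g \<otimes> h = h \<otimes> g \<otimes> commutator G g h" using gh by (rule mult_commutator)
      also have "F \<dots> mod P = (F (h \<otimes> g) + F (commutator G g h)) mod P" using gh by (intro hom F) auto
      finally show ?thesis by (simp add: mod_eq_dvd_iff mod_eq_0_iff_dvd)
    qed
    then show "commutator G g h \<in> centre G" using gh z by simp
  qed
  have "inj_on (\<lambda>(i, j). B i j) ({0..<P} \<times> {0..<P})" by (auto simp: inj_on_def eq)
  moreover have "(\<lambda>(i, j). B i j) ` ({0..<P} \<times> {0..<P}) = commutator_subgroup G"
  proof -
    have "B i j \<in> (\<lambda>(i, j). B i j) ` ({0..<P} \<times> {0..<P})" for i j
      using P0 by (intro image_eqI[of _ _ "(i mod P, j mod P)"]) (simp_all add: eq)
    then show ?thesis unfolding der by auto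
  qed
  ultimately have "card (commutator_subgroup G) = card ({0..<P} \<times> {0..<P})" using card_image by metis
  then have "card (commutator_subgroup G) = p ^ 2" by (simp add: P_def power2_eq_square)
  then show DZ: "commutator_subgroup G = centre G"
    using sub_Z cardZ finite_subset[OF subgroup.subset[OF subgroup_centre] fin] by (intro card_subset_eq) simp_all
  show pow_Z: "x [^] p = \<one>" if "x \<in> centre G" for x
  proof -
    have "x \<in> range (\<lambda>(i, j). B i j)" using that DZ der by simp
    then obtain i j where "x = B i j" by auto
    then have "x [^] p = B (P * i) (P * j)" by (simp add: B_pow P_def)
    also have "\<dots> = B 0 0" unfolding eq by simp
    finally show ?thesis by (simp add: B_0)
  qed
  show "x [^] p \<in> centre G" if x: "x \<in> carrier G" for x
  proof -
    have "F (x [^] p) mod P = 0" if F: "F \<in> {A, X1, X2}" for F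
    proof -
      have "F \<one> mod P = 0" using hom[OF F one_closed one_closed] by (simp add: mod_eq_dvd_iff mod_eq_0_iff_dvd)
      then have "F (x [^] n) mod P = (int n * F x) mod P" for n :: nat
      proof (induction n)
        case (Suc n)
        have "F (x [^] Suc n) mod P = (F (x [^] n) + F x) mod P" using hom[OF F, of "x [^] n" x] x by simp
        also have "\<dots> = (int n * F x + F x) mod P" using Suc by (intro mod_add_cong) auto
        finally show ?case by (simp add: algebra_simps)
      qed simp
      from this[of p] show ?thesis by (simp add: P_def)
    qed
    then show ?thesis using z x by simp
  qed
  show "card {g \<in> carrier G. \<forall>h\<in>carrier G. commutator G g h \<in> K} = p ^ 3"
    if K: "subgroup K G" and KZ: "K \<subseteq> centre G" and cardK: "card K = p" for K
  proof -
    interpret K: subgroup K G by fact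
    have prime_P: "Factorial_Ring.prime P" using p by (simp add: P_def)
    have "\<not> K \<subseteq> {\<one>}"
    proof
      assume "K \<subseteq> {\<one>}"
      then have "card K \<le> 1" using card_mono[of "{\<one>}" K] by simp
      then show False using cardK prime_gt_1_nat[OF p] by simp
    qed
    then obtain k where k: "k \<in> K" "k \<noteq> \<one>" by blast
    then have "k \<in> range (\<lambda>(i, j). B i j)" using KZ DZ der by auto
    then obtain k1 k2 where k12: "k = B k1 k2" by auto
    have ndvd: "\<not> (P dvd k1 \<and> P dvd k2)" using k unfolding k12 B_0[symmetric] eq by (simp add: mod_eq_0_iff_dvd)
    have pow_K: "B (int n * k1) (int n * k2) \<in> K" for n
    proof -
      have "k [^] n \<in> K" using k by (induction n) auto
      then show ?thesis by (simp add: k12 B_pow)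
    qed
    \<comment> \<open>Membership in the line through \<open>(k1, k2)\<close> is the vanishing of a
      determinant. Counting shows that the powers of \<open>k\<close> exhaust \<open>K\<close>;
      conversely, the required multiplier is found by inverting whichever of \<open>k1\<close>,
      \<open>k2\<close> is prime to \<open>P\<close>.\<close>
    have K_mem: "B i j \<in> K \<longleftrightarrow> P dvd i * k2 - j * k1" for i j
    proof
      have "inj_on (\<lambda>n. B (int n * k1) (int n * k2)) {..<p}"
      proof (rule inj_onI)
        fix m n assume mn: "m \<in> {..<p}" "n \<in> {..<p}" and "B (int m * k1) (int m * k2) = B (int n * k1) (int n * k2)"
        then have "P dvd (int m - int n) * k1" "P dvd (int m - int n) * k2"
          unfolding eq by (simp_all add: mod_eq_dvd_iff left_diff_distrib)
        then have "P dvd int m - int n" using ndvd prime_P by (auto simp: prime_dvd_mult_iff)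
        then have "int m mod P = int n mod P" by (simp add: mod_eq_dvd_iff)
        then show "m = n" using mn by (simp add: P_def)
      qed
      then have "card ((\<lambda>n. B (int n * k1) (int n * k2)) ` {..<p}) = p" by (simp add: card_image)
      moreover have "(\<lambda>n. B (int n * k1) (int n * k2)) ` {..<p} \<subseteq> K" using pow_K by auto
      ultimately have K_eq: "(\<lambda>n. B (int n * k1) (int n * k2)) ` {..<p} = K"
        using cardK p0 by (intro card_subset_eq) (auto intro: card_ge_0_finite)
      assume "B i j \<in> K"
      then obtain n where "B i j = B (int n * k1) (int n * k2)" using K_eq by blast
      then have "(i * k2 - j * k1) mod P = (int n * k1 * k2 - int n * k2 * k1) mod P"
        unfolding eq by (intro mod_diff_cong mod_mult_cong) auto
      then show "P dvd i * k2 - j * k1" by (simp add: mod_eq_0_iff_dvd mult.commute mult.left_commute)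
    next
      assume dvd: "P dvd i * k2 - j * k1"
      have ex: "\<exists>n::nat. P dvd int n * l - m" if "\<not> P dvd l" for l m
      proof -
        obtain x where x: "P dvd l * x - 1" using prime_inverse_mod[OF prime_P \<open>\<not> P dvd l\<close>] .
        define n where "n = nat ((x * m) mod P)"
        have "int n mod P = (x * m) mod P" using P0 by (simp add: n_def)
        then have "P dvd int n - x * m" by (simp add: mod_eq_dvd_iff)
        then have "P dvd (int n - x * m) * l + (l * x - 1) * m" using x by simp
        then show ?thesis by (intro exI[of _ n]) (simp add: algebra_simps)
      qed
      have "\<exists>n::nat. P dvd int n * k1 - i \<and> P dvd int n * k2 - j"
      proof (cases "P dvd k1")
        case False
        then obtain n :: nat where n: "P dvd int n * k1 - i" using ex by blast
        have "(int n * k2 - j) * k1 = (int n * k1 - i) * k2 + (i * k2 - j * k1)" by (simp add: algebra_simps)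
        then have "P dvd (int n * k2 - j) * k1" using n dvd by simp
        then show ?thesis using n False prime_P by (auto simp: prime_dvd_mult_iff)
      next
        case True
        then have "\<not> P dvd k2" using ndvd by simp
        then obtain n :: nat where n: "P dvd int n * k2 - j" using ex by blast
        have "(int n * k1 - i) * k2 = (int n * k2 - j) * k1 - (i * k2 - j * k1)" by (simp add: algebra_simps)
        then have "P dvd (int n * k1 - i) * k2" using n dvd by simp
        then show ?thesis using n \<open>\<not> P dvd k2\<close> prime_P by (auto simp: prime_dvd_mult_iff)
      qed
      then obtain n :: nat where "B i j = B (int n * k1) (int n * k2)"
        unfolding eq by (auto simp: mod_eq_dvd_iff dvd_diff_commute)
      then show "B i j \<in> K" using pow_K by simp
    qed
    define W where "W = {g \<in> carrier G. \<forall>h\<in>carrier G. commutator G g h \<in> K}"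
    have W_iff: "g \<in> W \<longleftrightarrow> A g mod P = 0 \<and> P dvd X1 g * k2 - X2 g * k1" if g: "g \<in> carrier G" for g
    proof -
      have cK: "commutator G g h \<in> K \<longleftrightarrow> P dvd (X1 g * k2 - X2 g * k1) * A h - A g * (X1 h * k2 - X2 h * k1)"
        if "h \<in> carrier G" for h
        using g that by (simp add: comm K_mem algebra_simps)
      \<comment> \<open>The coordinates of \<open>h\<close> may take any values; unit vectors for
        \<open>(i, j, k)\<close> then isolate the conditions on \<open>g\<close>.\<close>
      have lin: "P dvd (X1 g * k2 - X2 g * k1) * i - A g * (j * k2 - k * k1)" if "g \<in> W" for i j k
      proof -
        obtain h where h: "h \<in> carrier G" "A h mod P = i mod P" "X1 h mod P = j mod P" "X2 h mod P = k mod P"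
          using surj by blast
        have "((X1 g * k2 - X2 g * k1) * A h - A g * (X1 h * k2 - X2 h * k1)) mod P
          = ((X1 g * k2 - X2 g * k1) * i - A g * (j * k2 - k * k1)) mod P"
          using h by (intro mod_diff_cong mod_mult_cong) auto
        then show ?thesis using that cK[OF h(1)] h(1) by (simp add: W_def mod_eq_0_iff_dvd[symmetric])
      qed
      show ?thesis
      proof
        assume W: "g \<in> W"
        have "P dvd A g * k2" "P dvd A g * k1" using lin[OF W, of 0 1 0] lin[OF W, of 0 0 1] by simp_all
        then have "P dvd A g" using ndvd prime_P by (auto simp: prime_dvd_mult_iff)
        then show "A g mod P = 0 \<and> P dvd X1 g * k2 - X2 g * k1" using lin[OF W, of 1 0 0] by (simp add: mod_eq_0_iff_dvd)
      next
        assume "A g mod P = 0 \<and> P dvd X1 g * k2 - X2 g * k1"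
        then have "\<forall>h\<in>carrier G. commutator G g h \<in> K" by (auto simp: cK mod_eq_0_iff_dvd)
        then show "g \<in> W" using g by (simp add: W_def)
      qed
    qed
    define \<Theta> where "\<Theta> g = X1 g * k2 - X2 g * k1" for g
    have \<Theta>: "\<Theta> g mod P = \<Theta> h mod P \<longleftrightarrow> P dvd \<Theta> (g \<otimes> inv h)" if gh: "g \<in> carrier G" "h \<in> carrier G" for g h
    proof -
      have "\<Theta> (g \<otimes> inv h) mod P = ((X1 g - X1 h) * k2 - (X2 g - X2 h) * k1) mod P"
        unfolding \<Theta>_def using gh hom_inv by (intro mod_diff_cong mod_mult_cong) auto
      also have "(X1 g - X1 h) * k2 - (X2 g - X2 h) * k1 = \<Theta> g - \<Theta> h" by (simp add: \<Theta>_def algebra_simps)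
      finally show ?thesis by (metis mod_eq_dvd_iff mod_eq_0_iff_dvd)
    qed
    define f where "f g = (A g mod P, \<Theta> g mod P)" for g
    have f_iff: "f g = f h \<longleftrightarrow> g \<otimes> inv h \<in> W" if "g \<in> carrier G" "h \<in> carrier G" for g h
      using \<Theta>[OF that] zero_iff[of A, OF _ that] that W_iff[of "g \<otimes> inv h"] by (simp add: f_def) (simp add: \<Theta>_def)
    have "subgroup W G"
    proof (rule subgroupI)
      have "f \<one> = f \<one>" by simp
      then have "\<one> \<in> W" using f_iff[of \<one> \<one>] by simp
      then show "W \<noteq> {}" by blast
      have *: "inv b \<in> W" if b: "b \<in> W" for b
      proof -
        have bG: "b \<in> carrier G" using b by (simp add: W_def)
        have "f b = f \<one>" using b bG by (subst f_iff) auto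
        then have "f \<one> = f b" by simp
        then show ?thesis using bG by (subst (asm) f_iff) auto
      qed
      show "inv b \<in> W" if "b \<in> W" for b using * that .
      fix a b assume ab: "a \<in> W" "b \<in> W"
      have G: "a \<in> carrier G" "b \<in> carrier G" using ab by (auto simp: W_def)
      have "f a = f \<one>" using ab G by (subst f_iff) auto
      also have "\<dots> = f (inv b)" using ab G by (subst f_iff) auto
      finally show "a \<otimes> b \<in> W" using G by (subst (asm) f_iff) auto
    qed (simp add: W_def)
    then have "card (f ` carrier G) * card W = p ^ 5"
      using f_iff fin order by (simp add: card_fibres_subgroup)
    moreover have "f ` carrier G = {0..<P} \<times> {0..<P}"
    proof
      show "{0..<P} \<times> {0..<P} \<subseteq> f ` carrier G"
      proof clarify
        fix i j assume ij: "i \<in> {0..<P}" "j \<in> {0..<P}"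
        have "\<exists>x y. P dvd x * k2 - y * k1 - j"
        proof (cases "P dvd k2")
          case False
          then obtain x where "P dvd k2 * x - 1" using prime_inverse_mod[OF prime_P] by blast
          then have "P dvd (k2 * x - 1) * j" by simp
          then have "P dvd (x * j) * k2 - 0 * k1 - j" by (simp add: algebra_simps)
          then show ?thesis by blast
        next
          case True
          then obtain x where "P dvd k1 * x - 1" using prime_inverse_mod[OF prime_P] ndvd by blast
          then have "P dvd (k1 * x - 1) * j" by simp
          then have "P dvd 0 * k2 - (- x * j) * k1 - j" by (simp add: algebra_simps)
          then show ?thesis by blast
        qed
        then obtain x y where "P dvd x * k2 - y * k1 - j" by blast
        then have xy: "(x * k2 - y * k1) mod P = j mod P" by (simp add: mod_eq_dvd_iff)
        obtain g where g: "g \<in> carrier G" "A g mod P = i mod P" "X1 g mod P = x mod P" "X2 g mod P = y mod P"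
          using surj by blast
        have "\<Theta> g mod P = (x * k2 - y * k1) mod P"
          unfolding \<Theta>_def using g by (intro mod_diff_cong mod_mult_cong) auto
        then show "(i, j) \<in> f ` carrier G" using ij g xy by (intro image_eqI[of _ _ g]) (auto simp: f_def)
      qed
    qed (use P0 in \<open>auto simp: f_def\<close>)
    moreover have "p ^ 5 = p ^ 2 * p ^ 3" by (simp flip: power_add)
    ultimately have "p ^ 2 * card W = p ^ 2 * p ^ 3"
      by (simp add: P_def power2_eq_square)
    then show ?thesis using p0 unfolding W_def by (subst (asm) mult_cancel1) auto
  qed
qed

section \<open>Groups of order \<open>p\<close> and \<open>p\<^sup>2\<close>\<close>

lemma (in group) cyclic_subgroup_iff:
  assumes H: "subgroup H G"
  shows "cyclic_group (G\<lparr>carrier := H\<rparr>) \<longleftrightarrow> (\<exists>x\<in>H. H = range (\<lambda>n::int. x [^] n))"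
proof -
  interpret K: group "G\<lparr>carrier := H\<rparr>" using H by (rule subgroup_imp_group)
  have "(\<lambda>n::int. x [^]\<^bsub>G\<lparr>carrier := H\<rparr>\<^esub> n) = (\<lambda>n::int. x [^] n)" if "x \<in> H" for x
    using int_pow_consistent[OF H that] by auto
  then show ?thesis by (auto simp: K.cyclic_group)
qed

lemma (in group) prime_ord:
  assumes "Factorial_Ring.prime p" "x \<in> carrier G" "x \<noteq> \<one>" "x [^] p = \<one>"
  shows "ord x = p"
proof -
  have "ord x dvd p" using assms pow_eq_id by blast
  moreover have "ord x \<noteq> 1" using assms ord_eq_1 by blast
  ultimately show ?thesis using assms(1) by (auto simp: prime_nat_iff)
qed

lemma (in group) pow_inj_on_ord:
  assumes x: "x \<in> carrier G" and n: "n \<le> ord x"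
  shows "inj_on (\<lambda>i::nat. x [^] i) {..<n}"
proof (rule linorder_inj_onI')
  fix i j assume ij: "i \<in> {..<n}" "j \<in> {..<n}" "i < j"
  show "x [^] i \<noteq> x [^] j"
  proof
    assume "x [^] i = x [^] j"
    then have "x [^] (j - i) = \<one>" using x ij by (metis less_imp_le_nat pow_eq_div2)
    then have "ord x dvd j - i" using x pow_eq_id by blast
    then show False using ij n by (auto dest: dvd_imp_le)
  qed
qed

lemma (in group) subgroup_pow_card:
  assumes H: "subgroup H G" and x: "x \<in> H"
  shows "x [^] card H = \<one>"
proof -
  interpret K: group "G\<lparr>carrier := H\<rparr>" using H by (rule subgroup_imp_group)
  have "x [^]\<^bsub>G\<lparr>carrier := H\<rparr>\<^esub> card H = \<one>" using K.pow_order_eq_1[of x] x by (simp add: Coset.order_def)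
  then show ?thesis using nat_pow_consistent by metis
qed

lemma (in group) prime_subgroup_powers:
  assumes p: "Factorial_Ring.prime p" and H: "subgroup H G" "card H = p" and x: "x \<in> H" "x \<noteq> \<one>"
  shows "H = (\<lambda>i::nat. x [^] i) ` {..<p}" "x [^] p = \<one>"
proof -
  interpret H: subgroup H G by fact
  show xp: "x [^] p = \<one>" using subgroup_pow_card[OF H(1) x(1)] H(2) by simp
  have "ord x = p" using prime_ord[OF p _ x(2) xp] x(1) by simp
  then have "card ((\<lambda>i::nat. x [^] i) ` {..<p}) = p"
    using pow_inj_on_ord[of x p] x by (simp add: card_image)
  moreover have "x [^] i \<in> H" for i :: nat using x by (induction i) auto
  moreover have "finite H" using H(2) prime_gt_0_nat[OF p] by (auto intro: card_ge_0_finite)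
  ultimately show "H = (\<lambda>i::nat. x [^] i) ` {..<p}"
    using H(2) by (intro card_subset_eq[symmetric]) auto
qed

lemma (in group) prime_subgroup_nontrivial:
  assumes "Factorial_Ring.prime p" "subgroup H G" "card H = p"
  obtains x where "x \<in> H" "x \<noteq> \<one>"
proof -
  have "\<not> H \<subseteq> {\<one>}"
    using assms card_mono[of "{\<one>}" H] prime_gt_1_nat[of p] by auto
  then show ?thesis using that by blast
qed

lemma (in group) prime_subgroup_cyclic:
  assumes p: "Factorial_Ring.prime p" and H: "subgroup H G" "card H = p"
  shows "cyclic_group (G\<lparr>carrier := H\<rparr>)"
proof -
  obtain x where x: "x \<in> H" "x \<noteq> \<one>" using prime_subgroup_nontrivial[OF p H] .
  have "H \<subseteq> range (\<lambda>n::int. x [^] n)"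
    using prime_subgroup_powers(1)[OF p H x] by (auto simp: image_iff int_pow_int[symmetric])
  moreover have "x [^] n \<in> H" for n :: int using H x by (intro subgroup_int_pow_closed)
  ultimately show ?thesis using x H by (auto simp: cyclic_subgroup_iff)
qed

lemma (in group) num_cyclic_subgroups_prime:
  assumes p: "Factorial_Ring.prime p"
  shows "num_cyclic_subgroups G p = card {H. subgroup H G \<and> card H = p}"
  unfolding num_cyclic_subgroups_def using prime_subgroup_cyclic[OF p] by (intro arg_cong[of _ _ card]) auto

lemma (in group) prime_subgroup_iso:
  assumes p: "Factorial_Ring.prime p" and H: "subgroup H G" "card H = p"
  shows "G\<lparr>carrier := H\<rparr> \<cong> integer_mod_group p"
proof -
  interpret H: subgroup H G by fact
  interpret K: group "G\<lparr>carrier := H\<rparr>" using H(1) by (rule subgroup_imp_group)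
  obtain x where x: "x \<in> H" "x \<noteq> \<one>" using prime_subgroup_nontrivial[OF p H] .
  note pw = prime_subgroup_powers[OF p H x]
  have p0: "0 < p" using p by (rule prime_gt_0_nat)
  have ordx: "ord x = p" using prime_ord[OF p _ x(2) pw(2)] x by simp
  have "(\<lambda>i::int. x [^] i) \<in> iso (integer_mod_group p) (G\<lparr>carrier := H\<rparr>)"
  proof (rule isoI)
    have "x [^] ((i + j) mod int p) = x [^] i \<otimes> x [^] j" for i j :: int
    proof -
      have "x [^] ((i + j) mod int p) = x [^] (i + j)"
        using x by (simp add: int_pow_eq ordx mod_eq_dvd_iff[symmetric])
      then show ?thesis using x by (simp add: int_pow_mult)
    qed
    then show "(\<lambda>i::int. x [^] i) \<in> hom (integer_mod_group p) (G\<lparr>carrier := H\<rparr>)"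
      using H(1) x by (auto simp: hom_def intro: subgroup_int_pow_closed)
    have "(\<lambda>i::int. x [^] i) ` {0..<int p} = H"
    proof -
      have "(\<lambda>i::int. x [^] i) ` {0..<int p} = (\<lambda>i::int. x [^] i) ` int ` {..<p}"
        by (metis image_int_atLeastLessThan lessThan_atLeast0 of_nat_0)
      then show ?thesis using pw(1) by (simp add: image_image int_pow_int)
    qed
    moreover have "inj_on (\<lambda>i::int. x [^] i) {0..<int p}"
      using calculation H(2) p0 by (intro eq_card_imp_inj_on) auto
    ultimately show "bij_betw (\<lambda>i::int. x [^] i) (carrier (integer_mod_group p)) (carrier (G\<lparr>carrier := H\<rparr>))"
      using p0 by (simp add: bij_betw_def carrier_integer_mod_group)
  qed
  then have "integer_mod_group p \<cong> G\<lparr>carrier := H\<rparr>" by (auto simp: is_iso_def)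
  then show ?thesis by (rule group.iso_sym[OF group_integer_mod_group])
qed

lemma iso_integer_mod_group_card:
  assumes "0 < p" "G\<lparr>carrier := H\<rparr> \<cong> integer_mod_group p"
  shows "card H = p"
  using iso_same_card[OF assms(2)] assms(1) by (simp add: carrier_integer_mod_group)

section \<open>Exponents and numbers of cyclic subgroups in groups of order \<open>p\<close> and
  \<open>p\<^sup>2\<close>\<close>

lemma (in group) num_cyclic_subgroups_1: "num_cyclic_subgroups G 1 = 1"
proof -
  have "{H. subgroup H G \<and> cyclic_group (G\<lparr>carrier := H\<rparr>) \<and> card H = 1} = {{\<one>}}"
  proof (intro equalityI subsetI)
    fix H assume "H \<in> {H. subgroup H G \<and> cyclic_group (G\<lparr>carrier := H\<rparr>) \<and> card H = 1}"
    then show "H \<in> {{\<one>}}" using subgroup.one_closed by (fastforce simp: card_1_singleton_iff)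
  next
    fix H assume "H \<in> {{\<one>}}"
    moreover have "cyclic_group (G\<lparr>carrier := {\<one>}\<rparr>)"
      using triv_subgroup by (auto simp: cyclic_subgroup_iff)
    ultimately show "H \<in> {H. subgroup H G \<and> cyclic_group (G\<lparr>carrier := H\<rparr>) \<and> card H = 1}"
      using triv_subgroup by simp
  qed
  then show ?thesis by (simp add: num_cyclic_subgroups_def)
qed

lemma (in group) num_cyclic_subgroups_order:
  assumes fin: "finite (carrier G)" and x: "x \<in> carrier G" "ord x = Coset.order G"
  shows "num_cyclic_subgroups G (Coset.order G) = 1"
proof -
  have "{H. subgroup H G \<and> cyclic_group (G\<lparr>carrier := H\<rparr>) \<and> card H = Coset.order G} = {carrier G}"
  proof (intro equalityI subsetI)
    fix H assume "H \<in> {H. subgroup H G \<and> cyclic_group (G\<lparr>carrier := H\<rparr>) \<and> card H = Coset.order G}"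
    then show "H \<in> {carrier G}"
      using fin card_subset_eq[of "carrier G" H] by (auto simp: Coset.order_def dest: subgroup.subset)
  next
    fix H assume "H \<in> {carrier G}"
    have carr: "carrier G = (\<lambda>i::nat. x [^] i) ` {..<Coset.order G}"
      using pow_inj_on_ord[OF x(1)] x fin
      by (intro card_subset_eq[symmetric]) (auto simp: card_image Coset.order_def)
    have "carrier G \<subseteq> range (\<lambda>n::int. x [^] n)"
    proof (intro subsetI)
      fix y assume "y \<in> carrier G"
      then obtain i :: nat where "y = x [^] i" using carr by blast
      then have "y = x [^] int i" by (simp add: int_pow_int)
      then show "y \<in> range (\<lambda>n::int. x [^] n)" by blast
    qed
    then have "carrier G = range (\<lambda>n::int. x [^] n)" using x by auto
    then have "cyclic_group G" unfolding cyclic_group using x(1) by blast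
    then show "H \<in> {H. subgroup H G \<and> cyclic_group (G\<lparr>carrier := H\<rparr>) \<and> card H = Coset.order G}"
      using subgroup_self \<open>H \<in> {carrier G}\<close> by (simp add: Coset.order_def)
  qed
  then show ?thesis by (simp add: num_cyclic_subgroups_def)
qed

lemma (in group) group_exponent_eqI:
  assumes "0 < n" "\<And>x. x \<in> carrier G \<Longrightarrow> x [^] n = \<one>" "x \<in> carrier G" "ord x = n"
  shows "group_exponent G = n"
  unfolding group_exponent_def
proof (rule Least_equality)
  fix m :: nat assume "0 < m \<and> (\<forall>x\<in>carrier G. x [^] m = \<one>)"
  then show "n \<le> m" using assms pow_eq_id by (metis dvd_imp_le)
qed (use assms in auto)

lemma (in group) prime_order_invariants:
  assumes p: "Factorial_Ring.prime p" and ord: "Coset.order G = p"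
  shows "group_exponent G = p" "num_cyclic_subgroups G p = 1"
proof -
  have fin: "finite (carrier G)" using ord prime_gt_0_nat[OF p] order_gt_0_iff_finite by simp
  obtain x where x: "x \<in> carrier G" "x \<noteq> \<one>"
    using prime_subgroup_nontrivial[OF p subgroup_self] ord by (auto simp: Coset.order_def)
  have pow: "y [^] p = \<one>" if "y \<in> carrier G" for y using pow_order_eq_1[OF that] ord by simp
  have "ord x = p" using prime_ord[OF p x] pow x by simp
  then show "group_exponent G = p" using x pow prime_gt_0_nat[OF p] by (intro group_exponent_eqI) auto
  show "num_cyclic_subgroups G p = 1"
    using num_cyclic_subgroups_order[OF fin x(1)] \<open>ord x = p\<close> ord by simp
qed

text \<open>For subgroups of order \<open>p\<close> an upper bound suffices: it makes the difference
  with the single such subgroup of \<open>Z(G/K)/(G/K)'\<close> vanish.\<close>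

lemma (in group) cyclic_prime_square_invariants:
  assumes p: "Factorial_Ring.prime p" and order: "Coset.order G = p ^ 2" and x: "x \<in> carrier G" "ord x = p ^ 2"
  shows "group_exponent G = p ^ 2" "num_cyclic_subgroups G (p ^ 2) = 1" "num_cyclic_subgroups G p \<le> 1"
proof -
  have p0: "0 < p" using p by (rule prime_gt_0_nat)
  have fin: "finite (carrier G)" using order p0 order_gt_0_iff_finite by simp
  show "group_exponent G = p ^ 2"
    using pow_order_eq_1 order x p0 by (intro group_exponent_eqI) auto
  show "num_cyclic_subgroups G (p ^ 2) = 1" using num_cyclic_subgroups_order[OF fin x(1)] x order by simp
  have carr: "carrier G = (\<lambda>i::nat. x [^] i) ` {..<p ^ 2}"
    using pow_inj_on_ord[OF x(1)] x fin order
    by (intro card_subset_eq[symmetric]) (auto simp: card_image Coset.order_def)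
  \<comment> \<open>The powers of \<open>x [^] p\<close>. They include every element whose
    \<open>p\<close>-th power is trivial, so each subgroup of order \<open>p\<close> is contained in
    this set and equals it by counting.\<close>
  define \<Omega> where "\<Omega> = (\<lambda>j. x [^] (p * j)) ` {..<p}"
  have card_\<Omega>: "card \<Omega> \<le> p" unfolding \<Omega>_def using card_image_le[of "{..<p}"] by fastforce
  have "H = \<Omega>" if H: "subgroup H G" "card H = p" for H
  proof (rule card_seteq)
    show "H \<subseteq> \<Omega>"
    proof
      fix y assume y: "y \<in> H"
      have "y \<in> carrier G" using y H subgroup.subset by blast
      then obtain i :: nat where i: "y = x [^] i" "i < p ^ 2" using carr by auto
      have "x [^] (i * p) = \<one>" using subgroup_pow_card[OF H(1) y] H(2) i x by (simp add: nat_pow_pow)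
      then have "p ^ 2 dvd i * p" using x pow_eq_id by metis
      then have "p dvd i" using p0 by (simp add: power2_eq_square)
      then obtain j where "i = p * j" by blast
      then show "y \<in> \<Omega>" using i p0 by (auto simp: \<Omega>_def power2_eq_square)
    qed
  qed (use card_\<Omega> H in \<open>auto simp: \<Omega>_def\<close>)
  then have "{H. subgroup H G \<and> card H = p} \<subseteq> {\<Omega>}" by auto
  then have "card {H. subgroup H G \<and> card H = p} \<le> card {\<Omega>}" by (intro card_mono) auto
  then show "num_cyclic_subgroups G p \<le> 1" by (simp add: num_cyclic_subgroups_prime[OF p])
qed

lemma (in group) powers_subgroup:
  assumes p: "0 < p" and x: "x \<in> carrier G" "x [^] p = \<one>"
  shows "subgroup ((\<lambda>i::nat. x [^] i) ` {..<p}) G"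
proof -
  have eq: "(\<lambda>i::nat. x [^] i) ` {..<p} = range (\<lambda>i::nat. x [^] i)"
  proof -
    have "x [^] i = x [^] (i mod p)" for i :: nat
    proof -
      have "x [^] i = x [^] (p * (i div p) + i mod p)" by simp
      also have "\<dots> = (x [^] p) [^] (i div p) \<otimes> x [^] (i mod p)" by (simp only: nat_pow_mult nat_pow_pow nat_pow_closed x(1))
      finally show ?thesis using x by simp
    qed
    then have "x [^] i \<in> (\<lambda>i::nat. x [^] i) ` {..<p}" for i :: nat
      using p by (intro image_eqI[of _ _ "i mod p"]) auto
    then show ?thesis by auto
  qed
  show ?thesis unfolding eq
  proof (rule subgroupI)
    fix a b assume "a \<in> range (\<lambda>i::nat. x [^] i)" "b \<in> range (\<lambda>i::nat. x [^] i)"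
    then obtain i j :: nat where ij: "a = x [^] i" "b = x [^] j" by auto
    show "a \<otimes> b \<in> range (\<lambda>i::nat. x [^] i)" using x by (auto simp: ij nat_pow_mult)
    have "inv a = x [^] (i * (p - 1))"
    proof (rule inv_equality)
      have "x [^] (i * (p - 1)) \<otimes> a = x [^] (i * p)"
        using x p by (simp add: ij nat_pow_mult algebra_simps)
      also have "\<dots> = (x [^] p) [^] i" by (simp only: nat_pow_pow x(1) mult.commute)
      finally show "x [^] (i * (p - 1)) \<otimes> a = \<one>" using x by simp
    qed (use x ij in auto)
    then show "inv a \<in> range (\<lambda>i::nat. x [^] i)" by auto
  qed (use x in auto)
qed

text \<open>Inclusion-exclusion over the lines of the plane over the field with \<open>p\<close> elements.\<close>

lemma (in group) elementary_prime_square_sum: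
  fixes f :: "'a \<Rightarrow> rat"
  assumes p: "Factorial_Ring.prime p" and order: "Coset.order G = p ^ 2" and elem: "\<And>x. x \<in> carrier G \<Longrightarrow> x [^] p = \<one>"
  shows "card {L. subgroup L G \<and> card L = p} = p + 1"
    "(\<Sum>L\<in>{L. subgroup L G \<and> card L = p}. sum f L) = of_nat p * f \<one> + sum f (carrier G)"
proof -
  define \<L> where "\<L> = {L. subgroup L G \<and> card L = p}"
  have p1: "1 < p" using p by (rule prime_gt_1_nat)
  have fin: "finite (carrier G)" using order p1 order_gt_0_iff_finite by simp
  have fin\<L>: "finite \<L>"
    using fin by (intro finite_subset[of \<L> "Pow (carrier G)"]) (auto simp: \<L>_def dest: subgroup.subset)
  have L_fin: "finite L" if "L \<in> \<L>" for L
    using that fin by (auto simp: \<L>_def intro: finite_subset dest: subgroup.subset)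
  have L_one: "\<one> \<in> L" if "L \<in> \<L>" for L using that subgroup.one_closed by (auto simp: \<L>_def)
  have cover: "(\<Union>L\<in>\<L>. L - {\<one>}) = carrier G - {\<one>}"
  proof (intro equalityI subsetI)
    fix x assume x: "x \<in> carrier G - {\<one>}"
    then have "ord x = p" using prime_ord[OF p] elem by auto
    then have "card ((\<lambda>i::nat. x [^] i) ` {..<p}) = p" using pow_inj_on_ord[of x p] x by (simp add: card_image)
    then have "(\<lambda>i::nat. x [^] i) ` {..<p} \<in> \<L>"
      using x p1 powers_subgroup[of p x] elem by (simp add: \<L>_def)
    moreover have "x \<in> (\<lambda>i::nat. x [^] i) ` {..<p}" using x p1 by (intro image_eqI[of _ _ 1]) auto
    ultimately show "x \<in> (\<Union>L\<in>\<L>. L - {\<one>})" using x by blast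
  qed (auto simp: \<L>_def dest: subgroup.subset)
  have disj: "(L - {\<one>}) \<inter> (L' - {\<one>}) = {}" if "L \<in> \<L>" "L' \<in> \<L>" "L \<noteq> L'" for L L'
    using that prime_subgroup_powers(1)[OF p] unfolding \<L>_def by blast
  \<comment> \<open>Distinct lines meet in the identity only, and their punctured parts partition
    the rest of the group. So the identity is counted once per line and every other element
    once.\<close>
  have key: "(\<Sum>L\<in>\<L>. sum g L) = of_nat (card \<L>) * g \<one> + sum g (carrier G - {\<one>})" for g :: "'a \<Rightarrow> rat"
  proof -
    have "sum g L = g \<one> + sum g (L - {\<one>})" if "L \<in> \<L>" for L
      using L_fin[OF that] L_one[OF that] by (rule sum.remove)
    then have "(\<Sum>L\<in>\<L>. sum g L) = of_nat (card \<L>) * g \<one> + (\<Sum>L\<in>\<L>. sum g (L - {\<one>}))"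
      by (simp add: sum.distrib)
    also have "(\<Sum>L\<in>\<L>. sum g (L - {\<one>})) = sum g (carrier G - {\<one>})"
      unfolding cover[symmetric] using fin\<L> L_fin disj by (intro sum.UNION_disjoint[symmetric]) auto
    finally show ?thesis .
  qed
  \<comment> \<open>Applied to the constant function 1, \<open>key\<close> becomes an equation for
    the number of lines.\<close>
  have "(\<Sum>L\<in>\<L>. sum (\<lambda>_. 1 :: rat) L) = of_nat (card \<L>) * of_nat p"
    by (simp add: \<L>_def)
  then have "of_nat (card \<L>) * of_nat p = (of_nat (card \<L>) + of_nat (p ^ 2 - 1) :: rat)"
    using key[of "\<lambda>_. 1"] order fin by (simp add: Coset.order_def)
  then have "card \<L> * p = card \<L> + (p ^ 2 - 1)" by (metis of_nat_add of_nat_eq_iff of_nat_mult)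
  then have "card \<L> * (p - 1) = (p + 1) * (p - 1)"
    using p1 by (simp add: algebra_simps power2_eq_square diff_mult_distrib2)
  then show card\<L>: "card {L. subgroup L G \<and> card L = p} = p + 1" using p1 unfolding \<L>_def by (subst (asm) mult_cancel2) auto
  have "sum f (carrier G) = f \<one> + sum f (carrier G - {\<one>})" using fin by (intro sum.remove) auto
  then show "(\<Sum>L\<in>{L. subgroup L G \<and> card L = p}. sum f L) = of_nat p * f \<one> + sum f (carrier G)"
    using key[of f] card\<L> unfolding \<L>_def by (simp add: algebra_simps)
qed

lemma (in group) elementary_prime_square_invariants:
  assumes p: "Factorial_Ring.prime p" and order: "Coset.order G = p ^ 2" and elem: "\<And>x. x \<in> carrier G \<Longrightarrow> x [^] p = \<one>"
  shows "group_exponent G = p" "num_cyclic_subgroups G p = p + 1"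
proof -
  have p1: "1 < p" using p by (rule prime_gt_1_nat)
  obtain x where x: "x \<in> carrier G" "x \<noteq> \<one>"
  proof -
    have "\<not> carrier G \<subseteq> {\<one>}"
      using order p1 card_mono[of "{\<one>}" "carrier G"] one_less_power[of p 2] by (auto simp: Coset.order_def)
    then show ?thesis using that by blast
  qed
  then have "ord x = p" using prime_ord[OF p] elem by auto
  then show "group_exponent G = p" using x elem p1 by (intro group_exponent_eqI) auto
  show "num_cyclic_subgroups G p = p + 1"
    using num_cyclic_subgroups_prime[OF p] elementary_prime_square_sum(1)[OF p order elem] by simp
qed

section \<open>Groups with \<open>G' = Z(G)\<close> of order \<open>p\<^sup>2\<close>\<close>

lemma (in group) finite_mult_closed_subgroup:
  assumes fin: "finite (carrier G)" and S: "S \<subseteq> carrier G" "S \<noteq> {}" "\<And>a b. a \<in> S \<Longrightarrow> b \<in> S \<Longrightarrow> a \<otimes> b \<in> S"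
  shows "subgroup S G"
proof (rule subgroupI)
  fix a assume a: "a \<in> S"
  have pos: "a [^] Suc n \<in> S" for n using a S by (induction n) auto
  have aG: "a \<in> carrier G" using a S by blast
  \<comment> \<open>\<open>S\<close> is only known to contain the positive powers of
    \<open>a\<close>. The exponent \<open>2 * Coset.order G - 1\<close> is positive even in the
    trivial group, where \<open>Coset.order G - 1\<close> would be 0.\<close>
  have "Coset.order G > 0" using fin order_gt_0_iff_finite by blast
  then have "a [^] (2 * Coset.order G - 1) \<otimes> a = a [^] (2 * Coset.order G)"
    using nat_pow_Suc[of a "2 * Coset.order G - 1"] by simp
  also have "\<dots> = \<one>" using pow_order_eq_1[OF aG] aG by (metis mult.commute nat_pow_one nat_pow_pow)
  finally have "inv a = a [^] (2 * Coset.order G - 1)" using aG by (simp add: inv_equality)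
  also have "2 * Coset.order G - 1 = Suc (2 * Coset.order G - 2)" using \<open>Coset.order G > 0\<close> by simp
  also have "a [^] \<dots> \<in> S" by (rule pos)
  finally show "inv a \<in> S" .
qed (use S in auto)

text \<open>If \<open>k\<close> were prime to \<open>p\<close>, Bezout's identity would express
  \<open>x\<close> through \<open>x [^] k\<close> and \<open>x [^] p\<close>, both in
  \<open>H\<close>.\<close>

lemma (in group) pow_mem_iff_dvd:
  assumes p: "Factorial_Ring.prime p" and H: "subgroup H G" and x: "x \<in> carrier G" "x \<notin> H" "x [^] p \<in> H"
  shows "x [^] (k::nat) \<in> H \<longleftrightarrow> p dvd k"
proof
  assume k: "x [^] k \<in> H"
  show "p dvd k"
  proof (rule ccontr)
    assume "\<not> p dvd k"
    then have "gcd (int k) (int p) = 1"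
      using p by (metis coprime_commute coprime_iff_gcd_eq_1 coprime_int_iff prime_imp_coprime)
    then obtain a b where ab: "a * int k + b * int p = 1" using bezout_int[of "int k" "int p"] by metis
    have "x [^] (a * int k + b * int p) = (x [^] int k) [^] a \<otimes> (x [^] int p) [^] b"
      using x by (simp add: int_pow_mult int_pow_pow mult.commute)
    also have "\<dots> \<in> H"
    proof -
      have "x [^] int k \<in> H" "x [^] int p \<in> H" using k x by (simp_all only: int_pow_int)
      then have "(x [^] int k) [^] a \<in> H" "(x [^] int p) [^] b \<in> H" using subgroup_int_pow_closed[OF H] by blast+
      then show ?thesis by (rule subgroup.m_closed[OF H])
    qed
    finally show False using ab x by simp
  qed
next
  interpret H: subgroup H G by fact
  assume "p dvd k"
  then obtain j where "k = p * j" by blast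
  then have "x [^] k = (x [^] p) [^] j" using x by (simp add: nat_pow_pow)
  moreover have "y [^] n \<in> H" if "y \<in> H" for y and n :: nat using that by (induction n) auto
  ultimately show "x [^] k \<in> H" using x by simp
qed

text \<open>The step from \<open>N\<close> to the group generated by \<open>N\<close> and a
  normalising element \<open>x\<close>, where \<open>e\<close> is the order of \<open>x\<close>
  modulo \<open>N\<close>. It serves for the chain from \<open>N\<close> over \<open>M\<close> and
  \<open>A\<close> to \<open>G\<close>, for \<open>W\<close> over \<open>N\<close>, and for the
  centre over \<open>K\<close>.\<close>

lemma (in group) cyclic_extension:
  assumes fin: "finite (carrier G)" and N: "subgroup N G" and x: "x \<in> carrier G"
    and normalises: "\<forall>n\<in>N. inv x \<otimes> n \<otimes> x \<in> N" and e: "0 < e" "\<And>k::nat. x [^] k \<in> N \<longleftrightarrow> e dvd k"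
  shows "subgroup {x [^] (k::nat) \<otimes> n | k n. n \<in> N} G"
    "bij_betw (\<lambda>(k::nat, n). x [^] k \<otimes> n) ({..<e} \<times> N) {x [^] (k::nat) \<otimes> n | k n. n \<in> N}"
    "card {x [^] (k::nat) \<otimes> n | k n. n \<in> N} = e * card N"
    "\<And>n k. n \<in> N \<Longrightarrow> \<exists>n'\<in>N. n \<otimes> x [^] (k::nat) = x [^] k \<otimes> n'"
proof -
  interpret N: subgroup N G by fact
  define E where "E = {x [^] (k::nat) \<otimes> n | k n. n \<in> N}"
  show swap: "\<exists>n'\<in>N. n \<otimes> x [^] k = x [^] k \<otimes> n'" if "n \<in> N" for n and k :: nat
    using that
  proof (induction k arbitrary: n)
    case 0
    then show ?case by (intro bexI[of _ n]) auto
  next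
    case (Suc k)
    then obtain n' where n': "n' \<in> N" "n \<otimes> x [^] k = x [^] k \<otimes> n'" by blast
    have "n \<otimes> x [^] Suc k = (n \<otimes> x [^] k) \<otimes> x" using x Suc.prems by (simp add: m_assoc)
    also have "\<dots> = x [^] Suc k \<otimes> (inv x \<otimes> n' \<otimes> x)"
      unfolding n'(2) using x n'(1) by (simp add: group_simps)
    finally show ?case using normalises n'(1) by blast
  qed
  have "subgroup E G"
  proof (rule finite_mult_closed_subgroup[OF fin])
    fix a b assume "a \<in> E" "b \<in> E"
    then obtain k n l m where km: "a = x [^] (k::nat) \<otimes> n" "n \<in> N" "b = x [^] (l::nat) \<otimes> m" "m \<in> N"
      by (auto simp: E_def)
    obtain n' where n': "n' \<in> N" "n \<otimes> x [^] l = x [^] l \<otimes> n'" using swap km by blast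
    have "a \<otimes> b = x [^] k \<otimes> (n \<otimes> x [^] l) \<otimes> m" using km x by (simp add: m_assoc)
    also have "\<dots> = x [^] (k + l) \<otimes> (n' \<otimes> m)"
      unfolding n'(2) using n'(1) km x by (simp add: m_assoc nat_pow_mult[symmetric])
    finally show "a \<otimes> b \<in> E" using n' km by (auto simp: E_def)
  next
    have "x [^] (0::nat) \<otimes> \<one> \<in> E" unfolding E_def using N.one_closed by blast
    then show "E \<noteq> {}" by blast
  qed (use x in \<open>auto simp: E_def\<close>)
  then show "subgroup {x [^] (k::nat) \<otimes> n | k n. n \<in> N} G" by (simp add: E_def)
  have inj: "k = l \<and> n = m" if "k < e" "l < e" "n \<in> N" "m \<in> N" "x [^] k \<otimes> n = x [^] l \<otimes> m" "k \<le> l" for k l :: nat and n m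
  proof -
    have "x [^] l = x [^] k \<otimes> x [^] (l - k)" using x that by (simp add: nat_pow_mult)
    then have "x [^] k \<otimes> n = x [^] k \<otimes> (x [^] (l - k) \<otimes> m)" using that x by (simp add: m_assoc)
    then have n: "n = x [^] (l - k) \<otimes> m" using that x by (simp add: m_assoc)
    then have "x [^] (l - k) = n \<otimes> inv m" using that x by (simp add: m_assoc)
    then have "x [^] (l - k) \<in> N" using that by simp
    then have "e dvd l - k" using e by blast
    then have "k = l" using that by (metis dvd_imp_le diff_is_0_eq diff_le_self le_antisym le_trans not_le zero_less_diff)
    then show ?thesis using n that x by simp
  qed
  have "inj_on (\<lambda>(k::nat, n). x [^] k \<otimes> n) ({..<e} \<times> N)"
  proof (rule inj_onI)
    fix a b assume "a \<in> {..<e} \<times> N" "b \<in> {..<e} \<times> N"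
      "(case a of (k, n) \<Rightarrow> x [^] k \<otimes> n) = (case b of (k, n) \<Rightarrow> x [^] k \<otimes> n)"
    moreover obtain k n l m where "a = (k, n)" "b = (l, m)" by fastforce
    ultimately show "a = b" using inj[of k l n m] inj[of l k m n] by (cases "k \<le> l") auto
  qed
  moreover have "(\<lambda>(k::nat, n). x [^] k \<otimes> n) ` ({..<e} \<times> N) = E"
  proof
    show "E \<subseteq> (\<lambda>(k::nat, n). x [^] k \<otimes> n) ` ({..<e} \<times> N)"
    proof
      fix y assume "y \<in> E"
      then obtain k :: nat and n where y: "y = x [^] k \<otimes> n" "n \<in> N" by (auto simp: E_def)
      have "x [^] k = x [^] (k mod e) \<otimes> x [^] (e * (k div e))" using x by (simp add: nat_pow_mult)
      then have "y = x [^] (k mod e) \<otimes> (x [^] (e * (k div e)) \<otimes> n)" using y x by (simp add: m_assoc)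
      moreover have "x [^] (e * (k div e)) \<otimes> n \<in> N" using y e by simp
      ultimately show "y \<in> (\<lambda>(k::nat, n). x [^] k \<otimes> n) ` ({..<e} \<times> N)"
        using e by (intro image_eqI[of _ _ "(k mod e, x [^] (e * (k div e)) \<otimes> n)"]) auto
    qed
  qed (auto simp: E_def)
  ultimately show bij: "bij_betw (\<lambda>(k::nat, n). x [^] k \<otimes> n) ({..<e} \<times> N) {x [^] (k::nat) \<otimes> n | k n. n \<in> N}"
    by (simp add: bij_betw_def E_def)
  show "card {x [^] (k::nat) \<otimes> n | k n. n \<in> N} = e * card N"
    unfolding bij_betw_same_card[OF bij, symmetric] by (simp add: card_cartesian_product)
qed

lemma sum_powers_root_of_unity:
  fixes c :: complex
  assumes "c ^ p = 1" "c \<noteq> 1"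
  shows "(\<Sum>i<p. c ^ i) = 0"
  using assms by (simp add: geometric_sum)

text \<open>Beside the basic hypotheses, these are the conclusions of \<open>phi4_structure\<close>.
  Isoclinism and the presentation enter the rest through them alone.\<close>

locale phi4 = group G for G (structure) +
  fixes p :: nat
  assumes prime: "Factorial_Ring.prime p" and odd: "odd p" and order: "Coset.order G = p ^ 5"
    and derived_eq: "commutator_subgroup G = centre G" and card_centre: "card (centre G) = p ^ 2"
    and pow_centre: "\<And>z. z \<in> centre G \<Longrightarrow> z [^] p = \<one>"
    and pow_in_centre: "\<And>x. x \<in> carrier G \<Longrightarrow> x [^] p \<in> centre G"
    and card_upper: "\<And>K. subgroup K G \<Longrightarrow> K \<subseteq> centre G \<Longrightarrow> card K = p \<Longrightarrow>
      card {g \<in> carrier G. \<forall>h\<in>carrier G. commutator G g h \<in> K} = p ^ 3"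
begin

abbreviation "Z \<equiv> centre G"
abbreviation "C \<equiv> commutator G"

lemma p1: "1 < p" and p0: "0 < p"
  using prime prime_gt_1_nat prime_gt_0_nat by auto

lemma fin: "finite (carrier G)"
  using order p0 order_gt_0_iff_finite by simp

sublocale Z: subgroup Z G by (rule subgroup_centre)

lemma Z_comm: "z \<in> Z \<Longrightarrow> x \<in> carrier G \<Longrightarrow> z \<otimes> x = x \<otimes> z"
  unfolding centre_def by blast

lemma C_Z: "x \<in> carrier G \<Longrightarrow> y \<in> carrier G \<Longrightarrow> C x y \<in> Z"
  using commutator_in_derived derived_eq by blast

text \<open>Commutators are central, so \<open>C x z\<close> can be moved past \<open>y\<close>.
  With \<open>C_mult_right\<close> this makes the commutator map bilinear.\<close>

lemma C_mult_left:
  assumes [simp]: "x \<in> carrier G" "y \<in> carrier G" "z \<in> carrier G"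
  shows "C (x \<otimes> y) z = C x z \<otimes> C y z"
proof (rule commutator_eqI)
  have "x \<otimes> y \<otimes> z = x \<otimes> (z \<otimes> y \<otimes> C y z)"
    using mult_commutator[of y z] by (simp add: m_assoc)
  also have "\<dots> = (z \<otimes> x \<otimes> C x z) \<otimes> y \<otimes> C y z"
    using mult_commutator[of x z] by (simp flip: m_assoc)
  also have "\<dots> = z \<otimes> x \<otimes> (C x z \<otimes> y) \<otimes> C y z" by (simp add: m_assoc)
  also have "C x z \<otimes> y = y \<otimes> C x z" by (rule Z_comm) (simp_all add: C_Z)
  finally show "x \<otimes> y \<otimes> z = z \<otimes> (x \<otimes> y) \<otimes> (C x z \<otimes> C y z)" by (simp add: m_assoc)
qed auto

lemma C_inv: assumes [simp]: "x \<in> carrier G" "y \<in> carrier G" shows "C y x = inv (C x y)"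
  using assms by (simp add: commutator_def group_simps)

lemma C_mult_right:
  assumes [simp]: "x \<in> carrier G" "y \<in> carrier G" "z \<in> carrier G"
  shows "C z (x \<otimes> y) = C z x \<otimes> C z y"
proof -
  have "C z (x \<otimes> y) = inv (C y z) \<otimes> inv (C x z)"
    using C_inv[of "x \<otimes> y" z] by (simp add: C_mult_left inv_mult_group)
  also have "\<dots> = C z y \<otimes> C z x" by (simp add: C_inv[symmetric])
  also have "\<dots> = C z x \<otimes> C z y" by (rule Z_comm) (simp_all add: C_Z)
  finally show ?thesis .
qed

lemma C_one: "x \<in> carrier G \<Longrightarrow> C \<one> x = \<one>" "x \<in> carrier G \<Longrightarrow> C x \<one> = \<one>" "x \<in> carrier G \<Longrightarrow> C x x = \<one>"
  by (simp_all add: commutator_def m_assoc)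

lemma C_pow_left: "x \<in> carrier G \<Longrightarrow> y \<in> carrier G \<Longrightarrow> C (x [^] n) y = C x y [^] (n::nat)"
  by (induction n) (simp_all add: C_one C_mult_left)

lemma C_pow_right: "x \<in> carrier G \<Longrightarrow> y \<in> carrier G \<Longrightarrow> C x (y [^] n) = C x y [^] (n::nat)"
  by (induction n) (simp_all add: C_one C_mult_right)

lemma C_Z_left: "z \<in> Z \<Longrightarrow> x \<in> carrier G \<Longrightarrow> C z x = \<one>"
  by (rule commutator_eqI) (auto simp: Z_comm)

lemma conj_eq:
  assumes "x \<in> carrier G" "y \<in> carrier G"
  shows "inv y \<otimes> x \<otimes> y = x \<otimes> C x y"
  using assms by (simp add: commutator_def group_simps)

text \<open>In nilpotency class 2 the two sides for an exponent \<open>n\<close> differ by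
  \<open>C y x [^] (n choose 2)\<close>. For odd \<open>p\<close> the number
  \<open>p choose 2\<close> is a multiple of \<open>p\<close>, and commutators have trivial
  \<open>p\<close>-th power. This is where oddness enters.\<close>

lemma pow_p_mult:
  assumes [simp]: "x \<in> carrier G" "y \<in> carrier G"
  shows "(x \<otimes> y) [^] p = x [^] p \<otimes> y [^] p"
proof -
  define c where "c = C y x"
  have c: "c \<in> Z" "c \<in> carrier G" by (simp_all add: c_def C_Z)
  have c_pow: "c [^] (k::nat) \<in> Z" for k using c by (induction k) auto
  have *: "(x \<otimes> y) [^] n = x [^] n \<otimes> y [^] n \<otimes> c [^] (n choose 2)" for n :: nat
  proof (induction n)
    case (Suc n)
    have "(x \<otimes> y) [^] Suc n = x [^] n \<otimes> y [^] n \<otimes> c [^] (n choose 2) \<otimes> (x \<otimes> y)" using Suc by simp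
    also have "\<dots> = x [^] n \<otimes> y [^] n \<otimes> (c [^] (n choose 2) \<otimes> (x \<otimes> y))" using c by (simp add: m_assoc)
    also have "c [^] (n choose 2) \<otimes> (x \<otimes> y) = (x \<otimes> y) \<otimes> c [^] (n choose 2)" by (rule Z_comm[OF c_pow]) simp
    also have "x [^] n \<otimes> y [^] n \<otimes> (x \<otimes> y \<otimes> c [^] (n choose 2)) = x [^] n \<otimes> (y [^] n \<otimes> x) \<otimes> y \<otimes> c [^] (n choose 2)"
      using c by (simp add: m_assoc)
    also have "y [^] n \<otimes> x = x \<otimes> y [^] n \<otimes> c [^] n"
      using mult_commutator[of "y [^] n" x] by (simp add: C_pow_left c_def)
    also have "x [^] n \<otimes> (x \<otimes> y [^] n \<otimes> c [^] n) \<otimes> y \<otimes> c [^] (n choose 2)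
        = x [^] n \<otimes> x \<otimes> y [^] n \<otimes> (c [^] n \<otimes> y) \<otimes> c [^] (n choose 2)"
      using c by (simp add: m_assoc)
    also have "c [^] n \<otimes> y = y \<otimes> c [^] n" by (rule Z_comm[OF c_pow]) simp
    also have "x [^] n \<otimes> x \<otimes> y [^] n \<otimes> (y \<otimes> c [^] n) \<otimes> c [^] (n choose 2)
      = x [^] Suc n \<otimes> y [^] Suc n \<otimes> c [^] (Suc n choose 2)"
      using c by (simp add: m_assoc nat_pow_mult numeral_2_eq_2)
    finally show ?case .
  qed (use c in \<open>simp add: numeral_2_eq_2\<close>)
  have "p choose 2 = p * ((p - 1) div 2)"
    using odd by (simp add: choose_two div_mult_swap)
  then have "c [^] (p choose 2) = (c [^] p) [^] ((p - 1) div 2)" using c by (simp add: nat_pow_pow)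
  then have "c [^] (p choose 2) = \<one>" using pow_centre[OF c(1)] by simp
  then show ?thesis using *[of p] by simp
qed

lemma inv_pow_p: "x \<in> carrier G \<Longrightarrow> (inv x) [^] p = inv (x [^] p)"
  by (simp add: nat_pow_inv)

end

section \<open>A subgroup \<open>K\<close> of order \<open>p\<close> of the centre, and the preimage
  of the centre of \<open>G/K\<close>\<close>

locale phi4_line = phi4 +
  fixes K
  assumes K: "subgroup K G" and K_Z: "K \<subseteq> centre G" and card_K: "card K = p"
begin

sublocale K: subgroup K G by (rule K)

definition "W = {g \<in> carrier G. \<forall>h\<in>carrier G. C g h \<in> K}"

lemma card_W: "card W = p ^ 3"
  using card_upper[OF K K_Z card_K] by (simp add: W_def)

lemma W_G: "w \<in> W \<Longrightarrow> w \<in> carrier G" and C_W: "w \<in> W \<Longrightarrow> x \<in> carrier G \<Longrightarrow> C w x \<in> K"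
  by (simp_all add: W_def)

lemma W_I: "g \<in> carrier G \<Longrightarrow> (\<And>h. h \<in> carrier G \<Longrightarrow> C g h \<in> K) \<Longrightarrow> g \<in> W"
  by (simp add: W_def)

lemma C_W': "w \<in> W \<Longrightarrow> x \<in> carrier G \<Longrightarrow> C x w \<in> K"
  using C_inv[of w x] C_W W_G by simp

lemma subgroup_W: "subgroup W G"
proof (rule finite_mult_closed_subgroup[OF fin])
  show "W \<noteq> {}" using C_one by (auto simp: W_def intro!: exI[of _ \<one>])
qed (auto simp: W_def C_mult_left)

sublocale W: subgroup W G by (rule subgroup_W)

lemma Z_W: "Z \<subseteq> W"
proof
  fix z assume z: "z \<in> Z"
  have "C z h \<in> K" if "h \<in> carrier G" for h using C_Z_left[OF z that] by simp
  then show "z \<in> W" using Z.mem_carrier[OF z] by (intro W_I)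
qed

lemma fin_W: "finite W" and fin_K: "finite K" and fin_Z: "finite Z"
  using fin finite_subset W.subset K.subset Z.subset by blast+

text \<open>Such an element \<open>v\<close> is the reason why the Schur index is \<open>1\<close>: a character of \<open>W\<close> that is
  trivial on \<open>K\<close> extends to \<open>\<langle>v, W\<rangle>\<close> without enlarging its field of values.\<close>

lemma exists_outside_upper: "\<exists>v\<in>carrier G - W. v [^] p \<in> K"
proof -
  \<comment> \<open>The kernel of the homomorphism from \<open>G\<close> to \<open>Z/K\<close>
    induced by \<open>x [^] p\<close>. The target has order \<open>p\<close>, so \<open>P\<close>
    has at least \<open>p ^ 4\<close> elements and does not fit into \<open>W\<close>.\<close>
  define P where "P = {x \<in> carrier G. x [^] p \<in> K}"
  have subP: "subgroup P G"
    by (rule finite_mult_closed_subgroup[OF fin]) (auto simp: P_def pow_p_mult)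
  have coset_eq: "K #> x = K #> y \<longleftrightarrow> x \<otimes> inv y \<in> K" if "x \<in> carrier G" "y \<in> carrier G" for x y
  proof -
    have "K #> x = K #> y \<longleftrightarrow> x \<in> K #> y"
      using that K by (metis rcos_self repr_independence)
    then show ?thesis using that K.rcos_module[OF group_axioms, of y x] by simp
  qed
  define f where "f x = K #> x [^] p" for x
  have "card (f ` carrier G) * card P = p ^ 5"
    unfolding order[symmetric]
    by (rule card_fibres_subgroup[OF subP fin]) (simp add: f_def coset_eq P_def pow_p_mult inv_pow_p)
  moreover have "card (f ` carrier G) \<le> p"
  proof -
    interpret GZ: group "G\<lparr>carrier := Z\<rparr>" by (rule subgroup_imp_group) (rule subgroup_centre)
    have "card ((\<lambda>z. K #> z) ` carrier (G\<lparr>carrier := Z\<rparr>)) * card K = Coset.order (G\<lparr>carrier := Z\<rparr>)"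
    proof (rule GZ.card_fibres_subgroup)
      show "subgroup K (G\<lparr>carrier := Z\<rparr>)" using K subgroup_centre K_Z by (rule subgroup_incl)
    qed (use fin_Z coset_eq in \<open>auto simp: m_inv_consistent subgroup_centre\<close>)
    then have "card ((\<lambda>z. K #> z) ` Z) * p = p * p"
      using card_K card_centre by (simp add: Coset.order_def power2_eq_square)
    then have "card ((\<lambda>z. K #> z) ` Z) = p" using p0 by simp
    moreover have "f ` carrier G \<subseteq> (\<lambda>z. K #> z) ` Z" using pow_in_centre by (auto simp: f_def)
    ultimately show ?thesis using fin_Z card_mono by (metis finite_imageI)
  qed
  ultimately have "p ^ 5 \<le> p * card P" by (metis mult_le_mono1)
  then have "p * p ^ 4 \<le> p * card P" by (simp flip: power_Suc)
  then have "p ^ 4 \<le> card P" using p0 by simp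
  moreover have "p ^ 3 < p ^ 4" using p1 by (intro power_strict_increasing) auto
  ultimately have "\<not> P \<subseteq> W" using card_mono[OF fin_W, of P] card_W by auto
  then show ?thesis by (auto simp: P_def)
qed

end

section \<open>Irreducible representations over \<open>\<rat>(\<zeta>)\<close>\<close>

text \<open>\<open>\<mu>\<close> is extended by zero outside \<open>A\<close>. For fixed
  \<open>y\<close> and column \<open>k\<close> exactly one representative \<open>t j\<close>
  contributes, so the matrix product collapses to one term and multiplicativity on \<open>A\<close>
  applies.\<close>

lemma (in group) induced_representation:
  fixes \<mu> :: "'a \<Rightarrow> complex"
  assumes A: "subgroup A G" and mult: "\<And>x y. x \<in> A \<Longrightarrow> y \<in> A \<Longrightarrow> \<mu> (x \<otimes> y) = \<mu> x * \<mu> y"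
    and zero: "\<And>x. x \<notin> A \<Longrightarrow> \<mu> x = 0" and one: "\<mu> \<one> = 1"
    and t: "\<And>i. i < p \<Longrightarrow> t i \<in> carrier G" "\<And>g. g \<in> carrier G \<Longrightarrow> \<exists>!i. i < p \<and> inv (t i) \<otimes> g \<in> A"
  defines "R \<equiv> \<lambda>g i j. \<mu> (inv (t i) \<otimes> g \<otimes> t j)"
  shows "x \<in> carrier G \<Longrightarrow> y \<in> carrier G \<Longrightarrow> i < p \<Longrightarrow> k < p \<Longrightarrow>
      R (x \<otimes> y) i k = (\<Sum>j<p. R x i j * R y j k)"
    and "i < (p::nat) \<Longrightarrow> j < p \<Longrightarrow> R \<one> i j = of_bool (i = j)"
proof -
  interpret A: subgroup A G by fact
  assume xy: "x \<in> carrier G" "y \<in> carrier G" and ik: "i < p" "k < p"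
  have "y \<otimes> t k \<in> carrier G" using xy t ik by simp
  from t(2)[OF this] obtain j where j: "j < p" "inv (t j) \<otimes> (y \<otimes> t k) \<in> A"
    and uniq: "\<And>j'. j' < p \<Longrightarrow> inv (t j') \<otimes> (y \<otimes> t k) \<in> A \<Longrightarrow> j' = j" by blast
  define a where "a = inv (t j) \<otimes> y \<otimes> t k"
  have a: "a \<in> A" using j t xy ik by (simp add: a_def m_assoc)
  have other: "R y j' k = 0" if "j' < p" "j' \<noteq> j" for j'
  proof -
    have "inv (t j') \<otimes> y \<otimes> t k = inv (t j') \<otimes> (y \<otimes> t k)" using that t(1) xy ik by (simp add: m_assoc)
    then have "inv (t j') \<otimes> y \<otimes> t k \<notin> A" using uniq[of j'] that by auto
    then show ?thesis by (simp add: R_def zero)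
  qed
  have "(\<Sum>j<p. R x i j * R y j k) = R x i j * R y j k"
    using j other by (subst sum.remove[of _ j]) auto
  also have "\<dots> = R (x \<otimes> y) i k"
  proof -
    define b where "b = inv (t i) \<otimes> x \<otimes> t j"
    have bG: "b \<in> carrier G" using t ik j xy by (simp add: b_def)
    have eq: "inv (t i) \<otimes> (x \<otimes> y) \<otimes> t k = b \<otimes> a"
      using t ik j xy by (simp add: a_def b_def group_simps)
    have "\<mu> (b \<otimes> a) = \<mu> b * \<mu> a"
    proof (cases "b \<in> A")
      case False
      have "b \<otimes> a \<notin> A"
      proof
        assume "b \<otimes> a \<in> A"
        then have "b \<otimes> a \<otimes> inv a \<in> A" using a by blast
        then show False using False a bG by (simp add: m_assoc)
      qed
      then show ?thesis using False by (simp add: zero)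
    qed (use a mult in simp)
    then show ?thesis unfolding R_def eq by (simp add: a_def b_def)
  qed
  finally show "R (x \<otimes> y) i k = (\<Sum>j<p. R x i j * R y j k)" by simp
next
  assume ij: "i < p" "j < p"
  show "R \<one> i j = of_bool (i = j)"
  proof (cases "i = j")
    case False
    have "inv (t i) \<otimes> t j \<notin> A"
    proof
      assume "inv (t i) \<otimes> t j \<in> A"
      moreover have "inv (t j) \<otimes> t j \<in> A" using t ij A subgroup.one_closed by simp
      ultimately show False using t(2)[of "t j"] t(1) ij False by blast
    qed
    then show ?thesis using False t ij by (simp add: R_def zero)
  qed (use t ij one in \<open>simp add: R_def\<close>)
qed

lemma sum_lessThan_first:
  fixes F :: "nat \<Rightarrow> 'b::comm_monoid_add"
  assumes "0 < p" "\<And>c. 0 < c \<Longrightarrow> F c = 0"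
  shows "(\<Sum>c<p. F c) = F 0"
proof -
  have "(\<Sum>c<p. F c) = F 0 + sum F ({..<p} - {0})" using assms(1) by (intro sum.remove) auto
  also have "sum F ({..<p} - {0}) = 0" using assms(2) by (intro sum.neutral) auto
  finally show ?thesis by simp
qed

text \<open>\<open>N\<close> is the kernel of the scalar action of \<open>W\<close>, and
  \<open>g\<^sub>0\<close> generates \<open>W\<close> modulo \<open>N\<close>, with order
  \<open>p * q\<close>. Two cases occur: \<open>q = p\<close> with \<open>N = K\<close> if
  \<open>W/K\<close> is cyclic, and \<open>q = 1\<close> with \<open>g\<^sub>0\<close> central if
  \<open>W/K\<close> is elementary abelian. In both, \<open>g\<^sub>0 [^] q\<close> generates the
  centre modulo \<open>K\<close>.\<close>

locale phi4_component = phi4_line +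
  fixes N and q e :: nat and g\<^sub>0 :: 'a and \<zeta> :: complex and v
  assumes N: "subgroup N G" and K_N: "K \<subseteq> N" and N_W: "N \<subseteq> W" and N_Z: "N \<inter> centre G = K"
    and g0: "g\<^sub>0 \<in> W" and q: "q = p ^ e" and g0_pow: "\<And>k::nat. g\<^sub>0 [^] k \<in> N \<longleftrightarrow> p * q dvd k"
    and g0_q: "g\<^sub>0 [^] q \<in> centre G"
    and card_N: "p * q * card N = p ^ 3" and \<zeta>: "primitive_root_of_unity (p * q) \<zeta>"
    and v: "v \<in> carrier G" "v \<notin> W" and v_p: "v [^] p \<in> K"
begin

abbreviation "d \<equiv> p * q"

lemma d0: "0 < d" and \<zeta>_d: "\<zeta> ^ d = 1" and \<zeta>_0: "\<zeta> \<noteq> 0"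
  using \<zeta> by (auto simp: primitive_root_of_unity_def power_0_left)

lemma \<zeta>_pow: "\<zeta> ^ k = 1 \<longleftrightarrow> d dvd k"
proof
  assume k: "\<zeta> ^ k = 1"
  have "\<zeta> ^ k = \<zeta> ^ (k mod d) * (\<zeta> ^ d) ^ (k div d)" by (metis mod_mult_div_eq power_add power_mult)
  then have "\<zeta> ^ (k mod d) = 1" using k \<zeta>_d by simp
  moreover have "k mod d < d" using d0 by simp
  ultimately have "k mod d = 0" using \<zeta> unfolding primitive_root_of_unity_def by (metis gr0I)
  then show "d dvd k" by (simp add: dvd_eq_mod_eq_0)
qed (use \<zeta>_d in \<open>auto simp: power_mult\<close>)

sublocale N: subgroup N G by (rule N)

lemma g0_G [simp]: "g\<^sub>0 \<in> carrier G" and v_G [simp]: "v \<in> carrier G"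
  using g0 W_G v by auto

lemma N_G: "n \<in> N \<Longrightarrow> n \<in> carrier G" by (rule N.mem_carrier)

lemma normalise_v: "\<forall>n\<in>N. inv v \<otimes> n \<otimes> v \<in> N"
  using C_W[of _ v] N_W K_N by (simp add: conj_eq N_G subset_iff)

lemma v_pow: "v [^] (k::nat) \<in> N \<longleftrightarrow> p dvd k"
proof -
  have "v \<notin> N" using v N_W by blast
  moreover have "v [^] p \<in> N" using v_p K_N by blast
  ultimately show ?thesis using pow_mem_iff_dvd[OF prime N v_G] by blast
qed

text \<open>The future kernel of the extended character \<open>\<mu>\<close>; adjoining
  \<open>v\<close> to \<open>N\<close> adds no element of \<open>W\<close>, as \<open>M_W\<close>
  shows.\<close>

definition "M = {v [^] (k::nat) \<otimes> n | k n. n \<in> N}"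

lemmas M_ext = cyclic_extension[OF fin N v_G normalise_v p0 v_pow, folded M_def]

sublocale M: subgroup M G by (rule M_ext(1))

lemma N_M: "N \<subseteq> M"
proof
  fix n assume n: "n \<in> N"
  then have "n = v [^] (0::nat) \<otimes> n" by (simp add: N_G)
  then show "n \<in> M" unfolding M_def using n by blast
qed

lemma v_M: "v \<in> M"
proof -
  have "v = v [^] (1::nat) \<otimes> \<one>" by simp
  then show ?thesis unfolding M_def using N.one_closed by blast
qed

text \<open>A power of \<open>v\<close> lies in \<open>W\<close> only if its exponent is a multiple
  of \<open>p\<close>, and then it lies in \<open>K\<close> already.\<close>

lemma M_W: "M \<inter> W = N"
proof
  show "M \<inter> W \<subseteq> N"
  proof
    fix x assume x: "x \<in> M \<inter> W"
    then obtain k :: nat and n where kn: "x = v [^] k \<otimes> n" "n \<in> N" by (auto simp: M_def)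
    then have "v [^] k = x \<otimes> inv n" by (simp add: m_assoc N_G)
    also have "\<dots> \<in> W" using x kn N_W by blast
    finally have "v [^] k \<in> W" .
    moreover have "v [^] p \<in> W" using pow_in_centre[OF v_G] Z_W by blast
    ultimately have "p dvd k" using pow_mem_iff_dvd[OF prime subgroup_W v_G v(2)] by blast
    then have "v [^] k \<in> N" by (simp add: v_pow)
    then show "x \<in> N" using kn by simp
  qed
qed (use N_M N_W in blast)

lemma normalise_g0: "\<forall>m\<in>M. inv g\<^sub>0 \<otimes> m \<otimes> g\<^sub>0 \<in> M"
  using C_W'[OF g0] K_N N_M by (simp add: conj_eq subset_iff)

lemma W_pow: "w \<in> W \<Longrightarrow> w [^] (k::nat) \<in> W"
  by (induction k) auto

lemma g0_pow_M: "g\<^sub>0 [^] (k::nat) \<in> M \<longleftrightarrow> d dvd k"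
  using g0_pow[of k] M_W W_pow[OF g0, of k] by blast

text \<open>The group generated by \<open>v\<close> and \<open>W\<close>, of index \<open>p\<close>.
  It is abelian modulo \<open>K\<close> by \<open>C_A_A\<close>, and cyclic of order
  \<open>d\<close> modulo \<open>M\<close>.\<close>

definition "A = {g\<^sub>0 [^] (k::nat) \<otimes> m | k m. m \<in> M}"

lemmas A_ext = cyclic_extension[OF fin M_ext(1) g0_G normalise_g0 d0 g0_pow_M, folded A_def]

sublocale A: subgroup A G by (rule A_ext(1))

lemma card_A: "card A = p ^ 4"
proof -
  have "card A = p * (d * card N)" using A_ext(3) M_ext(3) by (simp add: ac_simps)
  then show ?thesis using card_N by (simp add: power_Suc[symmetric])
qed

lemma M_A: "M \<subseteq> A"
proof
  fix m assume m: "m \<in> M"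
  then have "m = g\<^sub>0 [^] (0::nat) \<otimes> m" by simp
  then show "m \<in> A" unfolding A_def using m by blast
qed

lemma normalise_g0': "\<forall>n\<in>N. inv g\<^sub>0 \<otimes> n \<otimes> g\<^sub>0 \<in> N"
  using C_W'[OF g0] K_N by (simp add: conj_eq subset_iff N_G)

lemmas W_ext = cyclic_extension[OF fin N g0_G normalise_g0' d0 g0_pow]

lemma W_eq: "W = {g\<^sub>0 [^] (k::nat) \<otimes> n | k n. n \<in> N}"
proof (rule card_subset_eq[symmetric, OF fin_W])
  show "{g\<^sub>0 [^] (k::nat) \<otimes> n | k n. n \<in> N} \<subseteq> W" using W_pow[OF g0] N_W by blast
  show "card {g\<^sub>0 [^] (k::nat) \<otimes> n | k n. n \<in> N} = card W" using W_ext(3) card_N card_W by simp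
qed

lemma W_bij: "bij_betw (\<lambda>(k::nat, n). g\<^sub>0 [^] k \<otimes> n) ({..<d} \<times> N) W"
  using W_ext(2) W_eq by simp

lemma W_A: "W \<subseteq> A"
  unfolding W_eq A_def using N_M by blast

lemma Z_A: "Z \<subseteq> A" using Z_W W_A by blast

text \<open>The linear character of \<open>A\<close> with kernel \<open>M\<close> that sends
  \<open>g\<^sub>0\<close> to \<open>\<zeta>\<close>. The chosen exponent is determined modulo
  \<open>d\<close> only, which is harmless as \<open>\<zeta> ^ d = 1\<close>. The value 0 outside
  \<open>A\<close> is the convention of \<open>induced_representation\<close>.\<close>

definition \<mu> :: "'a \<Rightarrow> complex" where
  "\<mu> x = (if x \<in> A then \<zeta> ^ (SOME k. \<exists>m\<in>M. x = g\<^sub>0 [^] k \<otimes> m) else 0)"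

lemma \<mu>_eq:
  assumes m: "m \<in> M"
  shows "\<mu> (g\<^sub>0 [^] (k::nat) \<otimes> m) = \<zeta> ^ k"
proof -
  have wd: "\<zeta> ^ k = \<zeta> ^ l" if "m \<in> M" "n \<in> M" "k \<le> l" "g\<^sub>0 [^] k \<otimes> m = g\<^sub>0 [^] l \<otimes> n" for k l :: nat and m n
  proof -
    have "g\<^sub>0 [^] l = g\<^sub>0 [^] k \<otimes> g\<^sub>0 [^] (l - k)" using that by (simp add: nat_pow_mult)
    then have "g\<^sub>0 [^] k \<otimes> m = g\<^sub>0 [^] k \<otimes> (g\<^sub>0 [^] (l - k) \<otimes> n)" using that by (simp add: m_assoc)
    then have "m = g\<^sub>0 [^] (l - k) \<otimes> n" using that by (simp add: m_assoc)
    then have "g\<^sub>0 [^] (l - k) = m \<otimes> inv n" using that by (simp add: m_assoc)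
    then have "d dvd l - k" using that by (simp flip: g0_pow_M)
    then have "\<zeta> ^ (l - k) = 1" by (simp add: \<zeta>_pow)
    moreover have "\<zeta> ^ l = \<zeta> ^ k * \<zeta> ^ (l - k)" using that by (simp flip: power_add)
    ultimately show ?thesis by simp
  qed
  define x where "x = g\<^sub>0 [^] k \<otimes> m"
  have "\<exists>k::nat. \<exists>m\<in>M. x = g\<^sub>0 [^] k \<otimes> m" using m x_def by blast
  then have "\<exists>m\<in>M. x = g\<^sub>0 [^] (SOME k::nat. \<exists>m\<in>M. x = g\<^sub>0 [^] k \<otimes> m) \<otimes> m" by (rule someI_ex)
  then obtain n where n: "n \<in> M" "x = g\<^sub>0 [^] (SOME k::nat. \<exists>m\<in>M. x = g\<^sub>0 [^] k \<otimes> m) \<otimes> n" by blast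
  have "\<zeta> ^ k = \<zeta> ^ (SOME k::nat. \<exists>m\<in>M. x = g\<^sub>0 [^] k \<otimes> m)"
  proof -
    define s where "s = (SOME k::nat. \<exists>m\<in>M. x = g\<^sub>0 [^] k \<otimes> m)"
    have "x = g\<^sub>0 [^] s \<otimes> n" unfolding s_def by (rule n(2))
    then have eq: "g\<^sub>0 [^] k \<otimes> m = g\<^sub>0 [^] s \<otimes> n" unfolding x_def .
    have "\<zeta> ^ k = \<zeta> ^ s"
    proof (cases "k \<le> s")
      case True
      then show ?thesis using wd[OF m n(1) _ eq] by blast
    next
      case False
      then have "s \<le> k" by simp
      then show ?thesis using wd[OF n(1) m _ eq[symmetric]] by simp
    qed
    then show ?thesis unfolding s_def .
  qed
  moreover have "x \<in> A" using m by (auto simp: A_def x_def)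
  ultimately show ?thesis unfolding x_def[symmetric] by (simp add: \<mu>_def)
qed

lemma A_E: assumes "x \<in> A" obtains k :: nat and m where "x = g\<^sub>0 [^] k \<otimes> m" "m \<in> M"
  using assms by (auto simp: A_def)

lemma \<mu>_mult:
  assumes "x \<in> A" "y \<in> A"
  shows "\<mu> (x \<otimes> y) = \<mu> x * \<mu> y"
proof -
  obtain k :: nat and m where km: "x = g\<^sub>0 [^] k \<otimes> m" "m \<in> M" using assms A_E by blast
  obtain l :: nat and n where ln: "y = g\<^sub>0 [^] l \<otimes> n" "n \<in> M" using assms A_E by blast
  obtain m' where m': "m' \<in> M" "m \<otimes> g\<^sub>0 [^] l = g\<^sub>0 [^] l \<otimes> m'" using A_ext(4)[OF km(2)] by blast
  have "x \<otimes> y = g\<^sub>0 [^] k \<otimes> (m \<otimes> g\<^sub>0 [^] l) \<otimes> n" using km ln by (simp add: m_assoc)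
  also have "\<dots> = g\<^sub>0 [^] (k + l) \<otimes> (m' \<otimes> n)"
    unfolding m'(2) using m'(1) km ln by (simp add: m_assoc nat_pow_mult[symmetric])
  finally show ?thesis using km ln m' by (simp add: \<mu>_eq power_add)
qed

lemma \<mu>_M: "m \<in> M \<Longrightarrow> \<mu> m = 1"
  using \<mu>_eq[of m 0] by simp

lemma \<mu>_1_iff: assumes "x \<in> A" shows "\<mu> x = 1 \<longleftrightarrow> x \<in> M"
proof
  assume 1: "\<mu> x = 1"
  obtain k :: nat and m where km: "x = g\<^sub>0 [^] k \<otimes> m" "m \<in> M" using assms A_E by blast
  then have "d dvd k" using 1 by (simp add: \<mu>_eq \<zeta>_pow)
  then show "x \<in> M" using km g0_pow_M by blast
qed (rule \<mu>_M)

lemma \<mu>_pow: "x \<in> A \<Longrightarrow> \<mu> (x [^] (n::nat)) = \<mu> x ^ n"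
proof (induction n)
  case (Suc n)
  have "x [^] n \<in> A" using Suc.prems by (induction n) auto
  then show ?case using Suc by (simp add: \<mu>_mult)
qed (simp add: \<mu>_M)

lemma A_pow: "x \<in> A \<Longrightarrow> x [^] (n::nat) \<in> A"
  by (induction n) auto

lemma \<mu>_rat_adjoin: "\<mu> x \<in> rat_adjoin \<zeta>"
  by (simp add: \<mu>_def rat_adjoin_power rat_adjoin_closed)

text \<open>\<open>W\<close> is central modulo \<open>K\<close> and \<open>v\<close> commutes with
  itself, so the generators of \<open>A\<close> commute modulo \<open>K\<close>.\<close>

lemma C_A_A: assumes "x \<in> A" "y \<in> A" shows "C x y \<in> K"
proof -
  have v_A: "C v a \<in> K" if a: "a \<in> A" for a
  proof -
    obtain k :: nat and m where km: "a = g\<^sub>0 [^] k \<otimes> m" "m \<in> M" using A_E[OF a] .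
    obtain l :: nat and n where ln: "m = v [^] l \<otimes> n" "n \<in> N" using km by (auto simp: M_def)
    have "C v a = C v (g\<^sub>0 [^] k) \<otimes> (C v v [^] l \<otimes> C v n)"
      using km ln N_G by (simp add: C_mult_right C_pow_right)
    also have "\<dots> \<in> K"
      using C_W'[OF W_pow[OF g0, of k]] C_W'[of n v] N_W ln by (simp add: C_one subset_iff)
    finally show ?thesis .
  qed
  obtain k :: nat and m where km: "x = g\<^sub>0 [^] k \<otimes> m" "m \<in> M" using assms A_E by blast
  obtain l :: nat and n where ln: "m = v [^] l \<otimes> n" "n \<in> N" using km by (auto simp: M_def)
  have K_pow: "z [^] i \<in> K" if "z \<in> K" for z and i :: nat using that by (induction i) auto
  have "C x y = C (g\<^sub>0 [^] k) y \<otimes> (C v y [^] l \<otimes> C n y)"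
    using km ln assms N_G by (simp add: C_mult_left C_pow_left)
  also have "\<dots> \<in> K"
    using C_W[OF W_pow[OF g0, of k]] C_W[of n y] N_W ln assms K_pow[OF v_A] by (simp add: subset_iff)
  finally show ?thesis .
qed

section \<open>The representation induced from \<open>A\<close> to \<open>G\<close>\<close>

lemma exists_outside_A: "\<exists>u. u \<in> carrier G - A"
proof (rule ccontr)
  assume "\<not> ?thesis"
  then have "carrier G = A" using A.subset by blast
  then have "p ^ 5 = p ^ 4" using card_A order by (simp add: Coset.order_def)
  then show False using p1 by simp
qed

definition "u = (SOME u. u \<in> carrier G - A)"

lemma u_G [simp]: "u \<in> carrier G" and u_A: "u \<notin> A"
  using someI_ex[OF exists_outside_A] by (simp_all add: u_def)

lemma u_pow: "u [^] (k::nat) \<in> A \<longleftrightarrow> p dvd k"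
  using pow_mem_iff_dvd[OF prime A_ext(1) u_G u_A] pow_in_centre[OF u_G] Z_A by blast

lemma normalise_u: "\<forall>a\<in>A. inv u \<otimes> a \<otimes> u \<in> A"
  using C_Z[of _ u] Z_A by (simp add: conj_eq subset_iff)

lemmas G_ext = cyclic_extension[OF fin A_ext(1) u_G normalise_u p0 u_pow]

lemma carrier_eq: "carrier G = {u [^] (k::nat) \<otimes> a | k a. a \<in> A}"
proof (rule card_subset_eq[symmetric, OF fin])
  show "card {u [^] (k::nat) \<otimes> a | k a. a \<in> A} = card (carrier G)"
    using G_ext(3) card_A order by (simp add: Coset.order_def power_Suc[symmetric] del: power_Suc)
qed auto

lemma transversal:
  assumes g: "g \<in> carrier G"
  shows "\<exists>!i. i < p \<and> inv (u [^] i) \<otimes> g \<in> A"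
proof -
  have bij: "bij_betw (\<lambda>(k::nat, a). u [^] k \<otimes> a) ({..<p} \<times> A) (carrier G)" using G_ext(2) carrier_eq by simp
  then have "g \<in> (\<lambda>(k::nat, a). u [^] k \<otimes> a) ` ({..<p} \<times> A)" using g by (simp add: bij_betw_def)
  then obtain k a where ka: "k < p" "a \<in> A" "g = u [^] k \<otimes> a" by auto
  show ?thesis
  proof (rule ex1I[of _ k])
    show "k < p \<and> inv (u [^] k) \<otimes> g \<in> A" using ka by (simp add: cancel_left)
    fix i assume i: "i < p \<and> inv (u [^] i) \<otimes> g \<in> A"
    have "(\<lambda>(k::nat, a). u [^] k \<otimes> a) (i, inv (u [^] i) \<otimes> g) = (\<lambda>(k::nat, a). u [^] k \<otimes> a) (k, a)"
      using g ka by (simp add: cancel_left)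
    then have "(i, inv (u [^] i) \<otimes> g) = (k, a)" 
      using i ka by (intro inj_onD[OF bij_betw_imp_inj_on[OF bij]]) auto
    then show "i = k" by simp
  qed
qed

lemma transversal_unique:
  assumes "i < p" "j < p" "inv (u [^] i) \<otimes> u [^] j \<in> A"
  shows "i = j"
proof -
  have "inv (u [^] j) \<otimes> u [^] j \<in> A" by simp
  moreover have "u [^] j \<in> carrier G" by simp
  ultimately show ?thesis using transversal assms by blast
qed

text \<open>The matrix coefficients of the representation induced from the linear character \<open>\<mu>\<close> of \<open>A\<close>,
  with respect to the transversal \<open>1, u, \<dots>, u\<^sup>p\<^sup>-\<^sup>1\<close>.\<close>

definition "R g i j = \<mu> (inv (u [^] i) \<otimes> g \<otimes> u [^] j)" for g and i j :: nat

lemma \<mu>_zero: "x \<notin> A \<Longrightarrow> \<mu> x = 0" by (simp add: \<mu>_def)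

lemma R_mult: "x \<in> carrier G \<Longrightarrow> y \<in> carrier G \<Longrightarrow> i < p \<Longrightarrow> k < p \<Longrightarrow>
    R (x \<otimes> y) i k = (\<Sum>j<p. R x i j * R y j k)"
  and R_one: "i < p \<Longrightarrow> j < p \<Longrightarrow> R \<one> i j = of_bool (i = j)"
  using induced_representation[OF A_ext(1) \<mu>_mult \<mu>_zero \<mu>_M[OF M.one_closed], of p "\<lambda>i. u [^] i"] transversal
  unfolding R_def by auto

lemma R_rat_adjoin: "R g i j \<in> rat_adjoin \<zeta>" by (simp add: R_def \<mu>_rat_adjoin)

text \<open>On \<open>A\<close> the induced representation is the diagonal sum of the conjugates of
  \<open>\<mu>\<close>: conjugation by \<open>u [^] i\<close> multiplies \<open>a\<close> by the
  central element \<open>C a u [^] i\<close>. Off the diagonal, \<open>A\<close> does not link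
  different representatives.\<close>

lemma R_A:
  assumes a: "a \<in> A" and ij: "i < p" "j < p"
  shows "R a i j = of_bool (i = j) * (\<mu> a * \<mu> (C a u) ^ i)"
proof -
  have aG [simp]: "a \<in> carrier G" using a by simp
  have Cu: "C a u \<in> A" using C_Z Z_A by auto
  have conj: "inv (u [^] i) \<otimes> a \<otimes> u [^] i = a \<otimes> C a u [^] i"
    using conj_eq[of a "u [^] i"] by (simp add: C_pow_right)
  have Cu_pow: "C a u [^] i \<in> A" using Cu by (induction i) auto
  show ?thesis
  proof (cases "i = j")
    case True
    then show ?thesis using conj a Cu Cu_pow by (simp add: R_def \<mu>_mult \<mu>_pow)
  next
    case False
    have "inv (u [^] i) \<otimes> a \<otimes> u [^] j = (inv (u [^] i) \<otimes> a \<otimes> u [^] i) \<otimes> (inv (u [^] i) \<otimes> u [^] j)"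
      by (simp add: group_simps)
    also have "\<dots> = a \<otimes> C a u [^] i \<otimes> (inv (u [^] i) \<otimes> u [^] j)" unfolding conj ..
    finally have eq: "inv (u [^] i) \<otimes> a \<otimes> u [^] j = a \<otimes> C a u [^] i \<otimes> (inv (u [^] i) \<otimes> u [^] j)" .
    have "inv (u [^] i) \<otimes> a \<otimes> u [^] j \<notin> A"
    proof
      assume "inv (u [^] i) \<otimes> a \<otimes> u [^] j \<in> A"
      then have "inv (a \<otimes> C a u [^] i) \<otimes> (a \<otimes> C a u [^] i \<otimes> (inv (u [^] i) \<otimes> u [^] j)) \<in> A"
        unfolding eq using a Cu_pow by blast
      moreover have "inv (a \<otimes> C a u [^] i) \<otimes> (a \<otimes> C a u [^] i \<otimes> (inv (u [^] i) \<otimes> u [^] j)) = inv (u [^] i) \<otimes> u [^] j"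
        by (rule cancel_left) auto
      ultimately have "inv (u [^] i) \<otimes> u [^] j \<in> A" by simp
      then show False using transversal_unique ij False by blast
    qed
    then show ?thesis using False by (simp add: R_def \<mu>_zero)
  qed
qed

text \<open>Commutators of \<open>x\<close> with \<open>A\<close> lie in \<open>K\<close> already,
  and \<open>A\<close> and \<open>u\<close> generate \<open>G\<close>; so \<open>u\<close> alone
  decides whether \<open>x\<close> is central modulo \<open>K\<close>. For central elements, lying
  in \<open>M\<close> and lying in \<open>K\<close> are the same.\<close>

lemma C_u_M_iff: assumes x: "x \<in> A" shows "C x u \<in> M \<longleftrightarrow> x \<in> W"
proof
  assume "C x u \<in> M"
  then have "C x u \<in> M \<inter> W \<inter> Z" using C_Z[of x u] x Z_W by auto
  then have xu: "C x u \<in> K" using M_W N_Z by simp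
  have "C x h \<in> K" if "h \<in> carrier G" for h
  proof -
    have "h \<in> {u [^] (k::nat) \<otimes> a | k a. a \<in> A}" using that carrier_eq by simp
    then obtain k :: nat and a where h: "h = u [^] k \<otimes> a" "a \<in> A" by blast
    have "C x u [^] k \<in> K" using xu by (induction k) auto
    then show ?thesis using h x C_A_A[OF x h(2)] by (simp add: C_mult_right C_pow_right)
  qed
  then show "x \<in> W" using x by (intro W_I) auto
next
  assume "x \<in> W"
  then show "C x u \<in> M" using C_W[of x u] K_N N_M by auto
qed

lemma R_W: "w \<in> W \<Longrightarrow> i < p \<Longrightarrow> j < p \<Longrightarrow> R w i j = of_bool (i = j) * \<mu> w"
  using R_A[of w i j] C_u_M_iff[of w] W_A by (auto simp: \<mu>_M)

lemma sum_C_u: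
  assumes x: "x \<in> A" "x \<notin> W"
  shows "(\<Sum>i<p. \<mu> (C x u) ^ i) = 0"
proof (rule sum_powers_root_of_unity)
  have Cu: "C x u \<in> Z" using C_Z x by simp
  then have "\<mu> (C x u) ^ p = \<mu> (C x u [^] p)" using Z_A by (simp add: \<mu>_pow subset_iff)
  then show "\<mu> (C x u) ^ p = 1" using pow_centre[OF Cu] by (simp add: \<mu>_M)
  show "\<mu> (C x u) \<noteq> 1" using \<mu>_1_iff[of "C x u"] Cu Z_A C_u_M_iff x by blast
qed

text \<open>Two different reasons. On \<open>A\<close> outside \<open>W\<close> the diagonal entries
  are \<open>\<mu> x\<close> times the powers of a nontrivial \<open>p\<close>-th root of unity.
  Outside \<open>A\<close> the diagonal is zero, because conjugation changes \<open>x\<close> only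
  by a central factor, which lies in \<open>A\<close>.\<close>

lemma trace_R: assumes "x \<in> carrier G" "x \<notin> W" shows "(\<Sum>i<p. R x i i) = 0"
proof (cases "x \<in> A")
  case True
  then have "(\<Sum>i<p. R x i i) = (\<Sum>i<p. \<mu> x * \<mu> (C x u) ^ i)" by (intro sum.cong) (auto simp: R_A)
  also have "\<dots> = \<mu> x * (\<Sum>i<p. \<mu> (C x u) ^ i)" by (simp add: sum_distrib_left)
  finally show ?thesis using sum_C_u True assms by simp
next
  case False
  have "R x i i = 0" for i
  proof -
    have eq: "inv (u [^] i) \<otimes> x \<otimes> u [^] i = x \<otimes> C x (u [^] i)" using assms by (simp add: conj_eq)
    have CA: "C x (u [^] i) \<in> A" using C_Z assms Z_A by auto
    have "x \<otimes> C x (u [^] i) \<notin> A"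
    proof
      assume "x \<otimes> C x (u [^] i) \<in> A"
      then have "x \<otimes> C x (u [^] i) \<otimes> inv (C x (u [^] i)) \<in> A" using CA by blast
      then show False using False assms by (simp add: m_assoc)
    qed
    then show ?thesis by (simp add: R_def eq \<mu>_zero)
  qed
  then show ?thesis by simp
qed

text \<open>\<open>v\<close> acts diagonally by the powers of a primitive \<open>p\<close>-th root
  of unity \<open>\<omega>\<close>, so the sum of its powers is \<open>p\<close> times the
  projection to basis vector 0. The factors \<open>u [^] i\<close> and \<open>inv (u [^] j)\<close>
  move this to position \<open>(i, j)\<close>.\<close>

lemma matrix_unit:
  assumes ij: "i < p" "j < p" and ab: "a < p" "b < p"
  shows "(\<Sum>l<p. R (u [^] i \<otimes> v [^] l \<otimes> inv (u [^] j)) a b) = of_nat p * of_bool (a = i \<and> b = j)"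
proof -
  have vA: "v \<in> A" and vlA: "v [^] (l::nat) \<in> A" for l
  proof -
    show "v \<in> A" using v_M M_A by blast
    then show "v [^] (l::nat) \<in> A" for l by (induction l) auto
  qed
  have vlM: "v [^] (l::nat) \<in> M" for l using v_M by (induction l) auto
  define \<omega> where "\<omega> = \<mu> (C v u)"
  have \<omega>p: "\<omega> ^ p = 1"
  proof -
    have Cu: "C v u \<in> Z" using C_Z by simp
    then have "\<omega> ^ p = \<mu> (C v u [^] p)" using Z_A by (simp add: \<omega>_def \<mu>_pow subset_iff)
    then show ?thesis using pow_centre[OF Cu] by (simp add: \<mu>_M)
  qed
  \<comment> \<open>\<open>C v u\<close> is outside \<open>M\<close> because \<open>v\<close> is
    outside \<open>W\<close>, and its \<open>p\<close>-th power is trivial; so its order modulo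
    \<open>M\<close> is exactly \<open>p\<close>.\<close>
  have \<omega>1: "\<omega> ^ c \<noteq> 1" if "0 < c" "c < p" for c
  proof
    assume "\<omega> ^ c = 1"
    moreover have CuA: "C v u \<in> A" using C_Z Z_A by auto
    ultimately have "C v u [^] c \<in> M" using \<mu>_1_iff[OF A_pow[OF CuA], of c] CuA by (simp add: \<omega>_def \<mu>_pow)
    moreover have "C v u \<notin> M" using C_u_M_iff[OF vA] v by simp
    moreover have "C v u [^] p \<in> M" using pow_centre[of "C v u"] C_Z by simp
    ultimately have "p dvd c" using pow_mem_iff_dvd[OF prime M_ext(1), of "C v u" c] by simp
    then show False using that by (auto dest: dvd_imp_le)
  qed
  have Rv: "R (v [^] l) c e = of_bool (c = e) * \<omega> ^ (l * c)" if "c < p" "e < p" for l c e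
  proof -
    have "\<mu> (C (v [^] l) u) = \<omega> ^ l"
      using C_Z Z_A by (simp add: C_pow_left \<omega>_def \<mu>_pow subset_iff)
    then show ?thesis using that R_A[OF vlA, of c e l] vlM by (simp add: \<mu>_M power_mult)
  qed
  have sum_v: "(\<Sum>l<p. R (v [^] l) c e) = of_bool (c = 0 \<and> e = 0) * of_nat p" if "c < p" "e < p" for c e
  proof -
    have "(\<Sum>l<p. R (v [^] l) c e) = of_bool (c = e) * (\<Sum>l<p. (\<omega> ^ c) ^ l)"
      using that by (simp add: Rv sum_distrib_left power_mult[symmetric] mult.commute)
    moreover have "(\<Sum>l<p. (\<omega> ^ c) ^ l) = (if c = 0 then of_nat p else 0)"
    proof (cases "c = 0")
      case False
      have "(\<omega> ^ c) ^ p = 1" using \<omega>p by (metis mult.commute power_mult power_one)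
      then show ?thesis using sum_powers_root_of_unity[of "\<omega> ^ c" p] \<omega>1[of c] that False by simp
    qed simp
    ultimately show ?thesis by auto
  qed
  \<comment> \<open>The projection leaves row 0 of \<open>inv (u [^] j)\<close> and column 0 of
    \<open>u [^] i\<close>. There the exponents of \<open>u\<close> differ by less than
    \<open>p\<close>, so the entries are 0 or 1.\<close>
  have R_inv: "R (inv (u [^] j)) 0 b = of_bool (b = j)" 
  proof -
    have "inv (u [^] j) \<otimes> u [^] b \<in> A \<longleftrightarrow> b = j"
    proof
      assume "inv (u [^] j) \<otimes> u [^] b \<in> A"
      then show "b = j" using transversal_unique ij ab by blast
    qed simp
    then show ?thesis by (cases "b = j") (simp_all add: R_def \<mu>_M \<mu>_zero)
  qed
  have R_u: "R (u [^] i) a 0 = of_bool (a = i)"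
  proof -
    have "inv (u [^] a) \<otimes> u [^] i \<in> A \<longleftrightarrow> a = i"
    proof
      assume "inv (u [^] a) \<otimes> u [^] i \<in> A"
      then show "a = i" using transversal_unique ij ab by blast
    qed simp
    then show ?thesis by (cases "a = i") (simp_all add: R_def \<mu>_M \<mu>_zero)
  qed
  have "(\<Sum>l<p. R (u [^] i \<otimes> v [^] l \<otimes> inv (u [^] j)) a b)
      = (\<Sum>l<p. \<Sum>e<p. \<Sum>c<p. R (u [^] i) a c * R (v [^] l) c e * R (inv (u [^] j)) e b)"
    using ab by (intro sum.cong refl) (simp add: R_mult sum_distrib_right)
  also have "\<dots> = (\<Sum>e<p. \<Sum>l<p. \<Sum>c<p. R (u [^] i) a c * R (v [^] l) c e * R (inv (u [^] j)) e b)"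
    by (rule sum.swap)
  also have "\<dots> = (\<Sum>e<p. \<Sum>c<p. \<Sum>l<p. R (u [^] i) a c * R (v [^] l) c e * R (inv (u [^] j)) e b)"
    by (intro sum.cong refl sum.swap)
  also have "\<dots> = (\<Sum>e<p. \<Sum>c<p. R (u [^] i) a c * (of_bool (c = 0 \<and> e = 0) * of_nat p) * R (inv (u [^] j)) e b)"
    by (intro sum.cong refl) (simp add: sum_v[symmetric] sum_distrib_left sum_distrib_right)
  also have "\<dots> = (\<Sum>e<p. R (u [^] i) a 0 * (of_bool (e = 0) * of_nat p) * R (inv (u [^] j)) e b)"
    by (intro sum.cong refl) (subst sum_lessThan_first[OF p0]; simp)
  also have "\<dots> = R (u [^] i) a 0 * of_nat p * R (inv (u [^] j)) 0 b" by (subst sum_lessThan_first[OF p0]) simp_all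
  finally show ?thesis by (simp add: R_u R_inv)
qed

end

text \<open>The interface of a component to the final assembly, free of the auxiliary
  \<open>u\<close>, \<open>v\<close> and \<open>g\<^sub>0\<close>. The fourth clause is surjectivity
  onto the matrices over \<open>\<rat>(z)\<close>. The fifth controls the kernel, for elements with
  zero image in the algebra of the quotient by the centre. The last describes the scalars by which
  elements of \<open>W\<close> outside \<open>N\<close> act.\<close>

definition component_rep ::
    "('a, 'b) monoid_scheme \<Rightarrow> nat \<Rightarrow> 'a set \<Rightarrow> complex \<Rightarrow> 'a set \<Rightarrow> ('a \<Rightarrow> nat \<Rightarrow> nat \<Rightarrow> complex) \<Rightarrow> bool" where
  "component_rep G p K z N R \<longleftrightarrow>
     (\<forall>x\<in>carrier G. \<forall>y\<in>carrier G. \<forall>i<p. \<forall>k<p. R (x \<otimes>\<^bsub>G\<^esub> y) i k = (\<Sum>j<p. R x i j * R y j k)) \<and>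
     (\<forall>i<p. \<forall>j<p. R \<one>\<^bsub>G\<^esub> i j = of_bool (i = j)) \<and>
     (\<forall>x\<in>carrier G. \<forall>i<p. \<forall>j<p. R x i j \<in> rat_adjoin z) \<and>
     (\<forall>B. (\<forall>i<p. \<forall>j<p. B i j \<in> rat_adjoin z) \<longrightarrow>
        (\<exists>f::'a \<Rightarrow> rat. \<forall>i<p. \<forall>j<p. (\<Sum>x\<in>carrier G. of_rat (f x) * R x i j) = B i j)) \<and>
     (\<forall>f::'a \<Rightarrow> rat. (\<forall>i<p. \<forall>j<p. (\<Sum>x\<in>carrier G. of_rat (f x) * R x i j) = 0) \<longrightarrow>
        (\<forall>x\<in>carrier G. (\<Sum>z\<in>centre G. f (z \<otimes>\<^bsub>G\<^esub> x)) = 0) \<longrightarrow>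
        (\<forall>x\<in>carrier G. (\<Sum>n\<in>N. f (n \<otimes>\<^bsub>G\<^esub> x)) = 0)) \<and>
     (\<forall>n\<in>N. \<forall>i<p. \<forall>j<p. R n i j = of_bool (i = j)) \<and>
     (\<forall>w\<in>carrier G. (\<forall>x\<in>carrier G. commutator G w x \<in> K) \<longrightarrow> w \<notin> N \<longrightarrow>
        (\<exists>c. c \<noteq> 1 \<and> (\<forall>i<p. \<forall>j<p. R w i j = of_bool (i = j) * c)))"

lemma component_repD:
  assumes "component_rep G p K z N R"
  shows "\<forall>x\<in>carrier G. \<forall>y\<in>carrier G. \<forall>i<p. \<forall>k<p. R (x \<otimes>\<^bsub>G\<^esub> y) i k = (\<Sum>j<p. R x i j * R y j k)"
    and "\<forall>i<p. \<forall>j<p. R \<one>\<^bsub>G\<^esub> i j = of_bool (i = j)"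
    and "\<forall>x\<in>carrier G. \<forall>i<p. \<forall>j<p. R x i j \<in> rat_adjoin z"
    and "\<forall>B. (\<forall>i<p. \<forall>j<p. B i j \<in> rat_adjoin z) \<longrightarrow>
        (\<exists>f::'a \<Rightarrow> rat. \<forall>i<p. \<forall>j<p. (\<Sum>x\<in>carrier G. of_rat (f x) * R x i j) = B i j)"
    and "\<forall>f::'a \<Rightarrow> rat. (\<forall>i<p. \<forall>j<p. (\<Sum>x\<in>carrier G. of_rat (f x) * R x i j) = 0) \<longrightarrow>
        (\<forall>x\<in>carrier G. (\<Sum>z\<in>centre G. f (z \<otimes>\<^bsub>G\<^esub> x)) = 0) \<longrightarrow>
        (\<forall>x\<in>carrier G. (\<Sum>n\<in>N. f (n \<otimes>\<^bsub>G\<^esub> x)) = 0)"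
    and "\<forall>n\<in>N. \<forall>i<p. \<forall>j<p. R n i j = of_bool (i = j)"
    and "\<forall>w\<in>carrier G. (\<forall>x\<in>carrier G. commutator G w x \<in> K) \<longrightarrow> w \<notin> N \<longrightarrow>
        (\<exists>c. c \<noteq> 1 \<and> (\<forall>i<p. \<forall>j<p. R w i j = of_bool (i = j) * c))"
  using assms unfolding component_rep_def by - (elim conjE, assumption)+

text \<open>Evaluates a linear map on the combination of the group elements \<open>h x\<close> with
  weights \<open>w x\<close>, written as a coefficient function; repetitions among the
  \<open>h x\<close> are added up.\<close>

lemma sum_point_masses:
  fixes F :: "'a \<Rightarrow> complex" and w :: "'i \<Rightarrow> rat"
  assumes "finite A" "finite I" "\<And>x. x \<in> I \<Longrightarrow> h x \<in> A"
  shows "(\<Sum>g\<in>A. of_rat (\<Sum>x\<in>I. w x * of_bool (g = h x)) * F g) = (\<Sum>x\<in>I. of_rat (w x) * F (h x))"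
proof -
  have "(\<Sum>g\<in>A. of_rat (\<Sum>x\<in>I. w x * of_bool (g = h x)) * F g)
      = (\<Sum>g\<in>A. \<Sum>x\<in>I. of_rat (w x) * (of_bool (g = h x) * F g))"
    by (intro sum.cong refl) (simp add: of_rat_sum of_rat_mult sum_distrib_right of_bool_def if_distrib[of of_rat] mult.assoc cong: if_cong)
  also have "\<dots> = (\<Sum>x\<in>I. of_rat (w x) * (\<Sum>g\<in>A. of_bool (g = h x) * F g))"
    by (subst sum.swap) (simp add: sum_distrib_left)
  also have "\<dots> = (\<Sum>x\<in>I. of_rat (w x) * F (h x))"
  proof (intro sum.cong refl)
    fix x assume "x \<in> I"
    then have "h x \<in> A" using assms by blast
    have "(\<Sum>g\<in>A. of_bool (g = h x) * F g) = (\<Sum>g\<in>A. if h x = g then F (h x) else 0)"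
      by (intro sum.cong) auto
    also have "\<dots> = F (h x)" using assms(1) \<open>h x \<in> A\<close> by (simp add: sum.delta')
    finally show "of_rat (w x) * (\<Sum>g\<in>A. of_bool (g = h x) * F g) = of_rat (w x) * F (h x)" by simp
  qed
  finally show ?thesis .
qed

lemma (in group) sum_translate_right:
  assumes "a \<in> carrier G"
  shows "(\<Sum>x\<in>carrier G. F x) = (\<Sum>x\<in>carrier G. F (x \<otimes> a))"
  by (rule sum.reindex_bij_witness[of _ "\<lambda>x. x \<otimes> a" "\<lambda>x. x \<otimes> inv a"]) (use assms in \<open>auto simp: m_assoc\<close>)

lemma (in group) sum_translate_subgroup:
  assumes "subgroup N G" "a \<in> N"
  shows "(\<Sum>n\<in>N. F (a \<otimes> n)) = (\<Sum>n\<in>N. F n)"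
proof -
  interpret N: subgroup N G by fact
  show ?thesis
    by (rule sum.reindex_bij_witness[of _ "\<lambda>n. inv a \<otimes> n" "\<lambda>n. a \<otimes> n"]) (use assms in \<open>auto simp: cancel_left\<close>)
qed

section \<open>Image and kernel of a component on the rational group algebra\<close>

context phi4_component
begin

lemma R_W_mult:
  assumes w: "w \<in> W" and y: "y \<in> carrier G" and ab: "a < p" "b < p"
  shows "R (w \<otimes> y) a b = \<mu> w * R y a b"
proof -
  have "R (w \<otimes> y) a b = (\<Sum>c<p. R w a c * R y c b)" using R_mult w y ab W_G by blast
  also have "\<dots> = (\<Sum>c<p. if a = c then \<mu> w * R y c b else 0)"
    using w ab by (intro sum.cong refl) (simp add: R_W)
  also have "\<dots> = \<mu> w * R y a b" using ab by (simp add: sum.delta')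
  finally show ?thesis .
qed

lemma \<mu>_g0: "n \<in> N \<Longrightarrow> \<mu> (g\<^sub>0 [^] (k::nat) \<otimes> n) = \<zeta> ^ k"
  using \<mu>_eq N_M by blast

text \<open>An entry \<open>B i j\<close> is a rational combination of the
  \<open>\<zeta> ^ k\<close>, the scalars by which the \<open>g\<^sub>0 [^] k\<close> act, and
  \<open>matrix_unit\<close> puts it at position \<open>(i, j)\<close>.\<close>

lemma R_surj:
  assumes B: "\<forall>i<p. \<forall>j<p. B i j \<in> rat_adjoin \<zeta>"
  shows "\<exists>f::'a \<Rightarrow> rat. \<forall>i<p. \<forall>j<p. (\<Sum>x\<in>carrier G. of_rat (f x) * R x i j) = B i j"
proof -
  define c where "c i j = (SOME c. B i j = (\<Sum>k<d. of_rat (c k) * \<zeta> ^ k))" for i j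
  have c: "B i j = (\<Sum>k<d. of_rat (c i j k) * \<zeta> ^ k)" if "i < p" "j < p" for i j
  proof -
    have "\<exists>c. B i j = (\<Sum>k<d. of_rat (c k) * \<zeta> ^ k)"
      by (rule rat_adjoin_root_of_unity[OF d0 \<zeta>_d]) (use B that in simp)
    then show ?thesis unfolding c_def by (rule someI_ex)
  qed
  \<comment> \<open>A quadruple \<open>(i, j, k, l)\<close> records the position, the power of
    \<open>\<zeta>\<close> and the summation index of \<open>matrix_unit\<close>, whose factor
    \<open>p\<close> is divided out in \<open>w\<close>.\<close>
  define I where "I = {..<p} \<times> {..<p} \<times> {..<d} \<times> {..<p}"
  define h where "h = (\<lambda>(i, j, k, l). g\<^sub>0 [^] (k::nat) \<otimes> (u [^] (i::nat) \<otimes> v [^] (l::nat) \<otimes> inv (u [^] (j::nat))))"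
  define w where "w = (\<lambda>(i, j, k, l::nat). c i j k / of_nat p)"
  define f where "f g = (\<Sum>x\<in>I. w x * of_bool (g = h x))" for g
  have "(\<Sum>x\<in>carrier G. of_rat (f x) * R x a b) = B a b" if ab: "a < p" "b < p" for a b
  proof -
    have Rh: "R (h (i, j, k, l)) a b = \<zeta> ^ k * R (u [^] i \<otimes> v [^] l \<otimes> inv (u [^] j)) a b" for i j k l
    proof -
      have "\<mu> (g\<^sub>0 [^] k) = \<zeta> ^ k" using \<mu>_g0[OF N.one_closed, of k] by simp
      then show ?thesis using R_W_mult[OF W_pow[OF g0, of k] _ ab] by (simp add: h_def)
    qed
    have "(\<Sum>x\<in>carrier G. of_rat (f x) * R x a b) = (\<Sum>x\<in>I. of_rat (w x) * R (h x) a b)"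
      unfolding f_def by (rule sum_point_masses[OF fin]) (auto simp: I_def h_def)
    also have "\<dots> = (\<Sum>(i, j, k, l)\<in>I. of_rat (c i j k / of_nat p) *
        (\<zeta> ^ k * R (u [^] i \<otimes> v [^] l \<otimes> inv (u [^] j)) a b))"
    proof (rule sum.cong[OF refl])
      fix x :: "nat \<times> nat \<times> nat \<times> nat"
      obtain i j k l where x: "x = (i, j, k, l)" by (cases x) auto
      show "of_rat (w x) * R (h x) a b = (case x of (i, j, k, l) \<Rightarrow> of_rat (c i j k / of_nat p) *
        (\<zeta> ^ k * R (u [^] i \<otimes> v [^] l \<otimes> inv (u [^] j)) a b))"
        unfolding x Rh by (simp add: w_def)
    qed
    also have "\<dots> = (\<Sum>i<p. \<Sum>j<p. \<Sum>k<d. \<Sum>l<p. of_rat (c i j k / of_nat p) *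
        (\<zeta> ^ k * R (u [^] i \<otimes> v [^] l \<otimes> inv (u [^] j)) a b))"
      unfolding I_def by (simp only: sum.cartesian_product)
    also have "\<dots> = (\<Sum>i<p. \<Sum>j<p. \<Sum>k<d. of_rat (c i j k / of_nat p) *
        (\<zeta> ^ k * (of_nat p * of_bool (a = i \<and> b = j))))"
      using ab by (intro sum.cong refl) (simp add: matrix_unit[symmetric] sum_distrib_left)
    also have "\<dots> = (\<Sum>i<p. \<Sum>j<p. if b = j then if a = i then B i j else 0 else 0)"
      using p0 by (intro sum.cong refl) (simp add: c of_rat_divide)
    also have "\<dots> = B a b" using ab by (simp add: sum.delta')
    finally show ?thesis .
  qed
  then show ?thesis by blast
qed

text \<open>Traces turn the vanishing matrix into one rational relation between powers of
  \<open>\<zeta>\<close>. It equates the sums over those translates of \<open>N\<close> whose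
  exponents agree modulo \<open>q\<close>, which are translates by the centre; and the total over
  the centre vanishes by assumption.\<close>

lemma R_inj:
  fixes f :: "'a \<Rightarrow> rat"
  assumes f: "\<forall>i<p. \<forall>j<p. (\<Sum>x\<in>carrier G. of_rat (f x) * R x i j) = 0"
    and Zf: "\<forall>x\<in>carrier G. (\<Sum>z\<in>Z. f (z \<otimes> x)) = 0" and g: "g \<in> carrier G"
  shows "(\<Sum>n\<in>N. f (n \<otimes> g)) = 0"
proof -
  define tr where "tr x = (\<Sum>i<p. R x i i)" for x
  \<comment> \<open>The trace of the image of \<open>f\<close> times the matrix of
    \<open>inv g\<close>, transformed until only \<open>W\<close> contributes.\<close>
  have "0 = (\<Sum>i<p. \<Sum>c<p. (\<Sum>x\<in>carrier G. of_rat (f x) * R x i c) * R (inv g) c i)"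
    using f by simp
  also have "\<dots> = (\<Sum>i<p. \<Sum>c<p. \<Sum>x\<in>carrier G. of_rat (f x) * (R x i c * R (inv g) c i))"
    by (simp add: sum_distrib_right mult.assoc)
  also have "\<dots> = (\<Sum>i<p. \<Sum>x\<in>carrier G. \<Sum>c<p. of_rat (f x) * (R x i c * R (inv g) c i))"
    by (intro sum.cong refl sum.swap)
  also have "\<dots> = (\<Sum>x\<in>carrier G. \<Sum>i<p. \<Sum>c<p. of_rat (f x) * (R x i c * R (inv g) c i))"
    by (rule sum.swap)
  also have "\<dots> = (\<Sum>x\<in>carrier G. of_rat (f x) * tr (x \<otimes> inv g))"
    using g by (intro sum.cong refl) (simp add: tr_def R_mult sum_distrib_left)
  also have "\<dots> = (\<Sum>x\<in>carrier G. of_rat (f (x \<otimes> g)) * tr x)"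
    using g by (subst sum_translate_right[OF g]) (simp add: m_assoc)
  also have "\<dots> = (\<Sum>x\<in>W. of_rat (f (x \<otimes> g)) * tr x)"
    using fin W.subset trace_R by (intro sum.mono_neutral_right) (auto simp: tr_def)
  also have "\<dots> = (\<Sum>x\<in>W. of_rat (f (x \<otimes> g)) * (of_nat p * \<mu> x))"
    by (intro sum.cong refl) (simp add: tr_def R_W)
  also have "\<dots> = of_nat p * (\<Sum>x\<in>W. of_rat (f (x \<otimes> g)) * \<mu> x)"
    by (simp add: sum_distrib_left ac_simps)
  finally have "(\<Sum>x\<in>W. of_rat (f (x \<otimes> g)) * \<mu> x) = 0" using p0 by simp
  also have "(\<Sum>x\<in>W. of_rat (f (x \<otimes> g)) * \<mu> x)
      = (\<Sum>(k, n)\<in>{..<d} \<times> N. of_rat (f (g\<^sub>0 [^] k \<otimes> n \<otimes> g)) * \<zeta> ^ k)"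
    by (subst sum.reindex_bij_betw[OF W_bij, symmetric]) (auto intro!: sum.cong simp: \<mu>_g0)
  finally have rel: "(\<Sum>k<d. of_rat (\<Sum>n\<in>N. f (g\<^sub>0 [^] k \<otimes> n \<otimes> g)) * \<zeta> ^ k) = 0"
    by (simp add: sum.cartesian_product' of_rat_sum sum_distrib_right)
  define S where "S z = (\<Sum>n\<in>N. f (z \<otimes> n \<otimes> g))" for z
  \<comment> \<open>The powers of \<open>g\<^sub>0\<close> with exponent divisible by
    \<open>q\<close> are the powers of \<open>z\<close>, and \<open>z\<close> generates the centre
    modulo \<open>K\<close>.\<close>
  define z where "z = g\<^sub>0 [^] q"
  have z: "z \<in> Z" "z \<in> carrier G" using g0_q by (simp_all add: z_def)
  have z_pow: "z [^] (k::nat) \<in> K \<longleftrightarrow> p dvd k" for k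
  proof -
    have "z [^] k \<in> Z" using z by (induction k) auto
    then have "z [^] k \<in> K \<longleftrightarrow> z [^] k \<in> N" using N_Z by blast
    also have "\<dots> \<longleftrightarrow> d dvd q * k" using g0_pow[of "q * k"] by (simp add: z_def nat_pow_pow)
    also have "\<dots> \<longleftrightarrow> p dvd k" using d0 by (simp add: mult.commute[of p])
    finally show ?thesis .
  qed
  have norm: "\<forall>k\<in>K. inv z \<otimes> k \<otimes> z \<in> K"
  proof
    fix k assume k: "k \<in> K"
    have "inv z \<otimes> k \<otimes> z = inv z \<otimes> (z \<otimes> k)" using Z_comm[OF z(1), of k] k z(2) by (simp add: m_assoc)
    then show "inv z \<otimes> k \<otimes> z \<in> K" using k z(2) by (simp add: cancel_left)
  qed
  note ext = cyclic_extension[OF fin K z(2) norm p0 z_pow]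
  have Z_eq: "{z [^] (k::nat) \<otimes> n | k n. n \<in> K} = Z"
  proof (rule card_subset_eq[OF fin_Z])
    have "z [^] (k::nat) \<in> Z" for k using z by (induction k) auto
    then show "{z [^] (k::nat) \<otimes> n | k n. n \<in> K} \<subseteq> Z" using K_Z by blast
    show "card {z [^] (k::nat) \<otimes> n | k n. n \<in> K} = card Z"
      using ext(3) card_K card_centre by (simp add: power2_eq_square)
  qed
  have S_K: "S (x \<otimes> k) = S x" if "x \<in> carrier G" "k \<in> K" for x k
  proof -
    have "k \<in> N" using that K_N by blast
    have "S (x \<otimes> k) = (\<Sum>n\<in>N. f (x \<otimes> (k \<otimes> n) \<otimes> g))"
      unfolding S_def using that by (intro sum.cong refl) (simp add: m_assoc N_G)
    also have "\<dots> = S x" unfolding S_def by (rule sum_translate_subgroup[OF N \<open>k \<in> N\<close>])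
    finally show ?thesis .
  qed
  have S_z: "S (z [^] i) = S \<one>" if "i < p" for i
  proof -
    have "S (z [^] i) = (\<Sum>n\<in>N. f (g\<^sub>0 [^] (i * q) \<otimes> n \<otimes> g))"
      by (simp add: S_def z_def nat_pow_pow mult.commute)
    also have "\<dots> = (\<Sum>n\<in>N. f (g\<^sub>0 [^] (0::nat) \<otimes> n \<otimes> g))"
      using that d0 by (intro root_of_unity_rat_relation[OF prime q \<zeta> rel]) auto
    finally show ?thesis by (simp add: S_def)
  qed
  have S_const: "S y = S \<one>" if "y \<in> Z" for y
  proof -
    have "y \<in> (\<lambda>(k::nat, n). z [^] k \<otimes> n) ` ({..<p} \<times> K)"
      using ext(2) that unfolding Z_eq bij_betw_def by blast
    then obtain i k where "y = z [^] i \<otimes> k" "i < p" "k \<in> K" by auto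
    then show ?thesis using S_K[of "z [^] i" k] S_z z by simp
  qed
  \<comment> \<open>\<open>S\<close> is constant on the centre, so its value times
    \<open>card Z\<close> is a sum over whole cosets of the centre.\<close>
  have "of_nat (card Z) * S \<one> = (\<Sum>y\<in>Z. S \<one>)" by simp
  also have "\<dots> = (\<Sum>y\<in>Z. S y)" by (intro sum.cong refl S_const[symmetric])
  also have "\<dots> = (\<Sum>n\<in>N. \<Sum>y\<in>Z. f (y \<otimes> (n \<otimes> g)))"
    unfolding S_def by (subst sum.swap) (intro sum.cong refl, use g in \<open>simp add: m_assoc N_G\<close>)
  also have "\<dots> = 0" using Zf g N_G by (intro sum.neutral) auto
  finally have "S \<one> = 0" using card_centre p0 by simp
  then show ?thesis by (simp add: S_def N_G cong: sum.cong)
qed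

lemma component_rep_R: "component_rep G p K \<zeta> N R"
  unfolding component_rep_def
proof (intro conjI)
  show "\<forall>x\<in>carrier G. \<forall>y\<in>carrier G. \<forall>i<p. \<forall>k<p. R (x \<otimes> y) i k = (\<Sum>j<p. R x i j * R y j k)"
    using R_mult by blast
  show "\<forall>n\<in>N. \<forall>i<p. \<forall>j<p. R n i j = of_bool (i = j)"
    using R_W N_W \<mu>_M N_M by (metis mult.right_neutral subsetD)
  show "\<forall>w\<in>carrier G. (\<forall>x\<in>carrier G. C w x \<in> K) \<longrightarrow> w \<notin> N \<longrightarrow>
        (\<exists>c. c \<noteq> 1 \<and> (\<forall>i<p. \<forall>j<p. R w i j = of_bool (i = j) * c))"
  proof (intro ballI impI)
    fix w assume "w \<in> carrier G" "\<forall>x\<in>carrier G. C w x \<in> K" "w \<notin> N"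
    then have w: "w \<in> W" by (intro W_I) auto
    then have "\<mu> w \<noteq> 1" using \<mu>_1_iff W_A M_W \<open>w \<notin> N\<close> by blast
    then show "\<exists>c. c \<noteq> 1 \<and> (\<forall>i<p. \<forall>j<p. R w i j = of_bool (i = j) * c)" using R_W[OF w] by blast
  qed
  show "\<forall>B. (\<forall>i<p. \<forall>j<p. B i j \<in> rat_adjoin \<zeta>) \<longrightarrow>
        (\<exists>f::'a \<Rightarrow> rat. \<forall>i<p. \<forall>j<p. (\<Sum>x\<in>carrier G. of_rat (f x) * R x i j) = B i j)"
    using R_surj by blast
  show "\<forall>f::'a \<Rightarrow> rat. (\<forall>i<p. \<forall>j<p. (\<Sum>x\<in>carrier G. of_rat (f x) * R x i j) = 0) \<longrightarrow>
        (\<forall>x\<in>carrier G. (\<Sum>z\<in>Z. f (z \<otimes> x)) = 0) \<longrightarrow> (\<forall>x\<in>carrier G. (\<Sum>n\<in>N. f (n \<otimes> x)) = 0)"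
    using R_inj by blast
qed (simp_all add: R_one R_rat_adjoin)

end

section \<open>The components belonging to a subgroup of order \<open>p\<close>\<close>

lemma order_FactGroup: "Coset.order (G Mod H) = card (rcosets\<^bsub>G\<^esub> H)"
  by (simp add: FactGroup_def Coset.order_def)

lemma dvd_prime_square:
  assumes "Factorial_Ring.prime (p :: nat)" "d dvd p ^ 2"
  shows "d = 1 \<or> d = p \<or> d = p ^ 2"
proof -
  obtain i where "i \<le> 2" "d = p ^ i" using assms divides_primepow_nat by blast
  moreover then have "i = 0 \<or> i = 1 \<or> i = 2" by auto
  ultimately show ?thesis by auto
qed

section \<open>The centre of \<open>G/K\<close>, its quotient by \<open>(G/K)'\<close>, and their
  invariants\<close>

context phi4_line
begin

lemma coset_eq: "x \<in> carrier G \<Longrightarrow> y \<in> carrier G \<Longrightarrow> K #> x = K #> y \<longleftrightarrow> x \<otimes> inv y \<in> K"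
proof -
  assume xy: "x \<in> carrier G" "y \<in> carrier G"
  have "K #> x = K #> y \<longleftrightarrow> x \<in> K #> y"
    using xy K by (metis rcos_self repr_independence)
  then show ?thesis using xy K.rcos_module[OF group_axioms, of y x] by simp
qed

lemma coset_one: "x \<in> carrier G \<Longrightarrow> K #> x = K \<longleftrightarrow> x \<in> K"
  using coset_eq[of x \<one>] by (simp add: K.subset coset_mult_one)

lemma card_cosets:
  assumes S: "subgroup S G" "K \<subseteq> S"
  shows "card ((\<lambda>x. K #> x) ` S) * p = card S"
proof -
  interpret S: subgroup S G by fact
  interpret GS: group "G\<lparr>carrier := S\<rparr>" by (rule subgroup_imp_group) (rule S)
  have "card ((\<lambda>z. K #> z) ` carrier (G\<lparr>carrier := S\<rparr>)) * card K = Coset.order (G\<lparr>carrier := S\<rparr>)"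
  proof (rule GS.card_fibres_subgroup)
    show "subgroup K (G\<lparr>carrier := S\<rparr>)" using K S by (rule subgroup_incl)
    show "finite (carrier (G\<lparr>carrier := S\<rparr>))" using finite_subset[OF S.subset fin] by simp
  qed (use coset_eq in \<open>auto simp: m_inv_consistent S\<close>)
  then show ?thesis using card_K by (simp add: Coset.order_def)
qed

lemma normal_K: "K \<lhd> G"
proof (rule normal_invI[OF K])
  fix x k assume xk: "x \<in> carrier G" "k \<in> K"
  then have "x \<otimes> k \<otimes> inv x = k \<otimes> x \<otimes> inv x" using Z_comm[of k x] K_Z by auto
  then show "x \<otimes> k \<otimes> inv x \<in> K" using xk by (simp add: m_assoc)
qed

sublocale K: normal K G by (rule normal_K)

sublocale Q0: group "G Mod K" by (rule K.factorgroup_is_group)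

lemma carrier_Q0: "carrier (G Mod K) = (\<lambda>x. K #> x) ` carrier G"
  by (auto simp: FactGroup_def RCOSETS_def)

lemma mult_Q0: "x \<in> carrier G \<Longrightarrow> y \<in> carrier G \<Longrightarrow> (K #> x) \<otimes>\<^bsub>G Mod K\<^esub> (K #> y) = K #> (x \<otimes> y)"
  by (simp add: K.rcos_sum)

text \<open>Two cosets of \<open>K\<close> commute exactly if the commutator of their
  representatives lies in \<open>K\<close>, which is the condition defining
  \<open>W\<close>.\<close>

lemma centre_Q0: "centre (G Mod K) = (\<lambda>x. K #> x) ` W"
proof -
  have *: "K #> x \<in> centre (G Mod K) \<longleftrightarrow> x \<in> W" if x: "x \<in> carrier G" for x
  proof -
    have "(K #> x) \<otimes>\<^bsub>G Mod K\<^esub> (K #> y) = (K #> y) \<otimes>\<^bsub>G Mod K\<^esub> (K #> x) \<longleftrightarrow> C x y \<in> K" if y: "y \<in> carrier G" for y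
    proof -
      have "x \<otimes> y \<otimes> inv (y \<otimes> x) = (y \<otimes> x) \<otimes> C x y \<otimes> inv (y \<otimes> x)"
        using mult_commutator[OF x y] by simp
      also have "(y \<otimes> x) \<otimes> C x y = C x y \<otimes> (y \<otimes> x)" using Z_comm[OF C_Z[OF x y], of "y \<otimes> x"] x y by simp
      also have "C x y \<otimes> (y \<otimes> x) \<otimes> inv (y \<otimes> x) = C x y"
        using inv_solve_right[of "C x y" "C x y \<otimes> (y \<otimes> x)" "y \<otimes> x"] x y by (simp del: inv_mult_group)
      finally show ?thesis using x y coset_eq[of "x \<otimes> y" "y \<otimes> x"] by (simp add: K.rcos_sum)
    qed
    note comm = this
    have "K #> x \<in> centre (G Mod K) \<longleftrightarrow>
      (\<forall>y\<in>carrier G. (K #> x) \<otimes>\<^bsub>G Mod K\<^esub> (K #> y) = (K #> y) \<otimes>\<^bsub>G Mod K\<^esub> (K #> x))"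
      unfolding centre_def carrier_Q0 using x by blast
    also have "\<dots> \<longleftrightarrow> (\<forall>y\<in>carrier G. C x y \<in> K)" by (intro ball_cong refl comm)
    also have "\<dots> \<longleftrightarrow> x \<in> W" unfolding W_def using x by blast
    finally show ?thesis .
  qed
  have "centre (G Mod K) \<subseteq> (\<lambda>x. K #> x) ` carrier G" unfolding centre_def carrier_Q0 by blast
  then show ?thesis using * W_G by blast
qed

abbreviation "Q \<equiv> quot_centre G K"

lemma Q_eq: "Q = (G Mod K)\<lparr>carrier := (\<lambda>x. K #> x) ` W\<rparr>"
  by (simp add: quot_centre_def centre_Q0)

lemma subgroup_centre_Q0: "subgroup ((\<lambda>x. K #> x) ` W) (G Mod K)"
  using Q0.subgroup_centre by (simp add: centre_Q0)

sublocale Q: group Q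
  unfolding Q_eq by (rule Q0.subgroup_imp_group[OF subgroup_centre_Q0])

lemma Q_simps: "carrier Q = (\<lambda>x. K #> x) ` W" "\<one>\<^bsub>Q\<^esub> = K"
  "x \<in> carrier G \<Longrightarrow> y \<in> carrier G \<Longrightarrow> (K #> x) \<otimes>\<^bsub>Q\<^esub> (K #> y) = K #> (x \<otimes> y)"
  using mult_Q0 by (simp_all add: Q_eq FactGroup_def)

lemma order_Q: "Coset.order Q = p ^ 2"
proof -
  have "card (carrier Q) * p = p ^ 2 * p"
    using card_cosets[OF subgroup_W] K_Z Z_W card_W by (simp add: Q_simps power3_eq_cube power2_eq_square)
  then show ?thesis using p0 by (simp add: Coset.order_def)
qed

lemma pow_Q: "x \<in> W \<Longrightarrow> (K #> x) [^]\<^bsub>Q\<^esub> (n::nat) = K #> (x [^] n)"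
proof (induction n)
  case 0
  then show ?case by (simp add: Q_simps coset_mult_one K.subset)
next
  case (Suc n)
  then show ?case using W_G by (simp add: Q_simps(3))
qed

abbreviation "D \<equiv> commutator_subgroup (G Mod K)"

lemma D_eq: "D = (\<lambda>x. K #> x) ` Z"
proof -
  interpret h: group_hom G "G Mod K" "\<lambda>x. K #> x"
    by (intro group_hom.intro group_axioms Q0.group_axioms group_hom_axioms.intro K.r_coset_hom_Mod)
  show ?thesis using h.derived_img[of "carrier G"] by (simp add: carrier_Q0 derived_eq)
qed

lemma card_D: "card D = p"
  using card_cosets[OF subgroup_centre K_Z] card_centre p0 by (simp add: D_eq power2_eq_square)

lemma subgroup_D: "subgroup D Q"
  unfolding Q_eq
  by (rule Q0.subgroup_incl[OF Q0.derived_is_subgroup subgroup_centre_Q0]) (use Z_W D_eq in auto)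

lemma Q_comm: "x \<in> carrier Q \<Longrightarrow> y \<in> carrier Q \<Longrightarrow> x \<otimes>\<^bsub>Q\<^esub> y = y \<otimes>\<^bsub>Q\<^esub> x"
proof -
  assume "x \<in> carrier Q" "y \<in> carrier Q"
  then have "x \<in> centre (G Mod K)" "y \<in> centre (G Mod K)" by (simp_all add: quot_centre_def)
  then have "x \<otimes>\<^bsub>G Mod K\<^esub> y = y \<otimes>\<^bsub>G Mod K\<^esub> x" unfolding centre_def by blast
  then show ?thesis by (simp add: quot_centre_def)
qed

lemma normal_D: "D \<lhd> Q"
proof (rule Q.normal_invI[OF subgroup_D])
  fix x h assume xh: "x \<in> carrier Q" "h \<in> D"
  have h: "h \<in> carrier Q" using xh subgroup.subset[OF subgroup_D] by blast
  then have "x \<otimes>\<^bsub>Q\<^esub> h \<otimes>\<^bsub>Q\<^esub> inv\<^bsub>Q\<^esub> x = h \<otimes>\<^bsub>Q\<^esub> x \<otimes>\<^bsub>Q\<^esub> inv\<^bsub>Q\<^esub> x" using Q_comm[OF xh(1) h] by simp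
  also have "\<dots> = h" using xh h by (simp add: Q.m_assoc)
  finally show "x \<otimes>\<^bsub>Q\<^esub> h \<otimes>\<^bsub>Q\<^esub> inv\<^bsub>Q\<^esub> x \<in> D" using xh by simp
qed

abbreviation "Q' \<equiv> quot_centre_mod_derived G K"

lemma order_Q': "Coset.order Q' = p"
proof -
  have "card (rcosets\<^bsub>Q\<^esub> D) * p = p * p"
    using Q.lagrange[OF subgroup_D] unfolding card_D order_Q power2_eq_square .
  then have "card (rcosets\<^bsub>Q\<^esub> D) = p" using p0 by (subst (asm) mult_cancel2) auto
  then show ?thesis unfolding quot_centre_mod_derived_def order_FactGroup .
qed

sublocale Q': group Q'
  unfolding quot_centre_mod_derived_def by (rule normal.factorgroup_is_group[OF normal_D])

lemma Q'_invariants: "group_exponent Q' = p" "num_cyclic_subgroups Q' p = 1" "num_cyclic_subgroups Q' 1 = 1"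
  using Q'.prime_order_invariants[OF prime order_Q'] Q'.num_cyclic_subgroups_1 by auto

text \<open>The pairs \<open>(d, i)\<close> indexing the simple components that belong to \<open>K\<close>.\<close>

definition "comp_index = {(d, i). 0 < d \<and> d dvd group_exponent Q \<and>
  i < (if d dvd group_exponent Q' then num_cyclic_subgroups Q d - num_cyclic_subgroups Q' d
       else num_cyclic_subgroups Q d)}"

text \<open>For \<open>d = 1\<close> and \<open>d = p\<close> the count in \<open>Q\<close> does not
  exceed the single subgroup counted in \<open>Q'\<close>, so no index is left. The divisor
  \<open>p ^ 2\<close> does not divide the exponent \<open>p\<close> of \<open>Q'\<close> and
  contributes one copy.\<close>

lemma comp_index_cyclic:
  assumes "x \<in> carrier Q" "Q.ord x = p ^ 2"
  shows "comp_index = {(p ^ 2, 0)}"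
proof -
  note inv = Q.cyclic_prime_square_invariants[OF prime order_Q assms]
  have "\<not> p ^ 2 dvd p" using p1 by (auto dest!: dvd_imp_le simp: power2_eq_square)
  show ?thesis
  proof (intro equalityI subsetI)
    fix c assume "c \<in> comp_index"
    moreover obtain d i where c: "c = (d, i)" by fastforce
    ultimately have d: "d dvd p ^ 2" and i: "i < (if d dvd p then num_cyclic_subgroups Q d - num_cyclic_subgroups Q' d
       else num_cyclic_subgroups Q d)"
      by (auto simp: comp_index_def inv Q'_invariants)
    from dvd_prime_square[OF prime d] show "c \<in> {(p ^ 2, 0)}"
    proof (elim disjE)
      assume "d = 1"
      then show ?thesis using i Q'_invariants(3) Q.num_cyclic_subgroups_1 by simp
    next
      assume "d = p"
      then show ?thesis using i Q'_invariants(2) inv(3) by simp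
    next
      assume "d = p ^ 2"
      then show ?thesis using i inv(2) \<open>\<not> p ^ 2 dvd p\<close> c by simp
    qed
  next
    fix c assume "c \<in> {(p ^ 2, 0 :: nat)}"
    then show "c \<in> comp_index" using inv \<open>\<not> p ^ 2 dvd p\<close> p0 by (simp add: comp_index_def Q'_invariants)
  qed
qed

text \<open>Both exponents equal \<open>p\<close>. The \<open>p + 1\<close> subgroups of order
  \<open>p\<close> of \<open>Q\<close> minus the one of \<open>Q'\<close> leave \<open>p\<close>
  indices, and \<open>d = 1\<close> leaves none.\<close>

lemma comp_index_elementary:
  assumes "\<And>x. x \<in> carrier Q \<Longrightarrow> x [^]\<^bsub>Q\<^esub> p = \<one>\<^bsub>Q\<^esub>"
  shows "comp_index = (\<lambda>i. (p, i)) ` {..<p}"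
proof -
  note inv = Q.elementary_prime_square_invariants[OF prime order_Q assms]
  have dvd_p: "d = 1 \<or> d = p" if "d dvd p" for d using that prime by (auto simp: prime_nat_iff)
  have a_1: "num_cyclic_subgroups Q 1 - num_cyclic_subgroups Q' 1 = 0"
    and a_p: "num_cyclic_subgroups Q p - num_cyclic_subgroups Q' p = p"
    using inv(2) Q'_invariants(2,3) Q.num_cyclic_subgroups_1 by simp_all
  show ?thesis
  proof (intro equalityI subsetI)
    fix c assume "c \<in> comp_index"
    moreover obtain d i where c: "c = (d, i)" by fastforce
    ultimately have d: "d dvd p" and i: "i < num_cyclic_subgroups Q d - num_cyclic_subgroups Q' d"
      by (auto simp: comp_index_def inv Q'_invariants)
    then show "c \<in> (\<lambda>i. (p, i)) ` {..<p}" using dvd_p[OF d] a_1 a_p c by auto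
  next
    fix c assume "c \<in> (\<lambda>i. (p, i)) ` {..<p}"
    then show "c \<in> comp_index" using a_p p0 by (auto simp: comp_index_def inv Q'_invariants(1))
  qed
qed

lemma Q_elementary:
  assumes "\<not> (\<exists>x\<in>carrier Q. Q.ord x = p ^ 2)" "x \<in> carrier Q"
  shows "x [^]\<^bsub>Q\<^esub> p = \<one>\<^bsub>Q\<^esub>"
proof -
  have "Q.ord x dvd p ^ 2"
    using Q.pow_order_eq_1[OF assms(2)] Q.pow_eq_id[OF assms(2)] by (simp add: order_Q)
  then have "Q.ord x dvd p" using dvd_prime_square[OF prime, of "Q.ord x"] assms by auto
  then show ?thesis using Q.pow_eq_id[OF assms(2)] by simp
qed

lemma finite_comp_index: "finite comp_index"
proof (cases "\<exists>x\<in>carrier Q. Q.ord x = p ^ 2")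
  case True
  then show ?thesis using comp_index_cyclic by auto
next
  case False
  then have "comp_index = (\<lambda>i. (p, i)) ` {..<p}" using Q_elementary by (intro comp_index_elementary) blast
  then show ?thesis by simp
qed

section \<open>Existence of the components belonging to \<open>K\<close>\<close>

definition "preimage L = {x \<in> carrier G. K #> x \<in> L}"

lemma sum_preimage:
  assumes L: "L \<subseteq> carrier (G Mod K)"
  shows "(\<Sum>C\<in>L. sum f C) = sum f (preimage L)"
proof -
  have fin_pre: "finite (preimage L)" using fin by (simp add: preimage_def)
  have "finite (carrier (G Mod K))" using fin by (simp add: carrier_Q0)
  then have fin_L: "finite L" using L finite_subset by blast
  have "sum f (preimage L) = (\<Sum>C\<in>L. sum f {x \<in> preimage L. K #> x = C})"
    using fin_pre fin_L by (intro sum.group[symmetric]) (auto simp: preimage_def)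
  also have "\<dots> = (\<Sum>C\<in>L. sum f C)"
  proof (rule sum.cong[OF refl])
    fix C assume C: "C \<in> L"
    then obtain y where y: "y \<in> carrier G" "C = K #> y" using L carrier_Q0 by blast
    have "{x \<in> preimage L. K #> x = C} = C"
    proof (intro equalityI subsetI)
      fix x assume "x \<in> {x \<in> preimage L. K #> x = C}"
      then show "x \<in> C" using rcos_self[OF _ K, of x] by (auto simp: preimage_def)
    next
      fix x assume x: "x \<in> C"
      then have "x \<in> carrier G" using y r_coset_subset_G[OF K.subset] by blast
      moreover have "K #> x = C" using repr_independence[of x K y] x y K by simp
      ultimately show "x \<in> {x \<in> preimage L. K #> x = C}" using C by (simp add: preimage_def)
    qed
    then show "sum f {x \<in> preimage L. K #> x = C} = sum f C" by simp
  qed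
  finally show ?thesis by simp
qed

lemma preimage_coset_image:
  assumes S: "subgroup S G" "K \<subseteq> S"
  shows "preimage ((\<lambda>x. K #> x) ` S) = S"
proof
  interpret S: subgroup S G by fact
  show "preimage ((\<lambda>x. K #> x) ` S) \<subseteq> S"
  proof
    fix x assume "x \<in> preimage ((\<lambda>x. K #> x) ` S)"
    then obtain y where x: "x \<in> carrier G" "y \<in> S" "K #> x = K #> y" by (auto simp: preimage_def)
    then have "x \<otimes> inv y \<in> S" using coset_eq S by auto
    then have "x \<otimes> inv y \<otimes> y \<in> S" using x by blast
    then show "x \<in> S" using x by (simp add: m_assoc)
  qed
next
  show "S \<subseteq> preimage ((\<lambda>x. K #> x) ` S)"
    unfolding preimage_def using subgroup.subset[OF S(1)] by blast
qed

text \<open>\<open>W\<close> is a union of cosets of the centre; summing over all translates by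
  central elements counts each of its elements \<open>card Z\<close> times.\<close>

lemma sum_W_zero:
  fixes f :: "'a \<Rightarrow> rat"
  assumes "\<forall>x\<in>carrier G. (\<Sum>z\<in>Z. f (z \<otimes> x)) = 0" "x \<in> carrier G"
  shows "(\<Sum>w\<in>W. f (w \<otimes> x)) = 0"
proof -
  have "of_nat (card Z) * (\<Sum>w\<in>W. f (w \<otimes> x)) = (\<Sum>z\<in>Z. \<Sum>w\<in>W. f (w \<otimes> x))" by simp
  also have "\<dots> = (\<Sum>z\<in>Z. \<Sum>w\<in>W. f (z \<otimes> w \<otimes> x))"
  proof (rule sum.cong[OF refl])
    fix z assume "z \<in> Z"
    then have "z \<in> W" using Z_W by blast
    then show "(\<Sum>w\<in>W. f (w \<otimes> x)) = (\<Sum>w\<in>W. f (z \<otimes> w \<otimes> x))"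
      by (rule sum_translate_subgroup[OF subgroup_W, of z "\<lambda>w. f (w \<otimes> x)", symmetric])
  qed
  also have "\<dots> = (\<Sum>z\<in>Z. \<Sum>w\<in>W. f (z \<otimes> (w \<otimes> x)))"
  proof (intro sum.cong refl)
    fix z w assume "z \<in> Z" "w \<in> W"
    then have "z \<otimes> w \<otimes> x = z \<otimes> (w \<otimes> x)" by (intro m_assoc Z.mem_carrier W_G assms(2))
    then show "f (z \<otimes> w \<otimes> x) = f (z \<otimes> (w \<otimes> x))" by (rule arg_cong)
  qed
  also have "\<dots> = (\<Sum>w\<in>W. \<Sum>z\<in>Z. f (z \<otimes> (w \<otimes> x)))" by (rule sum.swap)
  also have "\<dots> = 0"
  proof (rule sum.neutral, rule ballI)
    fix w assume "w \<in> W"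
    then show "(\<Sum>z\<in>Z. f (z \<otimes> (w \<otimes> x))) = 0" by (rule bspec[OF assms(1) m_closed[OF W_G assms(2)]])
  qed
  finally show ?thesis using card_centre p0 by simp
qed

text \<open>The data of the components belonging to \<open>K\<close>: \<open>N\<close> is the kernel of the central character
  of the component.\<close>

definition line_components where
  "line_components \<zeta> N R \<longleftrightarrow>
     (\<forall>(d, i)\<in>comp_index. component_rep G p K (\<zeta> d) (N (d, i)) (R (d, i)) \<and>
        subgroup (N (d, i)) G \<and> N (d, i) \<inter> Z = K \<and> N (d, i) \<subseteq> W) \<and>
     (\<forall>c\<in>comp_index. \<forall>c'\<in>comp_index. N c \<subseteq> N c' \<longrightarrow> c = c') \<and>
     (\<forall>f::'a \<Rightarrow> rat. (\<forall>x\<in>carrier G. (\<Sum>z\<in>Z. f (z \<otimes> x)) = 0) \<longrightarrow>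
        (\<forall>c\<in>comp_index. \<forall>x\<in>carrier G. (\<Sum>n\<in>N c. f (n \<otimes> x)) = 0) \<longrightarrow>
        (\<forall>x\<in>carrier G. (\<Sum>k\<in>K. f (k \<otimes> x)) = 0))"

text \<open>If \<open>Q\<close> is cyclic, a generator yields the only component, with
  \<open>N = K\<close>. Otherwise every subgroup of order \<open>p\<close> of \<open>Q\<close> other
  than \<open>D\<close> yields one, with \<open>N\<close> its preimage; \<open>D\<close> is left out
  because its preimage is the whole centre.\<close>

lemma exists_line_components:
  assumes \<zeta>: "\<And>d. 0 < d \<Longrightarrow> primitive_root_of_unity d (\<zeta> d)"
  shows "\<exists>N R. line_components \<zeta> N R"
proof -
  obtain v where v: "v \<in> carrier G" "v \<notin> W" "v [^] p \<in> K" using exists_outside_upper by blast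
  show ?thesis
  proof (cases "\<exists>x\<in>carrier Q. Q.ord x = p ^ 2")
    case True
    then obtain x where x: "x \<in> carrier Q" "Q.ord x = p ^ 2" by blast
    then obtain g where g: "g \<in> W" "x = K #> g" by (auto simp: Q_simps)
    have "g [^] k \<in> K \<longleftrightarrow> p * p dvd k" for k :: nat
    proof -
      have "g [^] k \<in> K \<longleftrightarrow> x [^]\<^bsub>Q\<^esub> k = \<one>\<^bsub>Q\<^esub>"
        using g W_G coset_one[of "g [^] k"] by (simp add: pow_Q Q_simps(2))
      then show ?thesis using Q.pow_eq_id[OF x(1)] x(2) by (simp add: power2_eq_square)
    qed
    then interpret c: phi4_component G p K K p 1 g "\<zeta> (p ^ 2)" v
      using g v K_Z Z_W W_G pow_in_centre[of g] card_K \<zeta>[of "p ^ 2"] p0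
      by unfold_locales (auto simp: K power3_eq_cube power2_eq_square)
    have "line_components \<zeta> (\<lambda>_. K) (\<lambda>_. c.R)"
      unfolding line_components_def comp_index_cyclic[OF x]
      using c.component_rep_R K K_Z Z_W by auto
    then show ?thesis by blast
  next
    case False
    then have elem: "\<And>x. x \<in> carrier Q \<Longrightarrow> x [^]\<^bsub>Q\<^esub> p = \<one>\<^bsub>Q\<^esub>" using Q_elementary by blast
    define \<L> where "\<L> = {L. subgroup L Q \<and> card L = p}"
    note plane = Q.elementary_prime_square_sum[OF prime order_Q elem, folded \<L>_def]
    have fin\<L>: "finite \<L>" using plane(1) by (intro card_ge_0_finite) simp
    have D\<L>: "D \<in> \<L>" using subgroup_D card_D by (simp add: \<L>_def)
    have "card (\<L> - {D}) = p" using plane(1) D\<L> fin\<L> by simp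
    \<comment> \<open>An arbitrary enumeration, since an index pair records only a divisor and a
      number.\<close>
    then obtain h where h: "bij_betw h {..<p} (\<L> - {D})"
      using ex_bij_betw_nat_finite[of "\<L> - {D}"] fin\<L> by (auto simp: lessThan_atLeast0)
    \<comment> \<open>One element \<open>z\<close> serves as \<open>g\<^sub>0\<close> for all these
      components, since each \<open>N\<close> meets the centre in \<open>K\<close>.\<close>
    obtain z where z: "z \<in> Z" "z \<notin> K"
    proof -
      have "card K < card Z" using card_K card_centre p1 by (simp add: power2_eq_square)
      then have "\<not> Z \<subseteq> K" using card_mono[OF fin_K] by (metis not_le)
      then show ?thesis using that by blast
    qed
    have L_Q: "L \<subseteq> (\<lambda>x. K #> x) ` W" if "L \<in> \<L>" for L
      using that subgroup.subset[of L Q] by (auto simp: \<L>_def Q_simps)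
    have L_eq: "L = (\<lambda>x. K #> x) ` preimage L" if "L \<in> \<L>" for L
      using L_Q[OF that] W_G by (auto simp: preimage_def)
    have pre: "subgroup (preimage L) G" "K \<subseteq> preimage L" "preimage L \<subseteq> W" "card (preimage L) = p * p"
      if L: "L \<in> \<L>" for L
    proof -
      interpret L: subgroup L Q using L by (simp add: \<L>_def)
      have "K \<in> L" using L.one_closed by (simp add: Q_simps)
      show K_pre: "K \<subseteq> preimage L"
      proof
        fix x assume x: "x \<in> K"
        then have "K #> x = K" using coset_one[of x] by simp
        then show "x \<in> preimage L" using x \<open>K \<in> L\<close> by (simp add: preimage_def)
      qed
      show sub: "subgroup (preimage L) G"
      proof (rule finite_mult_closed_subgroup[OF fin])
        show "preimage L \<noteq> {}" using K_pre K.one_closed by blast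
        fix a b assume "a \<in> preimage L" "b \<in> preimage L"
        then show "a \<otimes> b \<in> preimage L"
          using L.m_closed[of "K #> a" "K #> b"] by (simp add: preimage_def Q_simps(3))
      qed (auto simp: preimage_def)
      show "preimage L \<subseteq> W"
      proof -
        have "preimage L \<subseteq> preimage ((\<lambda>x. K #> x) ` W)" using L_Q[OF L] by (auto simp: preimage_def)
        then show ?thesis using preimage_coset_image[OF subgroup_W] K_Z Z_W by simp
      qed
      show "card (preimage L) = p * p"
        using card_cosets[OF sub K_pre] L_eq[OF L] L by (simp add: \<L>_def)
    qed
    have pre_Z: "preimage L \<inter> Z = K" if L: "L \<in> \<L> - {D}" for L
    proof
      show "preimage L \<inter> Z \<subseteq> K"
      proof
        fix x assume x: "x \<in> preimage L \<inter> Z"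
        then have "K #> x \<in> L" "K #> x \<in> D" by (auto simp: preimage_def D_eq)
        have "K #> x = \<one>\<^bsub>Q\<^esub>"
        proof (rule ccontr)
          assume ne: "K #> x \<noteq> \<one>\<^bsub>Q\<^esub>"
          have "L = (\<lambda>i::nat. (K #> x) [^]\<^bsub>Q\<^esub> i) ` {..<p}"
            using L \<open>K #> x \<in> L\<close> ne by (intro Q.prime_subgroup_powers(1)[OF prime]) (auto simp: \<L>_def)
          moreover have "D = (\<lambda>i::nat. (K #> x) [^]\<^bsub>Q\<^esub> i) ` {..<p}"
            using subgroup_D card_D \<open>K #> x \<in> D\<close> ne by (intro Q.prime_subgroup_powers(1)[OF prime])
          ultimately show False using L by simp
        qed
        then show "x \<in> K" using x coset_one[of x] by (simp add: Q_simps preimage_def)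
      qed
    qed (use pre L K_Z in auto)
    have comp: "phi4_component G p K (preimage L) 1 0 z (\<zeta> p) v" if L: "L \<in> \<L> - {D}" for L
    proof (intro phi4_component.intro phi4_line_axioms phi4_component_axioms.intro)
      have L': "L \<in> \<L>" using L by simp
      show "subgroup (preimage L) G" "K \<subseteq> preimage L" "preimage L \<subseteq> W" using pre[OF L'] by auto
      show "preimage L \<inter> Z = K" using pre_Z[OF L] .
      show "z \<in> W" using z Z_W by blast
      show "z [^] k \<in> preimage L \<longleftrightarrow> p * 1 dvd k" for k :: nat
      proof -
        have "z [^] k \<in> Z" using z by (induction k) auto
        then have "z [^] k \<in> preimage L \<longleftrightarrow> z [^] k \<in> K" using pre_Z[OF L] by blast
        then show ?thesis
          using pow_mem_iff_dvd[OF prime K, of z k] z pow_centre[OF z(1)] by simp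
      qed
      show "p * 1 * card (preimage L) = p ^ 3" using pre(4)[OF L'] by (simp add: power3_eq_cube)
      show "primitive_root_of_unity (p * 1) (\<zeta> p)" using \<zeta>[of p] p0 by simp
    qed (use z v in auto)
    have "\<forall>L\<in>\<L> - {D}. \<exists>R. component_rep G p K (\<zeta> p) (preimage L) R"
      using phi4_component.component_rep_R[OF comp] by blast
    then obtain R where R: "\<And>L. L \<in> \<L> - {D} \<Longrightarrow> component_rep G p K (\<zeta> p) (preimage L) (R L)" by metis
    have hL: "h i \<in> \<L> - {D}" if "i < p" for i using h that by (auto simp: bij_betw_def)
    have index: "comp_index = (\<lambda>i. (p, i)) ` {..<p}" by (rule comp_index_elementary) (rule elem)
    define Nf where "Nf c = preimage (h (snd c))" for c :: "nat \<times> nat"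
    define Rf where "Rf c = R (h (snd c))" for c :: "nat \<times> nat"
    have "line_components \<zeta> Nf Rf"
      unfolding line_components_def index
    proof (intro conjI allI impI)
      show "\<forall>(d, i)\<in>(\<lambda>i. (p, i)) ` {..<p}. component_rep G p K (\<zeta> d) (Nf (d, i)) (Rf (d, i)) \<and>
          subgroup (Nf (d, i)) G \<and> Nf (d, i) \<inter> Z = K \<and> Nf (d, i) \<subseteq> W"
        using R hL pre pre_Z by (auto simp: Nf_def Rf_def)
      have "i = j" if ij: "i < p" "j < p" "preimage (h i) \<subseteq> preimage (h j)" for i j
      proof -
        have "h i \<subseteq> h j" using ij L_eq hL by (metis DiffD1 image_mono)
        moreover have "card (h i) = p" "card (h j) = p" using hL ij by (auto simp: \<L>_def)
        ultimately have "h i = h j" using p0 by (metis card_ge_0_finite card_subset_eq)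
        then show ?thesis using h ij by (auto simp: bij_betw_def inj_on_def)
      qed
      then show "\<forall>c\<in>(\<lambda>i. (p, i)) ` {..<p}. \<forall>c'\<in>(\<lambda>i. (p, i)) ` {..<p}. Nf c \<subseteq> Nf c' \<longrightarrow> c = c'"
        by (auto simp: Nf_def)
      fix f :: "'a \<Rightarrow> rat"
      assume fZ: "\<forall>x\<in>carrier G. (\<Sum>z\<in>Z. f (z \<otimes> x)) = 0"
        and fN: "\<forall>c\<in>(\<lambda>i. (p, i)) ` {..<p}. \<forall>x\<in>carrier G. (\<Sum>n\<in>Nf c. f (n \<otimes> x)) = 0"
      show "\<forall>x\<in>carrier G. (\<Sum>k\<in>K. f (k \<otimes> x)) = 0"
      proof
        fix x assume x: "x \<in> carrier G"
        \<comment> \<open>The function on \<open>Q\<close> for inclusion-exclusion over the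
          subgroups of order \<open>p\<close>; its value at the identity of \<open>Q\<close> is the
          sum over \<open>K\<close>. The subgroup \<open>D\<close>, which has no component, is
          covered by the sums over the centre.\<close>
        define F where "F C = (\<Sum>w\<in>C. f (w \<otimes> x))" for C
        have F_L: "sum F L = 0" if L: "L \<in> \<L>" for L
        proof -
          have "L \<subseteq> carrier (G Mod K)" using L_Q[OF L] W_G carrier_Q0 by blast
          then have "sum F L = (\<Sum>n\<in>preimage L. f (n \<otimes> x))" unfolding F_def by (rule sum_preimage)
          also have "\<dots> = 0"
          proof (cases "L = D")
            case True
            have "preimage L = Z" unfolding True D_eq by (rule preimage_coset_image[OF subgroup_centre K_Z])
            then show ?thesis using fZ x by simp
          next
            case False
            then have "L \<in> h ` {..<p}" using L h by (auto simp: bij_betw_def)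
            then obtain i where "i < p" "L = h i" by blast
            then show ?thesis using fN x by (auto simp: Nf_def)
          qed
          finally show ?thesis .
        qed
        have "carrier Q \<subseteq> carrier (G Mod K)" using W_G by (auto simp: Q_simps carrier_Q0)
        then have "sum F (carrier Q) = (\<Sum>n\<in>preimage (carrier Q). f (n \<otimes> x))" unfolding F_def by (rule sum_preimage)
        also have "preimage (carrier Q) = W"
          unfolding Q_simps(1) by (rule preimage_coset_image[OF subgroup_W]) (use K_Z Z_W in auto)
        finally have "sum F (carrier Q) = 0" using sum_W_zero[OF fZ x] by simp
        moreover have "(\<Sum>L\<in>\<L>. sum F L) = 0" using F_L by (intro sum.neutral) auto
        ultimately have "of_nat p * F \<one>\<^bsub>Q\<^esub> = 0" using plane(2)[of F] by simp
        then have "F K = 0" using p0 by (simp add: Q_simps)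
        then show "(\<Sum>k\<in>K. f (k \<otimes> x)) = 0" by (simp add: F_def)
      qed
    qed
    then show ?thesis by blast
  qed
qed

end

section \<open>Homomorphisms from rational group algebras\<close>

definition alg_hom :: "(rat, 'a) module \<Rightarrow> (rat, 'b) module \<Rightarrow> ('a \<Rightarrow> 'b) \<Rightarrow> bool" where
  "alg_hom A B h \<longleftrightarrow> h \<in> Ring.ring_hom A B \<and> (\<forall>c. \<forall>x\<in>carrier A. h (c \<odot>\<^bsub>A\<^esub> x) = c \<odot>\<^bsub>B\<^esub> h x)"

lemma alg_homI:
  assumes "\<And>x. x \<in> carrier A \<Longrightarrow> h x \<in> carrier B"
    "\<And>x y. x \<in> carrier A \<Longrightarrow> y \<in> carrier A \<Longrightarrow> h (x \<otimes>\<^bsub>A\<^esub> y) = h x \<otimes>\<^bsub>B\<^esub> h y"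
    "\<And>x y. x \<in> carrier A \<Longrightarrow> y \<in> carrier A \<Longrightarrow> h (x \<oplus>\<^bsub>A\<^esub> y) = h x \<oplus>\<^bsub>B\<^esub> h y"
    "h \<one>\<^bsub>A\<^esub> = \<one>\<^bsub>B\<^esub>"
    "\<And>c x. x \<in> carrier A \<Longrightarrow> h (c \<odot>\<^bsub>A\<^esub> x) = c \<odot>\<^bsub>B\<^esub> h x"
  shows "alg_hom A B h"
  using assms by (auto simp: alg_hom_def intro: ring_hom_memI)

lemma alg_homD:
  assumes "alg_hom A B h"
  shows "x \<in> carrier A \<Longrightarrow> h x \<in> carrier B"
    "x \<in> carrier A \<Longrightarrow> y \<in> carrier A \<Longrightarrow> h (x \<otimes>\<^bsub>A\<^esub> y) = h x \<otimes>\<^bsub>B\<^esub> h y"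
    "x \<in> carrier A \<Longrightarrow> y \<in> carrier A \<Longrightarrow> h (x \<oplus>\<^bsub>A\<^esub> y) = h x \<oplus>\<^bsub>B\<^esub> h y"
    "h \<one>\<^bsub>A\<^esub> = \<one>\<^bsub>B\<^esub>"
    "x \<in> carrier A \<Longrightarrow> h (c \<odot>\<^bsub>A\<^esub> x) = c \<odot>\<^bsub>B\<^esub> h x"
  using assms by (auto simp: alg_hom_def Ring.ring_hom_def)

lemma alg_sum_simps:
  "carrier (A \<oplus>\<^sub>a B) = carrier A \<times> carrier B"
  "(a, b) \<otimes>\<^bsub>A \<oplus>\<^sub>a B\<^esub> (a', b') = (a \<otimes>\<^bsub>A\<^esub> a', b \<otimes>\<^bsub>B\<^esub> b')"
  "(a, b) \<oplus>\<^bsub>A \<oplus>\<^sub>a B\<^esub> (a', b') = (a \<oplus>\<^bsub>A\<^esub> a', b \<oplus>\<^bsub>B\<^esub> b')"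
  "\<one>\<^bsub>A \<oplus>\<^sub>a B\<^esub> = (\<one>\<^bsub>A\<^esub>, \<one>\<^bsub>B\<^esub>)"
  "c \<odot>\<^bsub>A \<oplus>\<^sub>a B\<^esub> (a, b) = (c \<odot>\<^bsub>A\<^esub> a, c \<odot>\<^bsub>B\<^esub> b)"
  by (simp_all add: alg_sum_def RDirProd_def DirProd_def ring.defs monoid.defs)

lemma alg_hom_sum:
  assumes "alg_hom A B h" "alg_hom A C k"
  shows "alg_hom A (B \<oplus>\<^sub>a C) (\<lambda>x. (h x, k x))"
  by (rule alg_homI) (simp_all add: alg_sum_simps alg_homD[OF assms(1)] alg_homD[OF assms(2)])

lemma alg_hom_Sum:
  assumes "\<And>i. i \<in> I \<Longrightarrow> alg_hom A (B i) (h i)"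
  shows "alg_hom A (alg_Sum I B) (\<lambda>x. \<lambda>i\<in>I. h i x)"
  by (rule alg_homI) (auto simp: alg_Sum_def fun_eq_iff alg_homD[OF assms])

lemma group_algebra_simps:
  "carrier (group_algebra G) = {f. finite {x. f x \<noteq> 0} \<and> (\<forall>x. x \<notin> carrier G \<longrightarrow> f x = 0)}"
  "\<one>\<^bsub>group_algebra G\<^esub> = (\<lambda>x. if x = \<one>\<^bsub>G\<^esub> then 1 else 0)"
  "f \<oplus>\<^bsub>group_algebra G\<^esub> g = (\<lambda>x. f x + g x)"
  "c \<odot>\<^bsub>group_algebra G\<^esub> f = (\<lambda>x. c * f x)"
  by (simp_all add: group_algebra_def)

lemma group_algebra_mult:
  assumes "finite (carrier G)"
  shows "f \<otimes>\<^bsub>group_algebra G\<^esub> g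
    = (\<lambda>x. if x \<in> carrier G then \<Sum>y\<in>carrier G. f y * g (inv\<^bsub>G\<^esub> y \<otimes>\<^bsub>G\<^esub> x) else 0)"
proof -
  have "(\<Sum>y\<in>{y \<in> carrier G. f y \<noteq> 0}. f y * g (inv\<^bsub>G\<^esub> y \<otimes>\<^bsub>G\<^esub> x)) = (\<Sum>y\<in>carrier G. f y * g (inv\<^bsub>G\<^esub> y \<otimes>\<^bsub>G\<^esub> x))" for x
    using assms by (intro sum.mono_neutral_left) auto
  note eq = this
  show ?thesis
  proof
    fix x
    show "(f \<otimes>\<^bsub>group_algebra G\<^esub> g) x
      = (if x \<in> carrier G then \<Sum>y\<in>carrier G. f y * g (inv\<^bsub>G\<^esub> y \<otimes>\<^bsub>G\<^esub> x) else 0)"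
      unfolding eq[symmetric] by (simp add: group_algebra_def)
  qed
qed

lemma carrier_group_algebra:
  assumes "finite (carrier G)"
  shows "carrier (group_algebra G) = {f. \<forall>x. x \<notin> carrier G \<longrightarrow> f x = 0}"
proof -
  have "finite {x. f x \<noteq> (0 :: rat)}" if "\<forall>x. x \<notin> carrier G \<longrightarrow> f x = 0" for f
    using that by (intro finite_subset[OF _ assms]) auto
  then show ?thesis by (auto simp: group_algebra_simps)
qed

lemma (in group) sum_group_algebra_mult:
  fixes F :: "'a \<Rightarrow> 'c :: field_char_0"
  assumes fin: "finite (carrier G)"
  shows "(\<Sum>x\<in>carrier G. of_rat ((f \<otimes>\<^bsub>group_algebra G\<^esub> g) x) * F x)
    = (\<Sum>y\<in>carrier G. \<Sum>z\<in>carrier G. of_rat (f y) * of_rat (g z) * F (y \<otimes> z))"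
proof -
  have "(\<Sum>x\<in>carrier G. of_rat ((f \<otimes>\<^bsub>group_algebra G\<^esub> g) x) * F x)
      = (\<Sum>x\<in>carrier G. \<Sum>y\<in>carrier G. of_rat (f y) * of_rat (g (inv y \<otimes> x)) * F x)"
    by (intro sum.cong refl) (simp add: group_algebra_mult[OF fin] of_rat_sum of_rat_mult sum_distrib_right)
  also have "\<dots> = (\<Sum>y\<in>carrier G. \<Sum>x\<in>carrier G. of_rat (f y) * of_rat (g (inv y \<otimes> x)) * F x)"
    by (rule sum.swap)
  also have "\<dots> = (\<Sum>y\<in>carrier G. \<Sum>z\<in>carrier G. of_rat (f y) * of_rat (g z) * F (y \<otimes> z))"
  proof (rule sum.cong[OF refl])
    fix y assume y: "y \<in> carrier G"
    show "(\<Sum>x\<in>carrier G. of_rat (f y) * of_rat (g (inv y \<otimes> x)) * F x) = (\<Sum>z\<in>carrier G. of_rat (f y) * of_rat (g z) * F (y \<otimes> z))"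
      by (rule sum.reindex_bij_witness[of _ "\<lambda>z. y \<otimes> z" "\<lambda>x. inv y \<otimes> x"]) (use y in \<open>auto simp: cancel_left\<close>)
  qed
  finally show ?thesis .
qed

text \<open>The linear extension of \<open>h\<close> to group algebras, in terms of coefficient
  functions.\<close>

definition push :: "('a, 'b) monoid_scheme \<Rightarrow> ('a \<Rightarrow> 'c) \<Rightarrow> ('a \<Rightarrow> rat) \<Rightarrow> 'c \<Rightarrow> rat" where
  "push G h f = (\<lambda>C. \<Sum>x\<in>{x \<in> carrier G. h x = C}. f x)"

lemma alg_hom_push:
  assumes "group_hom G H h" and fin: "finite (carrier G)" and surj: "h ` carrier G = carrier H"
  shows "alg_hom (group_algebra G) (group_algebra H) (push G h)"
proof -
  interpret group_hom G H h by fact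
  have finH: "finite (carrier H)" using fin surj by (metis finite_imageI)
  have indicator: "push G h f C = (\<Sum>x\<in>carrier G. f x * of_bool (h x = C))" for f C
  proof -
    have "push G h f C = (\<Sum>x\<in>{x \<in> carrier G. h x = C}. f x * of_bool (h x = C))"
      unfolding push_def by (intro sum.cong) auto
    also have "\<dots> = (\<Sum>x\<in>carrier G. f x * of_bool (h x = C))"
      using fin by (intro sum.mono_neutral_left) auto
    finally show ?thesis .
  qed
  show ?thesis
  proof (rule alg_homI)
    fix f g
    show "push G h (f \<otimes>\<^bsub>group_algebra G\<^esub> g) = push G h f \<otimes>\<^bsub>group_algebra H\<^esub> push G h g"
    proof
      fix C
      show "push G h (f \<otimes>\<^bsub>group_algebra G\<^esub> g) C = (push G h f \<otimes>\<^bsub>group_algebra H\<^esub> push G h g) C"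
      proof (cases "C \<in> carrier H")
        case False
        then have empty: "{x \<in> carrier G. h x = C} = {}" by auto
        show ?thesis using False unfolding push_def[of G h "f \<otimes>\<^bsub>group_algebra G\<^esub> g"] empty
          by (simp add: group_algebra_mult[OF finH])
      next
        case C: True
        have "push G h (f \<otimes>\<^bsub>group_algebra G\<^esub> g) C
            = (\<Sum>y\<in>carrier G. \<Sum>z\<in>carrier G. f y * g z * of_bool (h (y \<otimes>\<^bsub>G\<^esub> z) = C))"
          using G.sum_group_algebra_mult[OF fin, of f g "\<lambda>x. of_bool (h x = C) :: rat"] by (simp add: indicator)
        also have "\<dots> = (\<Sum>y\<in>carrier G. f y * push G h g (inv\<^bsub>H\<^esub> (h y) \<otimes>\<^bsub>H\<^esub> C))"
        proof (rule sum.cong[OF refl])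
          fix y assume y: "y \<in> carrier G"
          have "h (y \<otimes>\<^bsub>G\<^esub> z) = C \<longleftrightarrow> h z = inv\<^bsub>H\<^esub> (h y) \<otimes>\<^bsub>H\<^esub> C" if "z \<in> carrier G" for z
            using y that C H.inv_solve_left[of "h z" "h y" C] by auto
          then show "(\<Sum>z\<in>carrier G. f y * g z * of_bool (h (y \<otimes>\<^bsub>G\<^esub> z) = C)) = f y * push G h g (inv\<^bsub>H\<^esub> (h y) \<otimes>\<^bsub>H\<^esub> C)"
            unfolding indicator sum_distrib_left by (intro sum.cong refl) (simp add: mult.assoc)
        qed
        also have "\<dots> = (\<Sum>D\<in>carrier H. \<Sum>y\<in>{y \<in> carrier G. h y = D}. f y * push G h g (inv\<^bsub>H\<^esub> (h y) \<otimes>\<^bsub>H\<^esub> C))"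
          using fin finH by (intro sum.group[symmetric]) auto
        also have "\<dots> = (\<Sum>D\<in>carrier H. push G h f D * push G h g (inv\<^bsub>H\<^esub> D \<otimes>\<^bsub>H\<^esub> C))"
          by (intro sum.cong refl) (simp add: push_def[of G h f] sum_distrib_right)
        finally show ?thesis using C by (simp add: group_algebra_mult[OF finH])
      qed
    qed
  next
    fix f assume "f \<in> carrier (group_algebra G)"
    have "push G h f C = 0" if "C \<notin> carrier H" for C
    proof -
      have empty: "{x \<in> carrier G. h x = C} = {}" using that by auto
      show ?thesis unfolding push_def empty by simp
    qed
    then show "push G h f \<in> carrier (group_algebra H)" by (simp add: carrier_group_algebra[OF finH])
  next
    show "push G h \<one>\<^bsub>group_algebra G\<^esub> = \<one>\<^bsub>group_algebra H\<^esub>"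
    proof
      fix C
      have "push G h \<one>\<^bsub>group_algebra G\<^esub> C = (\<Sum>x\<in>carrier G. if x = \<one>\<^bsub>G\<^esub> then of_bool (h x = C) else 0)"
        unfolding indicator by (intro sum.cong refl) (simp add: group_algebra_simps)
      also have "\<dots> = \<one>\<^bsub>group_algebra H\<^esub> C" using fin by (auto simp: group_algebra_simps)
      finally show "push G h \<one>\<^bsub>group_algebra G\<^esub> C = \<one>\<^bsub>group_algebra H\<^esub> C" .
    qed
  qed (auto simp: push_def group_algebra_simps sum.distrib sum_distrib_left)
qed

text \<open>The linear extension of the matrix representation \<open>R\<close> to the rational group
  algebra.\<close>

definition rep_mat :: "('a, 'b) monoid_scheme \<Rightarrow> nat \<Rightarrow> ('a \<Rightarrow> nat \<Rightarrow> nat \<Rightarrow> complex) \<Rightarrow> ('a \<Rightarrow> rat) \<Rightarrow> complex mat" where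
  "rep_mat G n R f = mat n n (\<lambda>(i, j). \<Sum>x\<in>carrier G. of_rat (f x) * R x i j)"

lemma matrix_algebra_simps:
  "carrier (matrix_algebra n F) = {A \<in> carrier_mat n n. elements_mat A \<subseteq> F}"
  "A \<otimes>\<^bsub>matrix_algebra n F\<^esub> B = A * B" "A \<oplus>\<^bsub>matrix_algebra n F\<^esub> B = A + B"
  "\<one>\<^bsub>matrix_algebra n F\<^esub> = 1\<^sub>m n" "c \<odot>\<^bsub>matrix_algebra n F\<^esub> A = of_rat c \<cdot>\<^sub>m A"
  by (simp_all add: matrix_algebra_def ring_mat_def ring.defs)

lemma matrix_algebra_carrier_iff:
  "A \<in> carrier (matrix_algebra n F) \<longleftrightarrow> A \<in> carrier_mat n n \<and> (\<forall>i<n. \<forall>j<n. A $$ (i, j) \<in> F)"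
  by (auto simp: matrix_algebra_simps)

lemma alg_hom_rep_mat:
  assumes G: "group G" and fin: "finite (carrier G)"
    and mult: "\<And>x y i k. x \<in> carrier G \<Longrightarrow> y \<in> carrier G \<Longrightarrow> i < n \<Longrightarrow> k < n \<Longrightarrow>
      R (x \<otimes>\<^bsub>G\<^esub> y) i k = (\<Sum>j<n. R x i j * R y j k)"
    and one: "\<And>i j. i < n \<Longrightarrow> j < n \<Longrightarrow> R \<one>\<^bsub>G\<^esub> i j = of_bool (i = j)"
    and adj: "\<And>x i j. x \<in> carrier G \<Longrightarrow> i < n \<Longrightarrow> j < n \<Longrightarrow> R x i j \<in> rat_adjoin z"
  shows "alg_hom (group_algebra G) (matrix_algebra n (rat_adjoin z)) (rep_mat G n R)"
proof -
  interpret group G by fact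
  show ?thesis
  proof (rule alg_homI)
    fix f g
    show "rep_mat G n R (f \<otimes>\<^bsub>group_algebra G\<^esub> g) = rep_mat G n R f \<otimes>\<^bsub>matrix_algebra n (rat_adjoin z)\<^esub> rep_mat G n R g"
    proof (rule eq_matI)
      fix i k assume "i < dim_row (rep_mat G n R f \<otimes>\<^bsub>matrix_algebra n (rat_adjoin z)\<^esub> rep_mat G n R g)"
        "k < dim_col (rep_mat G n R f \<otimes>\<^bsub>matrix_algebra n (rat_adjoin z)\<^esub> rep_mat G n R g)"
      then have ik: "i < n" "k < n" by (simp_all add: matrix_algebra_simps rep_mat_def)
      have "rep_mat G n R (f \<otimes>\<^bsub>group_algebra G\<^esub> g) $$ (i, k)
          = (\<Sum>x\<in>carrier G. \<Sum>y\<in>carrier G. of_rat (f x) * of_rat (g y) * R (x \<otimes>\<^bsub>G\<^esub> y) i k)"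
        using ik sum_group_algebra_mult[OF fin, of f g "\<lambda>x. R x i k"] by (simp add: rep_mat_def)
      also have "\<dots> = (\<Sum>x\<in>carrier G. \<Sum>y\<in>carrier G. \<Sum>j<n. (of_rat (f x) * R x i j) * (of_rat (g y) * R y j k))"
        using ik by (intro sum.cong refl) (simp add: mult sum_distrib_left mult.assoc mult.left_commute)
      also have "\<dots> = (\<Sum>x\<in>carrier G. \<Sum>j<n. \<Sum>y\<in>carrier G. (of_rat (f x) * R x i j) * (of_rat (g y) * R y j k))"
        by (rule sum.cong[OF refl], rule sum.swap)
      also have "\<dots> = (\<Sum>j<n. \<Sum>x\<in>carrier G. \<Sum>y\<in>carrier G. (of_rat (f x) * R x i j) * (of_rat (g y) * R y j k))"
        by (rule sum.swap)
      also have "\<dots> = (\<Sum>j<n. (\<Sum>x\<in>carrier G. of_rat (f x) * R x i j) * (\<Sum>y\<in>carrier G. of_rat (g y) * R y j k))"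
        by (simp add: sum_product)
      also have "\<dots> = (rep_mat G n R f * rep_mat G n R g) $$ (i, k)"
        using ik by (simp add: rep_mat_def scalar_prod_def lessThan_atLeast0)
      finally show "rep_mat G n R (f \<otimes>\<^bsub>group_algebra G\<^esub> g) $$ (i, k)
          = (rep_mat G n R f \<otimes>\<^bsub>matrix_algebra n (rat_adjoin z)\<^esub> rep_mat G n R g) $$ (i, k)"
        by (simp add: matrix_algebra_simps)
    qed (simp_all add: matrix_algebra_simps rep_mat_def)
  next
    fix f
    show "rep_mat G n R f \<in> carrier (matrix_algebra n (rat_adjoin z))"
      unfolding matrix_algebra_carrier_iff
      by (auto simp: rep_mat_def intro!: rat_adjoin_sum rat_adjoin_closed(7) rat_adjoin_of_rat adj)
  next
    show "rep_mat G n R \<one>\<^bsub>group_algebra G\<^esub> = \<one>\<^bsub>matrix_algebra n (rat_adjoin z)\<^esub>"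
    proof (rule eq_matI)
      fix i j assume "i < dim_row \<one>\<^bsub>matrix_algebra n (rat_adjoin z)\<^esub>" "j < dim_col \<one>\<^bsub>matrix_algebra n (rat_adjoin z)\<^esub>"
      then have ij: "i < n" "j < n" by (simp_all add: matrix_algebra_simps)
      have "rep_mat G n R \<one>\<^bsub>group_algebra G\<^esub> $$ (i, j) = (\<Sum>x\<in>carrier G. if x = \<one>\<^bsub>G\<^esub> then R \<one>\<^bsub>G\<^esub> i j else 0)"
        using ij by (auto simp: rep_mat_def group_algebra_simps intro!: sum.cong)
      also have "\<dots> = R \<one>\<^bsub>G\<^esub> i j" using fin by simp
      finally show "rep_mat G n R \<one>\<^bsub>group_algebra G\<^esub> $$ (i, j) = \<one>\<^bsub>matrix_algebra n (rat_adjoin z)\<^esub> $$ (i, j)"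
        using ij one by (simp add: matrix_algebra_simps)
    qed (simp_all add: matrix_algebra_simps rep_mat_def)
  qed (auto simp: rep_mat_def group_algebra_simps matrix_algebra_simps of_rat_add of_rat_mult
      distrib_right sum.distrib sum_distrib_left mult.assoc intro!: eq_matI)
qed

section \<open>Averaging over subgroups\<close>

lemma (in group) sum_translate_left:
  assumes "a \<in> carrier G"
  shows "(\<Sum>x\<in>carrier G. F x) = (\<Sum>x\<in>carrier G. F (a \<otimes> x))"
  by (rule sum.reindex_bij_witness[of _ "\<lambda>x. a \<otimes> x" "\<lambda>x. inv a \<otimes> x"]) (use assms in \<open>auto simp: cancel_left\<close>)

text \<open>Translation by \<open>t\<close> leaves \<open>f\<close> unchanged and multiplies the
  matrix by \<open>c\<close>, so the sum equals \<open>c\<close> times itself.\<close>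

lemma (in group) rep_sum_invariant_zero:
  fixes R :: "'a \<Rightarrow> nat \<Rightarrow> nat \<Rightarrow> complex"
  assumes mult: "\<forall>x\<in>carrier G. \<forall>y\<in>carrier G. \<forall>i<n. \<forall>k<n. R (x \<otimes> y) i k = (\<Sum>j<n. R x i j * R y j k)"
    and t: "t \<in> carrier G" and R_t: "\<forall>i<n. \<forall>j<n. R t i j = of_bool (i = j) * c" and c: "c \<noteq> 1"
    and inv: "\<And>x. x \<in> carrier G \<Longrightarrow> f (t \<otimes> x) = f x" and ij: "i < n" "j < n"
  shows "(\<Sum>x\<in>carrier G. of_rat (f x) * R x i j) = 0"
proof -
  have R_tx: "R (t \<otimes> x) i j = c * R x i j" if x: "x \<in> carrier G" for x
  proof -
    have "R (t \<otimes> x) i j = (\<Sum>k<n. R t i k * R x k j)" using mult t x ij by blast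
    also have "\<dots> = (\<Sum>k<n. if i = k then c * R x k j else 0)"
      using R_t ij by (intro sum.cong refl) auto
    finally show ?thesis using ij by simp
  qed
  have "(\<Sum>x\<in>carrier G. of_rat (f x) * R x i j) = (\<Sum>x\<in>carrier G. of_rat (f (t \<otimes> x)) * R (t \<otimes> x) i j)"
    by (rule sum_translate_left[OF t])
  also have "\<dots> = c * (\<Sum>x\<in>carrier G. of_rat (f x) * R x i j)"
    unfolding sum_distrib_left by (intro sum.cong refl) (simp add: inv R_tx)
  finally have "(1 - c) * (\<Sum>x\<in>carrier G. of_rat (f x) * R x i j) = 0" by (simp add: left_diff_distrib)
  then show ?thesis using c by simp
qed

text \<open>For a finite subgroup \<open>S\<close>, left multiplication by the idempotent attached
  to it: the sum of its elements divided by \<open>card S\<close>.\<close>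

definition average :: "('a, 'b) monoid_scheme \<Rightarrow> 'a set \<Rightarrow> ('a \<Rightarrow> rat) \<Rightarrow> 'a \<Rightarrow> rat" where
  "average G S f = (\<lambda>x. (\<Sum>s\<in>S. f (s \<otimes>\<^bsub>G\<^esub> x)) / of_nat (card S))"

lemma (in group) average_invariant:
  assumes S: "subgroup S G" and t: "t \<in> S" and x: "x \<in> carrier G"
  shows "average G S f (t \<otimes> x) = average G S f x"
proof -
  interpret S: subgroup S G by fact
  have "(\<Sum>s\<in>S. f (s \<otimes> (t \<otimes> x))) = (\<Sum>s\<in>S. f (s \<otimes> x))"
    by (rule sum.reindex_bij_witness[of _ "\<lambda>s. s \<otimes> inv t" "\<lambda>s. s \<otimes> t"]) (use t x in \<open>auto simp: m_assoc\<close>)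
  then show ?thesis by (simp add: average_def)
qed

text \<open>Elements of \<open>S\<close> act trivially, so every translate of \<open>f\<close> by
  \<open>S\<close> has the same image as \<open>f\<close>.\<close>

lemma (in group) rep_sum_average:
  fixes R :: "'a \<Rightarrow> nat \<Rightarrow> nat \<Rightarrow> complex"
  assumes mult: "\<forall>x\<in>carrier G. \<forall>y\<in>carrier G. \<forall>i<n. \<forall>k<n. R (x \<otimes> y) i k = (\<Sum>j<n. R x i j * R y j k)"
    and fin: "finite (carrier G)" and S: "subgroup S G"
    and R_S: "\<forall>s\<in>S. \<forall>i<n. \<forall>j<n. R s i j = of_bool (i = j)" and ij: "i < n" "j < n"
  shows "(\<Sum>x\<in>carrier G. of_rat (average G S f x) * R x i j) = (\<Sum>x\<in>carrier G. of_rat (f x) * R x i j)"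
proof -
  interpret S: subgroup S G by fact
  have card: "of_nat (card S) \<noteq> (0 :: complex)"
    using finite_subset[OF S.subset fin] S.one_closed by (metis card_0_eq empty_iff of_nat_eq_0_iff)
  have R_sx: "R (s \<otimes> x) i j = R x i j" if s: "s \<in> S" and x: "x \<in> carrier G" for s x
  proof -
    have "R (s \<otimes> x) i j = (\<Sum>k<n. R s i k * R x k j)" using mult s x ij S.mem_carrier by blast
    also have "\<dots> = (\<Sum>k<n. if i = k then R x k j else 0)"
      using R_S s ij by (intro sum.cong refl) auto
    finally show ?thesis using ij by simp
  qed
  have "(\<Sum>x\<in>carrier G. of_rat (average G S f x) * R x i j)
      = (\<Sum>x\<in>carrier G. \<Sum>s\<in>S. of_rat (f (s \<otimes> x)) * R x i j) / of_nat (card S)"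
    by (simp add: average_def of_rat_divide of_rat_sum sum_distrib_right sum_divide_distrib)
  also have "(\<Sum>x\<in>carrier G. \<Sum>s\<in>S. of_rat (f (s \<otimes> x)) * R x i j)
      = (\<Sum>s\<in>S. \<Sum>x\<in>carrier G. of_rat (f (s \<otimes> x)) * R x i j)" by (rule sum.swap)
  also have "\<dots> = (\<Sum>s\<in>S. \<Sum>x\<in>carrier G. of_rat (f x) * R x i j)"
  proof (rule sum.cong[OF refl])
    fix s assume s: "s \<in> S"
    have "(\<Sum>x\<in>carrier G. of_rat (f x) * R x i j) = (\<Sum>x\<in>carrier G. of_rat (f (s \<otimes> x)) * R (s \<otimes> x) i j)"
      using s by (intro sum_translate_left) simp
    also have "\<dots> = (\<Sum>x\<in>carrier G. of_rat (f (s \<otimes> x)) * R x i j)"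
      by (intro sum.cong refl) (simp add: R_sx[OF s])
    finally show "(\<Sum>x\<in>carrier G. of_rat (f (s \<otimes> x)) * R x i j) = (\<Sum>x\<in>carrier G. of_rat (f x) * R x i j)" by simp
  qed
  also have "\<dots> / of_nat (card S) = (\<Sum>x\<in>carrier G. of_rat (f x) * R x i j)" using card by simp
  finally show ?thesis .
qed

lemma (in normal) push_average:
  assumes fin: "finite (carrier G)"
  shows "push G (\<lambda>x. H #> x) (average G H f) = push G (\<lambda>x. H #> x) f"
proof
  fix C
  have fin_H: "finite H" using finite_subset[OF subset fin] .
  have card: "of_nat (card H) \<noteq> (0 :: rat)" using fin_H subgroup.one_closed[OF subgroup_axioms] by (metis card_0_eq empty_iff of_nat_eq_0_iff)
  have coset: "H #> (h \<otimes> x) = H #> x" if "h \<in> H" "x \<in> carrier G" for h x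
    using that by (metis coset_join2 coset_mult_assoc mem_carrier subgroup_axioms subset)
  have "push G (\<lambda>x. H #> x) (average G H f) C
      = (\<Sum>x\<in>{x \<in> carrier G. H #> x = C}. \<Sum>h\<in>H. f (h \<otimes> x)) / of_nat (card H)"
    by (simp add: push_def average_def sum_divide_distrib)
  also have "(\<Sum>x\<in>{x \<in> carrier G. H #> x = C}. \<Sum>h\<in>H. f (h \<otimes> x))
      = (\<Sum>h\<in>H. \<Sum>x\<in>{x \<in> carrier G. H #> x = C}. f (h \<otimes> x))" by (rule sum.swap)
  also have "\<dots> = (\<Sum>h\<in>H. \<Sum>x\<in>{x \<in> carrier G. H #> x = C}. f x)"
  proof (rule sum.cong[OF refl])
    fix h assume h: "h \<in> H"
    show "(\<Sum>x\<in>{x \<in> carrier G. H #> x = C}. f (h \<otimes> x)) = (\<Sum>x\<in>{x \<in> carrier G. H #> x = C}. f x)"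
      by (rule sum.reindex_bij_witness[of _ "\<lambda>x. inv h \<otimes> x" "\<lambda>x. h \<otimes> x"])
        (use h coset[of h] coset[of "inv h"] in \<open>auto simp: cancel_left\<close>)
  qed
  also have "\<dots> / of_nat (card H) = push G (\<lambda>x. H #> x) f C" using card by (simp add: push_def)
  finally show "push G (\<lambda>x. H #> x) (average G H f) C = push G (\<lambda>x. H #> x) f C" .
qed

section \<open>The decomposition\<close>

text \<open>A Chinese remainder argument. Averaging over \<open>N a\<close> does not change
  component \<open>a\<close> but kills every other one, since some element of \<open>N a\<close>
  acts on it as a scalar other than 1. In the same way \<open>Z\<close> separates the algebra of the
  quotient from all components.\<close>

lemma (in group) joint_decomposition:
  fixes R :: "'i \<Rightarrow> 'a \<Rightarrow> nat \<Rightarrow> nat \<Rightarrow> complex" and N :: "'i \<Rightarrow> 'a set"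
  assumes fin: "finite (carrier G)" and Z: "Z \<lhd> G" and finI: "finite I"
    and mult: "\<And>a. a \<in> I \<Longrightarrow> \<forall>x\<in>carrier G. \<forall>y\<in>carrier G. \<forall>i<n. \<forall>k<n. R a (x \<otimes> y) i k = (\<Sum>j<n. R a x i j * R a y j k)"
    and surj: "\<And>a B. a \<in> I \<Longrightarrow> \<forall>i<n. \<forall>j<n. B i j \<in> F a \<Longrightarrow>
        \<exists>f::'a \<Rightarrow> rat. \<forall>i<n. \<forall>j<n. (\<Sum>x\<in>carrier G. of_rat (f x) * R a x i j) = B i j"
    and N: "\<And>a. a \<in> I \<Longrightarrow> subgroup (N a) G"
    and R_N: "\<And>a. a \<in> I \<Longrightarrow> \<forall>x\<in>N a. \<forall>i<n. \<forall>j<n. R a x i j = of_bool (i = j)"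
    and sep: "\<And>a b. a \<in> I \<Longrightarrow> b \<in> I \<Longrightarrow> a \<noteq> b \<Longrightarrow>
        \<exists>t\<in>N b. \<exists>c. c \<noteq> 1 \<and> (\<forall>i<n. \<forall>j<n. R a t i j = of_bool (i = j) * c)"
    and sep_Z: "\<And>a. a \<in> I \<Longrightarrow> \<exists>t\<in>Z. \<exists>c. c \<noteq> 1 \<and> (\<forall>i<n. \<forall>j<n. R a t i j = of_bool (i = j) * c)"
    and r: "r \<in> carrier (group_algebra (G Mod Z))"
    and B: "\<And>a. a \<in> I \<Longrightarrow> B a \<in> carrier (matrix_algebra n (F a))"
  shows "\<exists>f\<in>carrier (group_algebra G). push G (\<lambda>x. Z #> x) f = r \<and> (\<forall>a\<in>I. rep_mat G n (R a) f = B a)"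
proof -
  interpret Z: normal Z G by fact
  define \<rho> where "\<rho> a f i j = (\<Sum>x\<in>carrier G. of_rat (f x) * R a x i j)" for a f i j
  have \<rho>_average: "\<rho> a (average G (N a) f) i j = \<rho> a f i j" if "a \<in> I" "i < n" "j < n" for a f i j
    unfolding \<rho>_def using that by (intro rep_sum_average[OF mult fin N R_N])
  have \<rho>_zero: "\<rho> a f i j = 0"
    if a: "a \<in> I" "i < n" "j < n" and S: "subgroup S G"
      and inv: "\<And>s x. s \<in> S \<Longrightarrow> x \<in> carrier G \<Longrightarrow> f (s \<otimes> x) = f x"
      and t: "\<exists>t\<in>S. \<exists>c. c \<noteq> 1 \<and> (\<forall>i<n. \<forall>j<n. R a t i j = of_bool (i = j) * c)" for a f i j S
  proof -
    obtain t c where tc: "t \<in> S" "c \<noteq> 1" "\<forall>i<n. \<forall>j<n. R a t i j = of_bool (i = j) * c" using t by blast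
    show ?thesis
      unfolding \<rho>_def
      using inv[OF tc(1)] subgroup.mem_carrier[OF S tc(1)] a
      by (intro rep_sum_invariant_zero[OF mult _ tc(3,2)])
  qed
  have "\<exists>f. \<forall>i<n. \<forall>j<n. \<rho> a f i j = B a $$ (i, j)" if "a \<in> I" for a
    using surj[OF that, of "\<lambda>i j. B a $$ (i, j)"] B[OF that] unfolding matrix_algebra_carrier_iff \<rho>_def by blast
  then obtain f where f: "\<And>a i j. a \<in> I \<Longrightarrow> i < n \<Longrightarrow> j < n \<Longrightarrow> \<rho> a (f a) i j = B a $$ (i, j)" by metis
  \<comment> \<open>This has the prescribed image in every component; its image in the algebra of
    the quotient is still uncontrolled.\<close>
  define f1 where "f1 = (\<lambda>x. \<Sum>a\<in>I. average G (N a) (f a) x)"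
  have \<rho>_f1: "\<rho> b f1 i j = B b $$ (i, j)" if b: "b \<in> I" "i < n" "j < n" for b i j
  proof -
    have "\<rho> b f1 i j = (\<Sum>a\<in>I. \<rho> b (average G (N a) (f a)) i j)"
      unfolding \<rho>_def f1_def of_rat_sum sum_distrib_right by (rule sum.swap)
    also have "\<dots> = (\<Sum>a\<in>I. if a = b then B b $$ (i, j) else 0)"
    proof (rule sum.cong[OF refl])
      fix a assume a: "a \<in> I"
      show "\<rho> b (average G (N a) (f a)) i j = (if a = b then B b $$ (i, j) else 0)"
      proof (cases "a = b")
        case False
        have "\<rho> b (average G (N a) (f a)) i j = 0"
          by (rule \<rho>_zero[OF b N[OF a]]) (use False average_invariant[OF N[OF a]] sep[OF b(1) a] in auto)
        then show ?thesis using False by simp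
      qed (use b f \<rho>_average in simp)
    qed
    also have "\<dots> = B b $$ (i, j)" using b finI by simp
    finally show ?thesis .
  qed
  have card_Z: "of_nat (card Z) \<noteq> (0 :: rat)"
    using finite_subset[OF Z.subset fin] subgroup.one_closed[OF Z.subgroup_axioms]
    by (metis card_0_eq empty_iff of_nat_eq_0_iff)
  \<comment> \<open>Constant on the cosets of \<open>Z\<close>, each with \<open>card Z\<close>
    elements: it maps to \<open>r\<close> and vanishes in all components.\<close>
  define f0 where "f0 x = r (Z #> x) / of_nat (card Z)" for x
  \<comment> \<open>Subtracting the average over \<open>Z\<close> removes the image of
    \<open>f1\<close> in the quotient and leaves the components unchanged. Outside the carrier the
    value must be 0 for membership in the group algebra.\<close>
  define g where "g = (\<lambda>x. if x \<in> carrier G then f0 x + (f1 x - average G Z f1 x) else 0)"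
  have \<rho>_g: "\<rho> a g i j = B a $$ (i, j)" if a: "a \<in> I" "i < n" "j < n" for a i j
  proof -
    have "\<rho> a g i j = \<rho> a f0 i j + (\<rho> a f1 i j - \<rho> a (average G Z f1) i j)"
      unfolding \<rho>_def sum.distrib[symmetric] sum_subtractf[symmetric]
      by (intro sum.cong refl) (simp add: g_def of_rat_add of_rat_diff algebra_simps)
    moreover have "\<rho> a f0 i j = 0"
    proof (rule \<rho>_zero[OF a Z.subgroup_axioms _ sep_Z[OF a(1)]])
      fix s x assume "s \<in> Z" "x \<in> carrier G"
      then have "Z #> (s \<otimes> x) = Z #> x"
        by (metis coset_join2 coset_mult_assoc Z.mem_carrier Z.subgroup_axioms Z.subset)
      then show "f0 (s \<otimes> x) = f0 x" by (simp add: f0_def)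
    qed
    moreover have "\<rho> a (average G Z f1) i j = 0"
      by (rule \<rho>_zero[OF a Z.subgroup_axioms average_invariant[OF Z.subgroup_axioms] sep_Z[OF a(1)]])
    ultimately show ?thesis using \<rho>_f1 a by simp
  qed
  have push_g: "push G (\<lambda>x. Z #> x) g = r"
  proof
    fix C
    have "push G (\<lambda>x. Z #> x) g C = push G (\<lambda>x. Z #> x) f0 C
        + (push G (\<lambda>x. Z #> x) f1 C - push G (\<lambda>x. Z #> x) (average G Z f1) C)"
      unfolding push_def sum.distrib[symmetric] sum_subtractf[symmetric]
      by (intro sum.cong refl) (simp add: g_def)
    also have "\<dots> = push G (\<lambda>x. Z #> x) f0 C" by (simp add: Z.push_average[OF fin])
    also have "\<dots> = (\<Sum>x\<in>{x \<in> carrier G. Z #> x = C}. r C / of_nat (card Z))"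
      unfolding push_def f0_def by (intro sum.cong refl) auto
    also have "\<dots> = of_nat (card {x \<in> carrier G. Z #> x = C}) * (r C / of_nat (card Z))" by simp
    also have "\<dots> = r C"
    proof (cases "C \<in> rcosets Z")
      case True
      then obtain y where y: "y \<in> carrier G" "C = Z #> y" by (auto simp: RCOSETS_def)
      have "{x \<in> carrier G. Z #> x = C} = C"
      proof (intro equalityI subsetI)
        fix x assume "x \<in> {x \<in> carrier G. Z #> x = C}"
        then show "x \<in> C" using rcos_self[OF _ Z.subgroup_axioms, of x] by auto
      next
        fix x assume x: "x \<in> C"
        then have "x \<in> carrier G" using y r_coset_subset_G[OF Z.subset] by blast
        then show "x \<in> {x \<in> carrier G. Z #> x = C}"
          using repr_independence[of x Z y] x y Z.subgroup_axioms by simp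
      qed
      moreover have "card C = card Z" using card_rcosets_equal[OF True Z.subset] by simp
      ultimately show ?thesis using card_Z by simp
    next
      case False
      then have "r C = 0" using r by (auto simp: group_algebra_simps FactGroup_def)
      then show ?thesis by simp
    qed
    finally show "push G (\<lambda>x. Z #> x) g C = r C" .
  qed
  have "rep_mat G n (R a) g = B a" if a: "a \<in> I" for a
    using \<rho>_g[OF a] B[OF a] unfolding matrix_algebra_carrier_iff
    by (intro eq_matI) (auto simp: rep_mat_def \<rho>_def)
  moreover have "g \<in> carrier (group_algebra G)" by (simp add: carrier_group_algebra[OF fin] g_def)
  ultimately show ?thesis using push_g by blast
qed

lemma restrict_eq_PiE:
  assumes "S \<in> PiE I F" "\<And>i. i \<in> I \<Longrightarrow> h i = S i"
  shows "(\<lambda>i\<in>I. h i) = S"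
  using assms by (auto simp: fun_eq_iff PiE_def extensional_def)

lemma alg_copies_simps: "carrier (alg_copies n A) = (\<Pi>\<^sub>E i\<in>{..<n}. carrier A)"
  "carrier (alg_Sum I F) = (\<Pi>\<^sub>E i\<in>I. carrier (F i))"
  by (simp_all add: alg_copies_def alg_Sum_def)

section \<open>The subgroups of order \<open>p\<close> of the centre\<close>

context phi4
begin

lemma central_Cp_iff: "K \<in> central_Cp_subgroups p G \<longleftrightarrow> subgroup K G \<and> K \<subseteq> Z \<and> card K = p"
proof
  assume "K \<in> central_Cp_subgroups p G"
  then show "subgroup K G \<and> K \<subseteq> Z \<and> card K = p"
    using iso_integer_mod_group_card[OF p0] by (auto simp: central_Cp_subgroups_def)
next
  assume K: "subgroup K G \<and> K \<subseteq> Z \<and> card K = p"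
  have "K \<noteq> Z" using K card_centre p1 by (auto simp: power2_eq_square)
  then show "K \<in> central_Cp_subgroups p G"
    using K prime_subgroup_iso[OF prime] by (auto simp: central_Cp_subgroups_def)
qed

lemma line: "K \<in> central_Cp_subgroups p G \<Longrightarrow> phi4_line G p K"
  by (intro phi4_line.intro phi4_axioms phi4_line_axioms.intro) (auto simp: central_Cp_iff)

lemma finite_lines: "finite (central_Cp_subgroups p G)"
  by (rule finite_subset[of _ "Pow (carrier G)"]) (use fin in \<open>auto simp: central_Cp_iff intro: subgroup.mem_carrier\<close>)

lemma subgroups_centre:
  "{L. subgroup L (G\<lparr>carrier := Z\<rparr>) \<and> card L = p} = central_Cp_subgroups p G"
proof (intro equalityI subsetI)
  fix L assume "L \<in> {L. subgroup L (G\<lparr>carrier := Z\<rparr>) \<and> card L = p}"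
  then show "L \<in> central_Cp_subgroups p G"
    using incl_subgroup[OF subgroup_centre] subgroup.subset[of L "G\<lparr>carrier := Z\<rparr>"] by (auto simp: central_Cp_iff)
next
  fix L assume "L \<in> central_Cp_subgroups p G"
  then show "L \<in> {L. subgroup L (G\<lparr>carrier := Z\<rparr>) \<and> card L = p}"
    using subgroup_incl[OF _ subgroup_centre] by (auto simp: central_Cp_iff)
qed

text \<open>By \<open>elementary_prime_square_sum\<close> for the centre, \<open>p * f x\<close> is
  the total of the sums over the lines minus the sum over the centre.\<close>

lemma zero_if_line_sums_zero:
  fixes f :: "'a \<Rightarrow> rat"
  assumes Zf: "\<forall>x\<in>carrier G. (\<Sum>z\<in>Z. f (z \<otimes> x)) = 0"
    and Kf: "\<And>K. K \<in> central_Cp_subgroups p G \<Longrightarrow> \<forall>x\<in>carrier G. (\<Sum>k\<in>K. f (k \<otimes> x)) = 0"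
    and x: "x \<in> carrier G"
  shows "f x = 0"
proof -
  interpret GZ: group "G\<lparr>carrier := Z\<rparr>" by (rule subgroup_imp_group) (rule subgroup_centre)
  have ord: "Coset.order (G\<lparr>carrier := Z\<rparr>) = p ^ 2" using card_centre by (simp add: Coset.order_def)
  have elem: "y [^]\<^bsub>G\<lparr>carrier := Z\<rparr>\<^esub> p = \<one>\<^bsub>G\<lparr>carrier := Z\<rparr>\<^esub>" if "y \<in> carrier (G\<lparr>carrier := Z\<rparr>)" for y
    using pow_centre[of y] that nat_pow_consistent[of y p Z] by simp
  have "(\<Sum>L\<in>{L. subgroup L (G\<lparr>carrier := Z\<rparr>) \<and> card L = p}. \<Sum>k\<in>L. f (k \<otimes> x))
      = of_nat p * f (\<one>\<^bsub>G\<lparr>carrier := Z\<rparr>\<^esub> \<otimes> x) + (\<Sum>k\<in>carrier (G\<lparr>carrier := Z\<rparr>). f (k \<otimes> x))"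
    by (rule GZ.elementary_prime_square_sum(2)[OF prime ord]) (rule elem)
  then have "(\<Sum>L\<in>central_Cp_subgroups p G. \<Sum>k\<in>L. f (k \<otimes> x)) = of_nat p * f x + (\<Sum>k\<in>Z. f (k \<otimes> x))"
    using x by (simp add: subgroups_centre)
  moreover have "(\<Sum>L\<in>central_Cp_subgroups p G. \<Sum>k\<in>L. f (k \<otimes> x)) = 0"
    using Kf x by (intro sum.neutral) blast
  moreover have "(\<Sum>k\<in>Z. f (k \<otimes> x)) = 0" using Zf x by blast
  ultimately show ?thesis using p0 by simp
qed

end

lemma (in normal) push_coset:
  assumes x: "x \<in> carrier G"
  shows "push G (\<lambda>x. H #> x) f (H #> x) = (\<Sum>h\<in>H. f (h \<otimes> x))"
  unfolding push_def
proof (rule sum.reindex_bij_witness[of _ "\<lambda>h. h \<otimes> x" "\<lambda>y. y \<otimes> inv x"])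
  fix y assume "y \<in> {y \<in> carrier G. H #> y = H #> x}"
  then have y: "y \<in> carrier G" "y \<in> H #> x" using rcos_self[OF _ subgroup_axioms, of y] by auto
  then show "y \<otimes> inv x \<in> H" using x by (simp add: rcos_module[OF is_group])
  show "y \<otimes> inv x \<otimes> x = y" using x y by (simp add: m_assoc)
  then show "f (y \<otimes> inv x \<otimes> x) = f y" by simp
next
  fix h assume h: "h \<in> H"
  then show "h \<otimes> x \<otimes> inv x = h" using x by (simp add: m_assoc)
  have "H #> (h \<otimes> x) = H #> x"
    using h x by (metis coset_join2 coset_mult_assoc mem_carrier subgroup_axioms subset)
  then show "h \<otimes> x \<in> {y \<in> carrier G. H #> y = H #> x}" using h x by simp
qed

section \<open>Assembly of the isomorphism from all components\<close>

context phi4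
begin

text \<open>The isomorphism sends \<open>f\<close> to its image in the algebra of \<open>G/Z\<close>
  and to all matrices \<open>rep_mat\<close>. The components form one family over \<open>I\<close>,
  to which \<open>joint_decomposition\<close> applies; \<open>h1\<close> and \<open>h2\<close>
  distribute it over the nested sums of the statement.\<close>

lemma rational_group_algebra:
  assumes \<zeta>: "\<And>d. 0 < d \<Longrightarrow> primitive_root_of_unity d (\<zeta> d)"
  defines "m \<equiv> \<lambda>K. group_exponent (quot_centre G K)"
    and "m' \<equiv> \<lambda>K. group_exponent (quot_centre_mod_derived G K)"
    and "a \<equiv> \<lambda>K d. num_cyclic_subgroups (quot_centre G K) d"
    and "a' \<equiv> \<lambda>K d. num_cyclic_subgroups (quot_centre_mod_derived G K) d"
  shows "alg_isomorphic (group_algebra G)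
    (group_algebra (G Mod commutator_subgroup G)
     \<oplus>\<^sub>a alg_Sum (central_Cp_subgroups p G) (\<lambda>K.
           alg_Sum {d. 0 < d \<and> d dvd m K \<and> \<not> d dvd m' K} (\<lambda>d.
             alg_copies (a K d) (matrix_algebra p (rat_adjoin (\<zeta> d)))))
     \<oplus>\<^sub>a alg_Sum (central_Cp_subgroups p G) (\<lambda>K.
           alg_Sum {d. 0 < d \<and> d dvd m K \<and> d dvd m' K} (\<lambda>d.
             alg_copies (a K d - a' K d) (matrix_algebra p (rat_adjoin (\<zeta> d))))))"
proof -
  define \<K> where "\<K> = central_Cp_subgroups p G"
  define D1 where "D1 K = {d. 0 < d \<and> d dvd m K \<and> \<not> d dvd m' K}" for K
  define D2 where "D2 K = {d. 0 < d \<and> d dvd m K \<and> d dvd m' K}" for K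
  \<comment> \<open>The index sets of both direct sums merged into one: \<open>d\<close> ranges over
    \<open>D1 K\<close> and \<open>D2 K\<close>, and \<open>i\<close> counts the copies.\<close>
  define J where "J K = {(d, i). 0 < d \<and> d dvd m K \<and> i < (if d dvd m' K then a K d - a' K d else a K d)}" for K
  define I where "I = Sigma \<K> J"
  have J_eq: "phi4_line.comp_index G K = J K" if "K \<in> \<K>" for K
    unfolding phi4_line.comp_index_def[OF line[OF that[unfolded \<K>_def]]] J_def m_def m'_def a_def a'_def by (rule refl)
  have "\<forall>K\<in>\<K>. \<exists>N R. phi4_line.line_components G p K \<zeta> N R"
    using phi4_line.exists_line_components[OF line \<zeta>] by (auto simp: \<K>_def)
  then obtain N R where comps: "\<And>K. K \<in> \<K> \<Longrightarrow> phi4_line.line_components G p K \<zeta> (N K) (R K)" by metis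
  have upper: "phi4_line.W G K = {g \<in> carrier G. \<forall>h\<in>carrier G. C g h \<in> K}" if "K \<in> \<K>" for K
    using phi4_line.W_def[OF line[of K]] that by (simp add: \<K>_def)
  have comps': "(\<forall>(d, i)\<in>J K. component_rep G p K (\<zeta> d) (N K (d, i)) (R K (d, i)) \<and>
        subgroup (N K (d, i)) G \<and> N K (d, i) \<inter> Z = K \<and> N K (d, i) \<subseteq> {g \<in> carrier G. \<forall>h\<in>carrier G. C g h \<in> K}) \<and>
     (\<forall>c\<in>J K. \<forall>c'\<in>J K. N K c \<subseteq> N K c' \<longrightarrow> c = c') \<and>
     (\<forall>f::'a \<Rightarrow> rat. (\<forall>x\<in>carrier G. (\<Sum>z\<in>Z. f (z \<otimes> x)) = 0) \<longrightarrow>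
        (\<forall>c\<in>J K. \<forall>x\<in>carrier G. (\<Sum>n\<in>N K c. f (n \<otimes> x)) = 0) \<longrightarrow>
        (\<forall>x\<in>carrier G. (\<Sum>k\<in>K. f (k \<otimes> x)) = 0))" if K: "K \<in> \<K>" for K
    using comps[OF K] unfolding phi4_line.line_components_def[OF line[OF K[unfolded \<K>_def]]] J_eq[OF K] upper[OF K] .
  have comp: "component_rep G p K (\<zeta> d) (N K (d, i)) (R K (d, i))" "subgroup (N K (d, i)) G"
    "N K (d, i) \<inter> Z = K" "N K (d, i) \<subseteq> {g \<in> carrier G. \<forall>h\<in>carrier G. C g h \<in> K}"
    if "K \<in> \<K>" "(d, i) \<in> J K" for K d i
    using comps'[OF that(1)] that(2) by blast+
  have distinct: "c = c'" if "K \<in> \<K>" "c \<in> J K" "c' \<in> J K" "N K c \<subseteq> N K c'" for K c c'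
    using comps'[OF that(1)] that(2-4) by blast
  have cover: "\<forall>x\<in>carrier G. (\<Sum>k\<in>K. f (k \<otimes> x)) = 0"
    if "K \<in> \<K>" "\<forall>x\<in>carrier G. (\<Sum>z\<in>Z. f (z \<otimes> x)) = 0" "\<forall>c\<in>J K. \<forall>x\<in>carrier G. (\<Sum>n\<in>N K c. f (n \<otimes> x)) = 0"
    for K and f :: "'a \<Rightarrow> rat"
    using comps'[OF that(1)] that(2,3) by blast
  have \<K>: "subgroup K G" "K \<subseteq> Z" "card K = p" if "K \<in> \<K>" for K
    using that by (auto simp: \<K>_def central_Cp_iff)
  have scalar: "\<exists>c. c \<noteq> 1 \<and> (\<forall>i'<p. \<forall>j<p. R K (d, i) w i' j = of_bool (i' = j) * c)"
    if "K \<in> \<K>" "(d, i) \<in> J K" "w \<in> carrier G" "\<forall>x\<in>carrier G. C w x \<in> K" "w \<notin> N K (d, i)" for K d i w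
    using component_repD(7)[OF comp(1)[OF that(1,2)]] that(3-5) by blast
  have scalar_Z: "\<exists>c. c \<noteq> 1 \<and> (\<forall>i'<p. \<forall>j<p. R K (d, i) w i' j = of_bool (i' = j) * c)"
    if K: "K \<in> \<K>" "(d, i) \<in> J K" and w: "w \<in> Z" "w \<notin> K" for K d i w
  proof (rule scalar[OF K])
    show "w \<in> carrier G" using w by simp
    show "\<forall>x\<in>carrier G. C w x \<in> K" using C_Z_left[OF w(1)] subgroup.one_closed[OF \<K>(1)[OF K(1)]] by simp
    show "w \<notin> N K (d, i)" using comp(3)[OF K] w by blast
  qed
  have fin_Z: "finite Z" using finite_subset[OF Z.subset fin] .
  define \<rho> where "\<rho> = (\<lambda>(K, c). R K c)"
  define F where "F = (\<lambda>(K :: 'a set, (d, i :: nat)). rat_adjoin (\<zeta> d))"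
  have Z_normal: "Z \<lhd> G" by (rule normal_centre)
  have finI: "finite I"
    unfolding I_def using finite_lines phi4_line.finite_comp_index[OF line] J_eq by (auto simp: \<K>_def)
  have joint: "\<exists>f\<in>carrier (group_algebra G). push G (\<lambda>x. Z #> x) f = r \<and> (\<forall>c\<in>I. rep_mat G p (\<rho> c) f = B c)"
    if "r \<in> carrier (group_algebra (G Mod Z))" "\<And>c. c \<in> I \<Longrightarrow> B c \<in> carrier (matrix_algebra p (F c))" for r B
  proof (rule joint_decomposition[OF fin Z_normal finI _ _ _ _ _ _ that, where N = "\<lambda>(K, c). N K c"])
    fix b assume "b \<in> I"
    then obtain K d i where b: "b = (K, (d, i))" and K: "K \<in> \<K>" "(d, i) \<in> J K" by (auto simp: I_def)
    show "\<forall>x\<in>carrier G. \<forall>y\<in>carrier G. \<forall>i<p. \<forall>k<p. \<rho> b (x \<otimes> y) i k = (\<Sum>j<p. \<rho> b x i j * \<rho> b y j k)"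
      using component_repD(1)[OF comp(1)[OF K]] by (simp add: b \<rho>_def)
    show "\<exists>f::'a \<Rightarrow> rat. \<forall>i<p. \<forall>j<p. (\<Sum>x\<in>carrier G. of_rat (f x) * \<rho> b x i j) = M i j"
      if "\<forall>i<p. \<forall>j<p. M i j \<in> F b" for M
      using component_repD(4)[OF comp(1)[OF K]] that unfolding b \<rho>_def F_def prod.case by blast
    show "subgroup (case b of (K, c) \<Rightarrow> N K c) G" using comp(2)[OF K] by (simp add: b)
    show "\<forall>x\<in>(case b of (K, c) \<Rightarrow> N K c). \<forall>i<p. \<forall>j<p. \<rho> b x i j = of_bool (i = j)"
      using component_repD(6)[OF comp(1)[OF K]] unfolding b \<rho>_def prod.case .
    have "\<not> Z \<subseteq> K"
      using card_mono[OF finite_subset[OF \<K>(2)[OF K(1)] fin_Z], of Z] \<K>(3)[OF K(1)] card_centre p1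
      by (auto simp: power2_eq_square)
    then obtain t where t: "t \<in> Z" "t \<notin> K" by blast
    show "\<exists>t\<in>Z. \<exists>c. c \<noteq> 1 \<and> (\<forall>i<p. \<forall>j<p. \<rho> b t i j = of_bool (i = j) * c)"
      using scalar_Z[OF K t] t(1) unfolding b \<rho>_def prod.case by blast
    \<comment> \<open>For \<open>K \<noteq> K'\<close> an element of \<open>K'\<close> outside
      \<open>K\<close> separates: it is central and lies in \<open>N K' (d', i')\<close>. For
      \<open>K = K'\<close> an element of the second \<open>N\<close> outside the first does; it
      exists because different such subgroups are not contained in each other.\<close>
    fix b' assume "b' \<in> I" and ne: "b \<noteq> b'"
    then obtain K' d' i' where b': "b' = (K', (d', i'))" and K': "K' \<in> \<K>" "(d', i') \<in> J K'" by (auto simp: I_def)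
    show "\<exists>t\<in>(case b' of (K, c) \<Rightarrow> N K c). \<exists>c. c \<noteq> 1 \<and> (\<forall>i<p. \<forall>j<p. \<rho> b t i j = of_bool (i = j) * c)"
    proof (cases "K = K'")
      case False
      have "\<not> K' \<subseteq> K"
        using card_subset_eq[OF finite_subset[OF \<K>(2)[OF K(1)] fin_Z], of K'] \<K>(3)[OF K(1)] \<K>(3)[OF K'(1)] False by auto
      then obtain t where t: "t \<in> K'" "t \<notin> K" by blast
      then have "t \<in> Z" "t \<in> N K' (d', i')" using \<K>(2)[OF K'(1)] comp(3)[OF K'] by blast+
      then show ?thesis using scalar_Z[OF K \<open>t \<in> Z\<close> t(2)] unfolding b b' \<rho>_def prod.case by blast
    next
      case True
      then have "(d', i') \<in> J K" "(d', i') \<noteq> (d, i)" using K' ne b b' by auto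
      then have "\<not> N K (d', i') \<subseteq> N K (d, i)" using distinct[OF K(1) _ K(2)] by blast
      then obtain t where t: "t \<in> N K (d', i')" "t \<notin> N K (d, i)" by blast
      then have "t \<in> carrier G" "\<forall>x\<in>carrier G. C t x \<in> K" using comp(4)[OF K(1) \<open>(d', i') \<in> J K\<close>] by blast+
      then show ?thesis using scalar[OF K _ _ t(2)] t(1) unfolding b b' \<rho>_def prod.case True[symmetric] by blast
    qed
  qed
  have hom_push: "alg_hom (group_algebra G) (group_algebra (G Mod Z)) (push G (\<lambda>x. Z #> x))"
  proof (rule alg_hom_push[OF _ fin])
    interpret n: normal Z G by (rule Z_normal)
    show "group_hom G (G Mod Z) (\<lambda>x. Z #> x)"
      by (intro group_hom.intro group_axioms n.factorgroup_is_group group_hom_axioms.intro n.r_coset_hom_Mod)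
    show "(\<lambda>x. Z #> x) ` carrier G = carrier (G Mod Z)" by (auto simp: FactGroup_def RCOSETS_def)
  qed
  have hom_rep: "alg_hom (group_algebra G) (matrix_algebra p (rat_adjoin (\<zeta> d))) (rep_mat G p (R K (d, i)))"
    if K: "K \<in> \<K>" "(d, i) \<in> J K" for K d i
    using component_repD(1-3)[OF comp(1)[OF K]] by (intro alg_hom_rep_mat[OF group_axioms fin]) simp_all
  define h1 where "h1 f = (\<lambda>K\<in>\<K>. \<lambda>d\<in>D1 K. \<lambda>i\<in>{..<a K d}. rep_mat G p (R K (d, i)) f)" for f
  define h2 where "h2 f = (\<lambda>K\<in>\<K>. \<lambda>d\<in>D2 K. \<lambda>i\<in>{..<a K d - a' K d}. rep_mat G p (R K (d, i)) f)" for f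
  define A1 where "A1 = alg_Sum \<K> (\<lambda>K. alg_Sum (D1 K) (\<lambda>d. alg_copies (a K d) (matrix_algebra p (rat_adjoin (\<zeta> d)))))"
  define A2 where "A2 = alg_Sum \<K> (\<lambda>K. alg_Sum (D2 K) (\<lambda>d. alg_copies (a K d - a' K d) (matrix_algebra p (rat_adjoin (\<zeta> d)))))"
  have J1: "(d, i) \<in> J K" if "d \<in> D1 K" "i < a K d" for K d i using that by (simp add: D1_def J_def)
  have J2: "(d, i) \<in> J K" if "d \<in> D2 K" "i < a K d - a' K d" for K d i using that by (simp add: D2_def J_def)
  have J_cases: "d \<in> D1 K \<and> i < a K d \<or> d \<in> D2 K \<and> i < a K d - a' K d" if "(d, i) \<in> J K" for K d i
    using that by (auto simp: D1_def D2_def J_def split: if_splits)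
  have hom1: "alg_hom (group_algebra G) A1 h1"
    unfolding A1_def h1_def alg_copies_def by (intro alg_hom_Sum hom_rep J1) auto
  have hom2: "alg_hom (group_algebra G) A2 h2"
    unfolding A2_def h2_def alg_copies_def by (intro alg_hom_Sum hom_rep J2) auto
  define h where "h f = (push G (\<lambda>x. Z #> x) f, h1 f, h2 f)" for f
  have hom: "alg_hom (group_algebra G) (group_algebra (G Mod Z) \<oplus>\<^sub>a A1 \<oplus>\<^sub>a A2) h"
    unfolding h_def by (intro alg_hom_sum hom_push hom1 hom2)
  have "inj_on h (carrier (group_algebra G))"
  proof (rule inj_onI)
    fix f f' assume f: "f \<in> carrier (group_algebra G)" "f' \<in> carrier (group_algebra G)" and eq: "h f = h f'"
    have rep_eq: "rep_mat G p (R K (d, i)) f = rep_mat G p (R K (d, i)) f'"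
      if K: "K \<in> \<K>" "(d, i) \<in> J K" for K d i
      using J_cases[OF K(2)]
    proof
      assume "d \<in> D1 K \<and> i < a K d"
      moreover have "h1 f K d i = h1 f' K d i" using eq by (simp add: h_def)
      ultimately show ?thesis using K by (simp add: h1_def)
    next
      assume "d \<in> D2 K \<and> i < a K d - a' K d"
      moreover have "h2 f K d i = h2 f' K d i" using eq by (simp add: h_def)
      ultimately show ?thesis using K by (simp add: h2_def)
    qed
    \<comment> \<open>By linearity the difference has zero image everywhere. Its sums over the
      cosets of the centre, of each \<open>N\<close>, of each \<open>K\<close>, and finally its
      values vanish in turn.\<close>
    define g where "g x = f x - f' x" for x
    have gZ: "\<forall>x\<in>carrier G. (\<Sum>z\<in>Z. g (z \<otimes> x)) = 0"
    proof
      fix x assume x: "x \<in> carrier G"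
      have "(\<Sum>z\<in>Z. f (z \<otimes> x)) = (\<Sum>z\<in>Z. f' (z \<otimes> x))"
        using eq by (simp add: h_def flip: normal.push_coset[OF Z_normal x])
      then show "(\<Sum>z\<in>Z. g (z \<otimes> x)) = 0" by (simp add: g_def sum_subtractf)
    qed
    have gN: "\<forall>c\<in>J K. \<forall>x\<in>carrier G. (\<Sum>n\<in>N K c. g (n \<otimes> x)) = 0" if K: "K \<in> \<K>" for K
    proof
      fix c assume "c \<in> J K"
      then obtain d i where c: "c = (d, i)" "(d, i) \<in> J K" by (cases c) auto
      have "(\<Sum>x\<in>carrier G. of_rat (g x) * R K c x i' j) = 0" if "i' < p" "j < p" for i' j
      proof -
        have "rep_mat G p (R K c) f $$ (i', j) = rep_mat G p (R K c) f' $$ (i', j)"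
          using rep_eq[OF K c(2)] c(1) by simp
        then show ?thesis
          using that by (simp add: rep_mat_def g_def of_rat_diff left_diff_distrib sum_subtractf)
      qed
      then show "\<forall>x\<in>carrier G. (\<Sum>n\<in>N K c. g (n \<otimes> x)) = 0"
        using component_repD(5)[OF comp(1)[OF K c(2)]] gZ unfolding c(1) by blast
    qed
    have "g x = 0" if "x \<in> carrier G" for x
      using cover[OF _ gZ gN] by (intro zero_if_line_sums_zero[OF gZ _ that]) (simp add: \<K>_def)
    then have "f x = f' x" for x
      using f by (cases "x \<in> carrier G") (auto simp: g_def group_algebra_simps)
    then show "f = f'" by blast
  qed
  moreover have "h ` carrier (group_algebra G) = carrier (group_algebra (G Mod Z) \<oplus>\<^sub>a A1 \<oplus>\<^sub>a A2)"
  proof (intro equalityI subsetI)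
    fix y assume "y \<in> h ` carrier (group_algebra G)"
    then show "y \<in> carrier (group_algebra (G Mod Z) \<oplus>\<^sub>a A1 \<oplus>\<^sub>a A2)" using alg_homD(1)[OF hom] by blast
  next
    fix y assume "y \<in> carrier (group_algebra (G Mod Z) \<oplus>\<^sub>a A1 \<oplus>\<^sub>a A2)"
    then obtain r S1 S2 where y: "y = (r, S1, S2)" and r: "r \<in> carrier (group_algebra (G Mod Z))"
      and S1: "S1 \<in> carrier A1" and S2: "S2 \<in> carrier A2" by (auto simp: alg_sum_simps)
    \<comment> \<open>\<open>D1 K\<close> and \<open>D2 K\<close> are disjoint, so \<open>d\<close>
      decides from which of the two sums the target matrix is taken.\<close>
    define B where "B = (\<lambda>(K, (d, i)). if d \<in> D1 K then S1 K d i else S2 K d i)"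
    have S1': "S1 \<in> (\<Pi>\<^sub>E K\<in>\<K>. \<Pi>\<^sub>E d\<in>D1 K. \<Pi>\<^sub>E i\<in>{..<a K d}. carrier (matrix_algebra p (rat_adjoin (\<zeta> d))))"
      using S1 by (simp add: A1_def alg_copies_simps)
    have S2': "S2 \<in> (\<Pi>\<^sub>E K\<in>\<K>. \<Pi>\<^sub>E d\<in>D2 K. \<Pi>\<^sub>E i\<in>{..<a K d - a' K d}. carrier (matrix_algebra p (rat_adjoin (\<zeta> d))))"
      using S2 by (simp add: A2_def alg_copies_simps)
    have "B c \<in> carrier (matrix_algebra p (F c))" if cI: "c \<in> I" for c
    proof -
      obtain K d i where c: "c = (K, (d, i))" "K \<in> \<K>" "(d, i) \<in> J K" using cI by (auto simp: I_def)
      show ?thesis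
        using J_cases[OF c(3)]
      proof
        assume "d \<in> D1 K \<and> i < a K d"
        then show ?thesis using PiE_mem[OF PiE_mem[OF PiE_mem[OF S1' c(2)], of d], of i] by (simp add: B_def F_def c(1))
      next
        assume di: "d \<in> D2 K \<and> i < a K d - a' K d"
        then have "d \<notin> D1 K" by (simp add: D1_def D2_def)
        then show ?thesis
          using di PiE_mem[OF PiE_mem[OF PiE_mem[OF S2' c(2)], of d], of i] by (simp add: B_def F_def c(1))
      qed
    qed
    then obtain f where f: "f \<in> carrier (group_algebra G)" "push G (\<lambda>x. Z #> x) f = r"
      "\<And>c. c \<in> I \<Longrightarrow> rep_mat G p (\<rho> c) f = B c" using joint[OF r, of B] by blast
    have rep_f: "rep_mat G p (R K (d, i)) f = B (K, (d, i))" if "K \<in> \<K>" "(d, i) \<in> J K" for K d i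
      using f(3)[of "(K, (d, i))"] that by (simp add: I_def \<rho>_def)
    have "h1 f = S1"
      unfolding h1_def
    proof (rule restrict_eq_PiE[OF S1'])
      fix K assume K: "K \<in> \<K>"
      show "(\<lambda>d\<in>D1 K. \<lambda>i\<in>{..<a K d}. rep_mat G p (R K (d, i)) f) = S1 K"
      proof (rule restrict_eq_PiE[OF PiE_mem[OF S1' K]])
        fix d assume d: "d \<in> D1 K"
        show "(\<lambda>i\<in>{..<a K d}. rep_mat G p (R K (d, i)) f) = S1 K d"
          by (rule restrict_eq_PiE[OF PiE_mem[OF PiE_mem[OF S1' K] d]]) (simp add: rep_f[OF K J1[OF d]] B_def d)
      qed
    qed
    moreover have "h2 f = S2"
      unfolding h2_def
    proof (rule restrict_eq_PiE[OF S2'])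
      fix K assume K: "K \<in> \<K>"
      show "(\<lambda>d\<in>D2 K. \<lambda>i\<in>{..<a K d - a' K d}. rep_mat G p (R K (d, i)) f) = S2 K"
      proof (rule restrict_eq_PiE[OF PiE_mem[OF S2' K]])
        fix d assume d: "d \<in> D2 K"
        then have "d \<notin> D1 K" by (simp add: D1_def D2_def)
        then show "(\<lambda>i\<in>{..<a K d - a' K d}. rep_mat G p (R K (d, i)) f) = S2 K d"
          by (intro restrict_eq_PiE[OF PiE_mem[OF PiE_mem[OF S2' K] d]]) (simp add: rep_f[OF K J2[OF d]] B_def)
      qed
    qed
    ultimately show "y \<in> h ` carrier (group_algebra G)" using f y by (auto simp: h_def)
  qed
  ultimately have "h \<in> ring_iso (group_algebra G) (group_algebra (G Mod Z) \<oplus>\<^sub>a A1 \<oplus>\<^sub>a A2)"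
    using hom by (simp add: ring_iso_def alg_hom_def bij_betw_def)
  then have "alg_isomorphic (group_algebra G) (group_algebra (G Mod Z) \<oplus>\<^sub>a A1 \<oplus>\<^sub>a A2)"
    using hom unfolding alg_isomorphic_def alg_hom_def by blast
  then show ?thesis unfolding derived_eq A1_def A2_def D1_def D2_def \<K>_def .
qed

end

theorem theorem33:
  fixes G :: "('a, 'b) monoid_scheme" and p :: nat and \<zeta> :: "nat \<Rightarrow> complex"
    and m m' :: "'a set \<Rightarrow> nat" and a a' :: "'a set \<Rightarrow> nat \<Rightarrow> nat"
  assumes "Factorial_Ring.prime p" and "odd p"
    and "group G" and "Coset.order G = p ^ 5" and "in_phi4 p G"
    and "\<And>d. 0 < d \<Longrightarrow> primitive_root_of_unity d (\<zeta> d)"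
  defines "m \<equiv> \<lambda>K. group_exponent (quot_centre G K)"
    and "m' \<equiv> \<lambda>K. group_exponent (quot_centre_mod_derived G K)"
    and "a \<equiv> \<lambda>K d. num_cyclic_subgroups (quot_centre G K) d"
    and "a' \<equiv> \<lambda>K d. num_cyclic_subgroups (quot_centre_mod_derived G K) d"
  shows "alg_isomorphic (group_algebra G)
    (group_algebra (G Mod commutator_subgroup G)
     \<oplus>\<^sub>a alg_Sum (central_Cp_subgroups p G) (\<lambda>K.
           alg_Sum {d. 0 < d \<and> d dvd m K \<and> \<not> d dvd m' K} (\<lambda>d.
             alg_copies (a K d) (matrix_algebra p (rat_adjoin (\<zeta> d)))))
     \<oplus>\<^sub>a alg_Sum (central_Cp_subgroups p G) (\<lambda>K.
           alg_Sum {d. 0 < d \<and> d dvd m K \<and> d dvd m' K} (\<lambda>d.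
             alg_copies (a K d - a' K d) (matrix_algebra p (rat_adjoin (\<zeta> d))))))"
proof -
  note struct = phi4_structure[OF assms(1,3,4,5)]
  interpret phi4 G p
    by (intro phi4.intro phi4_axioms.intro assms(1-4) struct)
  show ?thesis unfolding m_def m'_def a_def a'_def by (rule rational_group_algebra) (rule assms(6))
qed

end
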